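(* Let $d=2$, let $E\subset[1,2]$ be nonempty, and let $\beta=\dim_{\mathrm M}E$ be its upper Minkowski dimension. Let $\Delta_\beta\subset[0,1]^2$ be the closed triangle with vertices $$P_1=(0,0),\quad P_{2,\beta}=\big(\tfrac1{1+\beta},\tfrac1{1+\beta}\big),\quad P^{\mathrm{rad}}_{3,\beta}=\big(\tfrac2{3+\beta},\tfrac1{3+\beta}\big).$$ Then $$\overline{\mathcal T_E^{\mathrm{rad}}}=\Delta_\beta\cap\Big\{(\tfrac1p,\tfrac1q):\ \tfrac1q\,\nu^\sharp(\tfrac q2-1)+\tfrac1p-\tfrac1q\le\tfrac12\Big\},$$ where the point $(0,0)$ (the only point of $\Delta_\beta$ with $\frac1q=0$) is understood to belong to the set on the right.
   Context: For $f\in L^1_{\mathrm{loc}}(\mathbb R^d)$ and $t>0$, $A_tf(x)$ is the average of $f$ over the sphere of radius $t$ centered at $x$ (with respect to normalized surface measure). For $E\subset[1,2]$, $M_Ef(x)=\sup_{t\in E}|A_tf(x)|$. $L^p_{\mathrm{rad}}\subset L^p(\mathbb R^d)$ is the space of radial $L^p$ functions. "$M_E:L^p_{\mathrm{rad}}\to L^q$" means there is $C<\infty$ with $\|M_Ef\|_{L^q(\mathbb R^d)}\le C\|f\|_{L^p(\mathbb R^d)}$ for all $f\in L^p_{\mathrm{rad}}$. The radial type set is $\mathcal T_E^{\mathrm{rad}}=\{(\frac1p,\frac1q)\in[0,1]^2: M_E:L^p_{\mathrm{rad}}\to L^q\}$, and the bar denotes closure. For a set $F\subset[1,2]$ and $\delta\in(0,1)$,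 $N(F,\delta)$ is the minimum number of intervals of length $\delta$ required to cover $F$, and $\dim_{\mathrm M}E=\limsup_{\delta\to0}\frac{\log N(E,\delta)}{\log(1/\delta)}$. For $\alpha\in\mathbb R$, $$\nu^\sharp(\alpha)=\limsup_{\delta\to0}\frac{\log\sup_{\delta\le|J|\le1}|J|^{-\alpha}N(E\cap J,\delta)}{\log(1/\delta)},$$ the inner supremum being over intervals $J\subset[1,2]$ with length $|J|\in[\delta,1]$. *)

theory Defs
  imports "HOL-Analysis.Analysis"
begin

section \<open>Spherical averages and maximal functions in the plane\<close>

text \<open>The point of the circle of radius t about x in direction theta. As theta runs through
  [0, 2 pi], normalized arc length is the normalized Lebesgue measure in theta.\<close>

definition circle_pt :: "real^2 \<Rightarrow> real \<Rightarrow> real \<Rightarrow> real^2" where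
  "circle_pt x t \<theta> = x + t *\<^sub>R vector [cos \<theta>, sin \<theta>]"

definition circle_avg :: "real \<Rightarrow> (real^2 \<Rightarrow> complex) \<Rightarrow> real^2 \<Rightarrow> complex" where
  "circle_avg t f x =
     (1 / (2 * pi)) *\<^sub>R (LINT \<theta>:{0..2*pi}|lebesgue. f (circle_pt x t \<theta>))"

text \<open>The Bochner integral of a non-integrable function is 0, so the absolute value of the average
  is set to infinity explicitly when f is not integrable over the circle. For a Lebesgue measurable
  radial f and x not 0, neither integrability nor the average changes if f is replaced by another
  radial function that is almost everywhere equal to it, so the maximal function below
  is well defined almost everywhere on classes of radial functions.\<close>

definition abs_circle_avg :: "real \<Rightarrow> (real^2 \<Rightarrow> complex) \<Rightarrow> real^2 \<Rightarrow> ennreal" where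
  "abs_circle_avg t f x =
     (if set_integrable lebesgue {0..2*pi} (\<lambda>\<theta>. f (circle_pt x t \<theta>))
      then ennreal (cmod (circle_avg t f x)) else \<infinity>)"

definition max_fun :: "real set \<Rightarrow> (real^2 \<Rightarrow> complex) \<Rightarrow> real^2 \<Rightarrow> ennreal" where
  "max_fun E f x = (SUP t\<in>E. abs_circle_avg t f x)"

section \<open>Lebesgue norms and the radial type set\<close>

text \<open>Only used with exponent r > 0.\<close>

definition ennreal_powr :: "ennreal \<Rightarrow> real \<Rightarrow> ennreal" where
  "ennreal_powr y r = (if y = \<infinity> then \<infinity> else ennreal (enn2real y powr r))"

definition Lp_norm :: "ennreal \<Rightarrow> (real^2 \<Rightarrow> ennreal) \<Rightarrow> ennreal" where
  "Lp_norm p g =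
     (if p = \<infinity> then Inf {c. AE x in lebesgue. g x \<le> c}
      else ennreal_powr (\<integral>\<^sup>+x. ennreal_powr (g x) (enn2real p) \<partial>lebesgue) (1 / enn2real p))"

definition radial :: "(real^2 \<Rightarrow> complex) \<Rightarrow> bool" where
  "radial f \<longleftrightarrow> (\<forall>x y. norm x = norm y \<longrightarrow> f x = f y)"

definition Lp_rad :: "ennreal \<Rightarrow> (real^2 \<Rightarrow> complex) set" where
  "Lp_rad p = {f. f \<in> borel_measurable lebesgue \<and> radial f \<and>
                  Lp_norm p (\<lambda>x. ennreal (cmod (f x))) < \<infinity>}"

definition max_bounded_rad :: "real set \<Rightarrow> ennreal \<Rightarrow> ennreal \<Rightarrow> bool" where
  "max_bounded_rad E p q \<longleftrightarrow>
     (\<exists>C::real. \<forall>f\<in>Lp_rad p.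
        Lp_norm q (max_fun E f) \<le> ennreal C * Lp_norm p (\<lambda>x. ennreal (cmod (f x))))"

definition radial_type_set :: "real set \<Rightarrow> (real \<times> real) set" where
  "radial_type_set E =
     {(enn2real (1 / p), enn2real (1 / q)) | p q. 1 \<le> p \<and> 1 \<le> q \<and> max_bounded_rad E p q}"

section \<open>Dimensional quantities of the dilation set\<close>

definition covering_number :: "real set \<Rightarrow> real \<Rightarrow> nat" where
  "covering_number F \<delta> =
     (LEAST n. \<exists>A. finite A \<and> card A = n \<and> F \<subseteq> (\<Union>a\<in>A. {a..a+\<delta>}))"

definition upper_minkowski_dim :: "real set \<Rightarrow> ereal" where
  "upper_minkowski_dim E =
     Limsup (at_right 0) (\<lambda>\<delta>. ereal (ln (real (covering_number E \<delta>)) / ln (1 / \<delta>)))"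

text \<open>For nonempty E within [1,2] and 0 < \<open>\<delta>\<close> < 1 the supremum is over a nonempty, bounded set of
  reals and is positive.\<close>

definition nu_sharp :: "real set \<Rightarrow> real \<Rightarrow> ereal" where
  "nu_sharp E \<alpha> =
     Limsup (at_right 0) (\<lambda>\<delta>. ereal (
       ln (SUP (a, b)\<in>{(a, b). 1 \<le> a \<and> b \<le> 2 \<and> \<delta> \<le> b - a \<and> b - a \<le> 1}.
             (b - a) powr (-\<alpha>) * real (covering_number (E \<inter> {a..b}) \<delta>))
       / ln (1 / \<delta>)))"

definition radial_triangle :: "real \<Rightarrow> (real \<times> real) set" where
  "radial_triangle \<beta> =
     convex hull {(0, 0), (1 / (1 + \<beta>), 1 / (1 + \<beta>)), (2 / (3 + \<beta>), 1 / (3 + \<beta>))}"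

end

theory Submission
  imports Defs
begin

text \<open>
  With \<open>w = |x|\<^sup>2\<close> as radial variable, Lebesgue measure of the plane becomes \<open>\<pi> dw\<close> and the circle of radius
  \<open>t\<close> about a point at distance \<open>r\<close> from the origin is \<open>w = r\<^sup>2 + t\<^sup>2 - 2 r t cos \<theta>\<close>, so that \<open>2 r t sin \<theta> d\<theta> = dw\<close>.

  Sufficiency: a pointwise three-exponent Hoelder inequality with weights \<open>sin \<theta>\<close> bounds \<open>|A\<^sub>t f(r)|\<^sup>q\<close> by an
  integral of \<open>|f|\<^sup>p\<close> against a power of \<open>sin \<theta>\<close>, that is, against powers of \<open>|w - (r \<plusminus> t)\<^sup>2| / r\<close>.
  Decomposed dyadically, the supremum over \<open>t \<in> E\<close> acts only on indicator functions, and by Tonelli everything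
  reduces to bounding, uniformly in \<open>w\<close>, the measure of the set of \<open>r\<close> with \<open>|w - (r \<plusminus> t)\<^sup>2| < 8 r 2\<^sup>-\<^sup>k\<close> for some
  \<open>t \<in> E\<close>. These measures are covering numbers of \<open>E\<close>, and of \<open>E \<inter> J\<close> with \<open>|J| \<sim> r\<close> for small \<open>r\<close>.

  Necessity: test on indicator functions of large balls (\<open>p \<le> q\<close>), of thin annuli seen from the origin
  (\<open>q \<le> 2 p\<close>), of small balls (the edge through \<open>P\<^sub>2\<close> and \<open>P\<^sub>3\<close>) and of thin annuli seen from distance \<open>|J|\<close>
  (the condition involving \<open>\<nu>\<^sup>\<sharp>\<close>).

  The closure: at each scale the \<open>\<nu>\<^sup>\<sharp>\<close>-condition is affine in \<open>(1/p, 1/q)\<close>, so mixing a point of the right-hand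
  side with a fixed point at which all conditions are strict makes them strict there.
\<close>

section \<open>Covering numbers\<close>

text \<open>Write u = 1/p, v = 1/q and normalise f in L^p. Hoelder splits |f| into three factors
  with weights v, u - v, 1 - u: the first keeps a kernel, the second is absorbed by the
  normalisation, the third is the integral of sin^(-e), finite because e < 1. The critical choice e
  = 1 would give the kernel exponent \<open>A\<close>; taking e < 1 costs an arbitrarily small
  power, and so does every dyadic sum. All losses are paid from the single gain
  \<open>\<eta>\<close>, which is available only where the conditions hold strictly. This is why the
  closure is what gets described.

  The geometric obstacle is the square root: w close to (r - t)^2 locates |r - t| to the same
  precision when that number is bounded below, but only to the square root of the precision when the
  circle passes near the origin. The square root scale turns the count of all of E into a condition
  with exponent 2 A, the edge through P_2 and P_3. For small r the relevant t are confined to an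
  interval of length about r, and the weight r^(1 - P) then produces the condition with
  nu-sharp.\<close>

lemma bounded_interval_cover:
  fixes F :: "real set"
  assumes "F \<subseteq> {a..a+L}" "0 < \<delta>" "0 \<le> L"
  shows "\<exists>A. finite A \<and> real (card A) \<le> L / \<delta> + 1 \<and> F \<subseteq> (\<Union>x\<in>A. {x..x+\<delta>})"
proof (intro exI conjI)
  let ?n = "nat \<lfloor>L/\<delta>\<rfloor>"
  let ?A = "(\<lambda>i::nat. a + real i * \<delta>) ` {..?n}"
  show "finite ?A" by simp
  have L0: "0 \<le> L / \<delta>" using assms by simp
  have "card ?A \<le> card {..?n}" by (rule card_image_le) simp
  also have "\<dots> = ?n + 1" by simp
  finally have "real (card ?A) \<le> real ?n + 1" by linarith
  also have "real ?n \<le> L / \<delta>" using L0 by (simp add: of_nat_floor)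
  finally show "real (card ?A) \<le> L / \<delta> + 1" by simp
  show "F \<subseteq> (\<Union>x\<in>?A. {x..x+\<delta>})"
  proof
    fix x assume "x \<in> F"
    then have x: "a \<le> x" "x \<le> a + L" using assms(1) by auto
    define i where "i = nat \<lfloor>(x-a)/\<delta>\<rfloor>"
    have nn: "0 \<le> (x-a)/\<delta>" using x assms by simp
    have ri: "real i = of_int \<lfloor>(x-a)/\<delta>\<rfloor>" using nn by (simp add: i_def)
    have "i \<le> ?n" unfolding i_def using x assms
      by (intro nat_mono floor_mono divide_right_mono) auto
    moreover have "real i \<le> (x-a)/\<delta>" "(x-a)/\<delta> \<le> real i + 1" unfolding ri by linarith+
    then have "a + real i * \<delta> \<le> x" "x \<le> a + real i * \<delta> + \<delta>"
      using assms(2) by (auto simp: field_simps)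
    ultimately show "x \<in> (\<Union>x\<in>?A. {x..x+\<delta>})" by auto
  qed
qed

lemma covering_number_le:
  assumes "finite A" "F \<subseteq> (\<Union>a\<in>A. {a..a+\<delta>})"
  shows "covering_number F \<delta> \<le> card A"
  unfolding covering_number_def using assms by (intro Least_le) blast

lemma covering_number_attained:
  assumes "F \<subseteq> {a..b::real}" "0 < \<delta>"
  obtains A where "finite A" "card A = covering_number F \<delta>" "F \<subseteq> (\<Union>a\<in>A. {a..a+\<delta>})"
proof -
  have "F \<subseteq> {a..a + \<bar>b-a\<bar>}" using assms(1) by fastforce
  from bounded_interval_cover[OF this assms(2)]
  obtain A where "finite A" "F \<subseteq> (\<Union>x\<in>A. {x..x+\<delta>})" by auto
  then have "\<exists>n A. finite A \<and> card A = n \<and> F \<subseteq> (\<Union>a\<in>A. {a..a+\<delta>})" by blast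
  from LeastI_ex[OF this] show ?thesis
    unfolding covering_number_def[symmetric] using that by blast
qed

lemma covering_number_mono:
  assumes "F \<subseteq> G" "G \<subseteq> {a..b::real}" "0 < \<delta>"
  shows "covering_number F \<delta> \<le> covering_number G \<delta>"
proof -
  obtain A where "finite A" "card A = covering_number G \<delta>" "G \<subseteq> (\<Union>a\<in>A. {a..a+\<delta>})"
    using covering_number_attained[OF assms(2,3)] .
  then show ?thesis using covering_number_le[of A F \<delta>] assms(1) by auto
qed

lemma covering_number_interval_le:
  assumes "F \<subseteq> {a..a+L::real}" "0 < \<delta>" "\<delta> \<le> L"
  shows "real (covering_number F \<delta>) \<le> 2 * L / \<delta>"
proof -
  obtain A where A: "finite A" "real (card A) \<le> L / \<delta> + 1" "F \<subseteq> (\<Union>x\<in>A. {x..x+\<delta>})"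
    using bounded_interval_cover[OF assms(1,2)] assms by auto
  have "1 \<le> L / \<delta>" using assms by simp
  then show ?thesis using covering_number_le[OF A(1,3)] A(2) by simp
qed

lemma covering_number_pos:
  assumes "F \<subseteq> {a..b::real}" "0 < \<delta>" "F \<noteq> {}"
  shows "1 \<le> covering_number F \<delta>"
proof -
  obtain A where "finite A" "card A = covering_number F \<delta>" "F \<subseteq> (\<Union>a\<in>A. {a..a+\<delta>})"
    using covering_number_attained[OF assms(1,2)] .
  then show ?thesis using assms(3) by (cases "covering_number F \<delta>") auto
qed

lemma open_translates:
  fixes F :: "real set"
  shows "open {r. \<exists>t\<in>F. \<bar>r - (c + \<sigma> * t)\<bar> < \<epsilon>}"
proof -
  have "{r. \<exists>t\<in>F. \<bar>r - (c + \<sigma> * t)\<bar> < \<epsilon>} = (\<Union>t\<in>F. ball (c + \<sigma> * t) \<epsilon>)"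
    by (auto simp: dist_real_def abs_minus_commute)
  then show ?thesis by auto
qed

text \<open>Thickening a covering interval of length \<open>\<delta>\<close> by
  \<open>K * \<delta>\<close> on both sides gives length \<open>(2 * K + 1) * \<delta>\<close>. The
  sign \<open>\<sigma>\<close> admits both translates and reflections of F, as the two kinds of
  tangency require.\<close>

lemma emeasure_translates_le:
  fixes F :: "real set"
  assumes F: "F \<subseteq> {a..b}" and \<delta>: "0 < \<delta>" and K: "0 \<le> K" and \<sigma>: "\<bar>\<sigma>\<bar> = 1"
  shows "emeasure lborel {r. \<exists>t\<in>F. \<bar>r - (c + \<sigma> * t)\<bar> < K * \<delta>}
         \<le> ennreal ((2 * K + 1) * (\<delta> * real (covering_number F \<delta>)))"
proof -
  obtain A where A: "finite A" "card A = covering_number F \<delta>" "F \<subseteq> (\<Union>x\<in>A. {x..x+\<delta>})"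
    using covering_number_attained[OF F \<delta>] .
  \<comment> \<open>For either sign, the image of \<open>{x..x+\<delta>}\<close> under t -> c +
    \<open>\<sigma>\<close> t has midpoint c + \<open>\<sigma>\<close> x + \<open>\<sigma>\<close>
    \<open>\<delta>\<close> / 2; its half-length plus \<open>K * \<delta>\<close> is
    \<open>(K + 1/2) * \<delta>\<close>.\<close>
  let ?I = "\<lambda>x. {c + \<sigma> * x + \<sigma> * \<delta> / 2 - (K + 1/2) * \<delta> .. c + \<sigma> * x + \<sigma> * \<delta> / 2 + (K + 1/2) * \<delta>}"
  have "{r. \<exists>t\<in>F. \<bar>r - (c + \<sigma> * t)\<bar> < K * \<delta>} \<subseteq> (\<Union>x\<in>A. ?I x)"
  proof safe
    fix r t assume t: "t \<in> F" "\<bar>r - (c + \<sigma> * t)\<bar> < K * \<delta>"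
    then obtain x where x: "x \<in> A" "x \<le> t" "t \<le> x + \<delta>" using A(3) by fastforce
    have s: "\<sigma> = 1 \<or> \<sigma> = -1" using \<sigma> by auto
    have "r \<in> ?I x" using s t(2) x by (auto simp: algebra_simps abs_less_iff)
    then show "r \<in> (\<Union>x\<in>A. ?I x)" using x(1) by blast
  qed
  then have "emeasure lborel {r. \<exists>t\<in>F. \<bar>r - (c + \<sigma> * t)\<bar> < K * \<delta>} \<le> emeasure lborel (\<Union>x\<in>A. ?I x)"
    using A(1) by (intro emeasure_mono) (auto intro!: sets.finite_UN)
  also have "\<dots> \<le> (\<Sum>x\<in>A. emeasure lborel (?I x))"
    using A(1) by (intro emeasure_subadditive_finite) auto
  also have "\<dots> = (\<Sum>x\<in>A. ennreal ((2*K+1) * \<delta>))"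
    using \<delta> K by (intro sum.cong refl, subst emeasure_lborel_Icc) (auto simp: algebra_simps)
  also have "\<dots> = ennreal ((2 * K + 1) * (\<delta> * real (covering_number F \<delta>)))"
    using A(2) \<delta> K by (simp add: ennreal_of_nat_eq_real_of_nat ennreal_mult'[symmetric] algebra_simps)
  finally show ?thesis .
qed

text \<open>The cells of the grid of mesh \<open>\<delta>\<close> that meet F cover F, so there are
  at least \<open>covering_number F \<delta>\<close> of them. The images of the open cells are
  disjoint, have length \<open>\<delta>\<close>, and lie within \<open>2 * \<delta>\<close> of the
  images of points of F.\<close>

lemma emeasure_translates_ge:
  fixes F :: "real set"
  assumes F: "F \<subseteq> {a..b}" and \<delta>: "0 < \<delta>" and \<sigma>: "\<bar>\<sigma>\<bar> = 1"
  shows "ennreal (\<delta> * real (covering_number F \<delta>))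
         \<le> emeasure lborel {r. \<exists>t\<in>F. \<bar>r - (c + \<sigma> * t)\<bar> < 2 * \<delta>}"
proof -
  define Z where "Z = (\<lambda>t. \<lfloor>t/\<delta>\<rfloor>) ` F"
  have "Z \<subseteq> {\<lfloor>a/\<delta>\<rfloor>..\<lfloor>b/\<delta>\<rfloor>}"
    using F \<delta> unfolding Z_def by (auto intro!: floor_mono divide_right_mono dest!: subsetD)
  then have finZ: "finite Z" by (rule finite_subset) simp
  have cell: "of_int \<lfloor>t/\<delta>\<rfloor> * \<delta> \<le> t" "t < of_int \<lfloor>t/\<delta>\<rfloor> * \<delta> + \<delta>" for t
  proof -
    have "of_int \<lfloor>t/\<delta>\<rfloor> \<le> t/\<delta>" "t/\<delta> < of_int \<lfloor>t/\<delta>\<rfloor> + 1" by linarith+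
    then show "of_int \<lfloor>t/\<delta>\<rfloor> * \<delta> \<le> t" "t < of_int \<lfloor>t/\<delta>\<rfloor> * \<delta> + \<delta>"
      using \<delta> by (simp_all only: pos_le_divide_eq pos_divide_less_eq distrib_right mult_1)
  qed
  have "F \<subseteq> (\<Union>a\<in>(\<lambda>z. of_int z * \<delta>) ` Z. {a..a+\<delta>})"
    unfolding Z_def using cell by (force intro: less_imp_le)
  from covering_number_le[OF _ this] finZ
  have "covering_number F \<delta> \<le> card ((\<lambda>z. of_int z * \<delta>) ` Z)" by simp
  also have "\<dots> \<le> card Z" using finZ by (rule card_image_le)
  finally have N: "covering_number F \<delta> \<le> card Z" .
  have s: "\<sigma> = 1 \<or> \<sigma> = -1" using \<sigma> by auto
  let ?I = "\<lambda>z. {r. of_int z * \<delta> < \<sigma> * (r - c) \<and> \<sigma> * (r - c) < of_int z * \<delta> + \<delta>}"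
  have I: "?I z = (if \<sigma> = 1 then {c + of_int z * \<delta> <..< c + of_int z * \<delta> + \<delta>}
              else {c - of_int z * \<delta> - \<delta> <..< c - of_int z * \<delta>})" for z
    using s by auto
  have disj: "disjoint_family_on ?I Z"
  proof (unfold disjoint_family_on_def, intro ballI impI)
    fix z z' assume "z \<in> Z" "z' \<in> Z" "z \<noteq> z'"
    show "?I z \<inter> ?I z' = {}"
    proof (rule ccontr)
      assume "?I z \<inter> ?I z' \<noteq> {}"
      then obtain r where r: "r \<in> ?I z" "r \<in> ?I z'" by auto
      then have "of_int z * \<delta> < (of_int z' + 1) * \<delta>" "of_int z' * \<delta> < (of_int z + 1) * \<delta>"
        by (auto simp: algebra_simps)
      then have "of_int z < (of_int z' + 1 :: real)" "of_int z' < (of_int z + 1 :: real)"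
        using \<delta> by auto
      with \<open>z \<noteq> z'\<close> show False by linarith
    qed
  qed
  have sets: "?I z \<in> sets lborel" for z unfolding I by auto
  have "ennreal (\<delta> * real (covering_number F \<delta>)) \<le> ennreal (\<delta> * real (card Z))"
    using N \<delta> by (intro ennreal_leI mult_left_mono) auto
  also have "\<dots> = (\<Sum>z\<in>Z. emeasure lborel (?I z))"
  proof -
    have "emeasure lborel (?I z) = ennreal \<delta>" for z unfolding I using \<delta> by simp
    then show ?thesis
      using \<delta> by (simp add: ennreal_of_nat_eq_real_of_nat ennreal_mult'[symmetric] mult.commute)
  qed
  also have "\<dots> = emeasure lborel (\<Union>z\<in>Z. ?I z)"
    using finZ disj sets by (intro sum_emeasure) auto
  also have "\<dots> \<le> emeasure lborel {r. \<exists>t\<in>F. \<bar>r - (c + \<sigma> * t)\<bar> < 2 * \<delta>}"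
  proof (rule emeasure_mono)
    show "(\<Union>z\<in>Z. ?I z) \<subseteq> {r. \<exists>t\<in>F. \<bar>r - (c + \<sigma> * t)\<bar> < 2 * \<delta>}"
    proof
      fix r assume "r \<in> (\<Union>z\<in>Z. ?I z)"
      then obtain t where t: "t \<in> F" "r \<in> ?I \<lfloor>t/\<delta>\<rfloor>" unfolding Z_def by blast
      have "\<bar>r - (c + \<sigma> * t)\<bar> < 2 * \<delta>" using s t(2) cell[of t] \<delta> by (auto simp: abs_less_iff)
      with t(1) show "r \<in> {r. \<exists>t\<in>F. \<bar>r - (c + \<sigma> * t)\<bar> < 2 * \<delta>}" by blast
    qed
    show "{r. \<exists>t\<in>F. \<bar>r - (c + \<sigma> * t)\<bar> < 2 * \<delta>} \<in> sets lborel"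
      using open_translates[of F c \<sigma> "2*\<delta>"] by simp
  qed
  finally show ?thesis .
qed

section \<open>Radial functions and circle averages\<close>

lemma distr_norm_square:
  "distr lborel borel (\<lambda>x::real^2. (norm x)\<^sup>2) = density lborel (\<lambda>w. ennreal pi * indicator {0..} w)"
proof (rule measure_eqI_generator_eq[where E = "range (\<lambda>a::real. {..a})" and \<Omega> = UNIV and A = "\<lambda>n::nat. {..real n}"])
  have ball: "emeasure lborel {x::real^2. (norm x)\<^sup>2 \<le> a} = ennreal (pi * max 0 a)" for a :: real
  proof (cases "0 \<le> a")
    case True
    have "(norm x)\<^sup>2 \<le> a \<longleftrightarrow> norm x \<le> sqrt a" for x :: "real^2"
      using real_sqrt_le_iff[of "(norm x)\<^sup>2" a] by simp
    then have "{x::real^2. (norm x)\<^sup>2 \<le> a} = cball 0 (sqrt a)"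
      by (intro set_eqI) (simp only: mem_Collect_eq mem_cball dist_0_norm)
    then show ?thesis using True
      by (simp add: emeasure_cball unit_ball_vol_2)
  next
    case False
    then have "{x::real^2. (norm x)\<^sup>2 \<le> a} = {}" by (auto simp: not_le intro: less_le_trans)
    then show ?thesis using False by (simp add: max_def)
  qed
  show "Int_stable (range (\<lambda>a::real. {..a}))" by (auto simp: Int_stable_def)
  show "sets (distr lborel borel (\<lambda>x::real^2. (norm x)\<^sup>2)) = sigma_sets UNIV (range (\<lambda>a::real. {..a}))"
       "sets (density lborel (\<lambda>w. ennreal pi * indicator {0..} w)) = sigma_sets UNIV (range (\<lambda>a::real. {..a}))"
    by (simp_all add: borel_eq_atMost)
  have L: "emeasure (distr lborel borel (\<lambda>x::real^2. (norm x)\<^sup>2)) {..a} = ennreal (pi * max 0 a)" for a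
    using ball[of a] by (subst emeasure_distr) (auto simp: vimage_def)
  show "emeasure (distr lborel borel (\<lambda>x::real^2. (norm x)\<^sup>2)) {..real n} \<noteq> \<infinity>" for n unfolding L by simp
  have R: "emeasure (density lborel (\<lambda>w. ennreal pi * indicator {0..} w)) {..a} = ennreal (pi * max 0 a)" for a :: real
  proof -
    have "emeasure (density lborel (\<lambda>w. ennreal pi * indicator {0..} w)) {..a}
        = (\<integral>\<^sup>+w. ennreal pi * indicator {0..a} w \<partial>lborel)"
      by (subst emeasure_density) (auto intro!: nn_integral_cong split: split_indicator)
    also have "\<dots> = ennreal pi * emeasure lborel {0..a}" by (rule nn_integral_cmult_indicator) simp
    also have "\<dots> = ennreal (pi * max 0 a)" by (cases "0 \<le> a") (auto simp: ennreal_mult')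
    finally show ?thesis .
  qed
  show "emeasure (distr lborel borel (\<lambda>x::real^2. (norm x)\<^sup>2)) X = emeasure (density lborel (\<lambda>w. ennreal pi * indicator {0..} w)) X"
    if "X \<in> range (\<lambda>a::real. {..a})" for X
    using that L R by auto
  show "(\<Union>i::nat. {..real i}) = UNIV" using real_arch_simple by auto
qed auto

lemma nn_integral_norm_square:
  fixes g :: "real \<Rightarrow> ennreal"
  assumes [measurable]: "g \<in> borel_measurable borel"
  shows "(\<integral>\<^sup>+x. g ((norm x)\<^sup>2) \<partial>(lborel :: (real^2) measure))
       = ennreal pi * (\<integral>\<^sup>+w. g w * indicator {0..} w \<partial>lborel)"
proof -
  have "(\<integral>\<^sup>+x. g ((norm x)\<^sup>2) \<partial>(lborel :: (real^2) measure))
      = (\<integral>\<^sup>+w. g w \<partial>(distr lborel borel (\<lambda>x::real^2. (norm x)\<^sup>2)))"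
    by (subst nn_integral_distr) auto
  also have "\<dots> = (\<integral>\<^sup>+w. ennreal pi * (g w * indicator {0..} w) \<partial>lborel)"
    unfolding distr_norm_square
    by (subst nn_integral_density) (auto intro!: nn_integral_cong simp: mult_ac)
  also have "\<dots> = ennreal pi * (\<integral>\<^sup>+w. g w * indicator {0..} w \<partial>lborel)"
    by (rule nn_integral_cmult) auto
  finally show ?thesis .
qed

text \<open>The substitution w = r^2 is made on the compact intervals \<open>{0..real n}\<close>,
  where n = 0 is degenerate with both integrals zero; both sides are then exhausted by monotone
  convergence.\<close>

lemma nn_integral_square_substitution:
  fixes g :: "real \<Rightarrow> ennreal"
  assumes [measurable]: "g \<in> borel_measurable borel"
  shows "(\<integral>\<^sup>+w. g w * indicator {0..} w \<partial>lborel)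
       = (\<integral>\<^sup>+r. g (r\<^sup>2) * ennreal (2 * r) * indicator {0..} r \<partial>lborel)"
proof -
  have sup1: "(SUP n. indicator {0..(real n)\<^sup>2} w :: ennreal) = indicator {0..} w" for w :: real
  proof (rule antisym)
    show "(SUP n. indicator {0..(real n)\<^sup>2} w :: ennreal) \<le> indicator {0..} w"
      by (rule SUP_least) (auto split: split_indicator)
    obtain n :: nat where n: "sqrt \<bar>w\<bar> \<le> real n" using real_arch_simple by blast
    then have "\<bar>w\<bar> \<le> (real n)\<^sup>2" using power_mono[OF n, of 2] by simp
    then have "indicator {0..} w \<le> (indicator {0..(real n)\<^sup>2} w :: ennreal)" by (auto split: split_indicator)
    then show "indicator {0..} w \<le> (SUP n. indicator {0..(real n)\<^sup>2} w :: ennreal)" by (rule SUP_upper2[OF UNIV_I])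
  qed
  have sup2: "(SUP n. indicator {0..(real n)} w :: ennreal) = indicator {0..} w" for w :: real
  proof (rule antisym)
    show "(SUP n. indicator {0..(real n)} w :: ennreal) \<le> indicator {0..} w"
      by (rule SUP_least) (auto split: split_indicator)
    obtain n :: nat where n: "w \<le> real n" using real_arch_simple by blast
    then have "indicator {0..} w \<le> (indicator {0..(real n)} w :: ennreal)" by (auto split: split_indicator)
    then show "indicator {0..} w \<le> (SUP n. indicator {0..(real n)} w :: ennreal)" by (rule SUP_upper2[OF UNIV_I])
  qed
  have "(\<integral>\<^sup>+w. g w * indicator {0..} w \<partial>lborel) = (\<integral>\<^sup>+w. (SUP n. g w * indicator {0..(real n)\<^sup>2} w) \<partial>lborel)"
    by (simp only: sup1 SUP_mult_left_ennreal[symmetric])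
  also have "\<dots> = (SUP n. \<integral>\<^sup>+w. g w * indicator {0..(real n)\<^sup>2} w \<partial>lborel)"
  proof (intro nn_integral_monotone_convergence_SUP)
    show "incseq (\<lambda>n w. g w * indicator {0..(real n)\<^sup>2} w)"
    proof (intro incseq_SucI le_funI mult_left_mono)
      fix n :: nat and w :: real
      have "(real n)\<^sup>2 \<le> (real (Suc n))\<^sup>2" by (intro power_mono) auto
      then have "w \<le> (real n)\<^sup>2 \<Longrightarrow> w \<le> (real (Suc n))\<^sup>2" by linarith
      then show "indicator {0..(real n)\<^sup>2} w \<le> (indicator {0..(real (Suc n))\<^sup>2} w :: ennreal)"
        by (auto split: split_indicator simp del: of_nat_Suc)
    qed simp
  qed simp
  also have "\<dots> = (SUP n. \<integral>\<^sup>+r. g (r\<^sup>2) * ennreal (2 * r) * indicator {0..real n} r \<partial>lborel)"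
  proof (rule SUP_cong[OF refl])
    fix n :: nat
    show "(\<integral>\<^sup>+w. g w * indicator {0..(real n)\<^sup>2} w \<partial>lborel)
        = (\<integral>\<^sup>+r. g (r\<^sup>2) * ennreal (2 * r) * indicator {0..real n} r \<partial>lborel)"
    proof (cases "n = 0")
      case True
      have "(\<integral>\<^sup>+w. g w * indicator {0..(real n)\<^sup>2} w \<partial>lborel) = (\<integral>\<^sup>+(w::real). 0 \<partial>lborel)"
        by (intro nn_integral_cong_AE AE_I'[of "{0}"]) (auto simp: True split: split_indicator)
      moreover have "(\<integral>\<^sup>+r. g (r\<^sup>2) * ennreal (2 * r) * indicator {0..real n} r \<partial>lborel) = (\<integral>\<^sup>+(w::real). 0 \<partial>lborel)"
        by (intro nn_integral_cong_AE AE_I'[of "{0}"]) (auto simp: True split: split_indicator)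
      ultimately show ?thesis by simp
    next
      case False
      then have "0 < real n" by simp
      have "((\<lambda>r. r\<^sup>2) has_real_derivative 2 * x) (at x)" for x :: real
        by (auto intro!: derivative_eq_intros)
      moreover have "continuous_on {0..real n} (\<lambda>r. 2 * r)" by (intro continuous_intros)
      ultimately have "(\<integral>\<^sup>+w. g w * indicator {0\<^sup>2..(real n)\<^sup>2} w \<partial>lborel)
        = (\<integral>\<^sup>+r. g (r\<^sup>2) * ennreal (2 * r) * indicator {0..real n} r \<partial>lborel)"
        using \<open>0 < real n\<close> by (intro nn_integral_substitution_aux) auto
      then show ?thesis by simp
    qed
  qed
  also have "\<dots> = (\<integral>\<^sup>+r. (SUP n. g (r\<^sup>2) * ennreal (2 * r) * indicator {0..real n} r) \<partial>lborel)"
    by (intro nn_integral_monotone_convergence_SUP[symmetric])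
       (auto simp: incseq_def le_fun_def split: split_indicator)
  also have "\<dots> = (\<integral>\<^sup>+r. g (r\<^sup>2) * ennreal (2 * r) * indicator {0..} r \<partial>lborel)"
    by (simp only: sup2 SUP_mult_left_ennreal[symmetric])
  finally show ?thesis .
qed

lemma nn_integral_polar:
  fixes g :: "real \<Rightarrow> ennreal"
  assumes [measurable]: "g \<in> borel_measurable borel"
  shows "(\<integral>\<^sup>+x. g (norm x) \<partial>(lborel :: (real^2) measure))
       = ennreal pi * (\<integral>\<^sup>+r. g r * ennreal (2 * r) * indicator {0..} r \<partial>lborel)"
proof -
  have "(\<integral>\<^sup>+x. g (norm x) \<partial>(lborel :: (real^2) measure))
      = (\<integral>\<^sup>+x. g (sqrt ((norm x)\<^sup>2)) \<partial>(lborel :: (real^2) measure))" by simp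
  also have "\<dots> = ennreal pi * (\<integral>\<^sup>+r. g (sqrt (r\<^sup>2)) * ennreal (2 * r) * indicator {0..} r \<partial>lborel)"
    by (subst nn_integral_norm_square[of "\<lambda>w. g (sqrt w)"], simp)
       (subst nn_integral_square_substitution, simp_all)
  also have "\<dots> = ennreal pi * (\<integral>\<^sup>+r. g r * ennreal (2 * r) * indicator {0..} r \<partial>lborel)"
    by (intro arg_cong[where f = "\<lambda>x. ennreal pi * x"] nn_integral_cong) (auto split: split_indicator)
  finally show ?thesis .
qed

text \<open>The image of a Lebesgue set under |x|^2 need not be Borel, but images of sigma-compact
  sets are. Hence S and its complement are both approximated from inside by sigma-compact sets, and
  the squared radii reached by neither approximation form a null set.\<close>

lemma radial_set_borel_mod_null:
  fixes S :: "(real^2) set"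
  assumes S: "S \<in> sets lebesgue" and rad: "\<And>x y. norm x = norm y \<Longrightarrow> x \<in> S \<longleftrightarrow> y \<in> S"
  obtains B N where "B \<in> sets borel" "N \<in> null_sets lborel"
    "\<And>x. (norm x)\<^sup>2 \<notin> N \<Longrightarrow> x \<in> S \<longleftrightarrow> (norm x)\<^sup>2 \<in> B"
proof -
  let ?P = "\<lambda>x::real^2. (norm x)\<^sup>2"
  have img: "?P ` C \<in> sets borel" if "fsigma C" for C
  proof -
    obtain F :: "nat \<Rightarrow> (real^2) set" where F: "range F \<subseteq> Collect compact" "C = \<Union>(range F)"
      using fsigma_Union_compact \<open>fsigma C\<close> by metis
    have "compact (?P ` F i)" for i
      using F(1) by (intro compact_continuous_image continuous_intros) auto
    then have "?P ` F i \<in> sets borel" for i by (intro borel_closed compact_imp_closed)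
    moreover have "?P ` C = (\<Union>i. ?P ` F i)" unfolding F(2) by auto
    ultimately show ?thesis by auto
  qed
  obtain C T where C: "fsigma C" "T \<in> null_sets lebesgue" "C \<union> T = S"
    using lebesgue_set_almost_fsigma[OF S] by metis
  have "- S \<in> sets lebesgue" using sets.compl_sets[OF S] by (simp add: Compl_eq_Diff_UNIV)
  then obtain C' T' where C': "fsigma C'" "T' \<in> null_sets lebesgue" "C' \<union> T' = - S"
    using lebesgue_set_almost_fsigma by metis
  \<comment> \<open>A point over \<open>N\<close> lies in neither inner approximation, hence in one
    of the null remainders \<open>T\<close>, \<open>T'\<close>. Since |x|^2 carries Lebesgue measure
    to pi dw, \<open>N\<close> itself is then null.\<close>
  define N where "N = {0..} - ?P ` C - ?P ` C'"
  have Nb[measurable]: "N \<in> sets borel" unfolding N_def using img[OF C(1)] img[OF C'(1)] by auto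
  have "{x. ?P x \<in> N} \<subseteq> T \<union> T'" using C(3) C'(3) unfolding N_def by auto
  moreover have "T \<union> T' \<in> null_sets lebesgue" using C(2) C'(2) by auto
  ultimately have "{x. ?P x \<in> N} \<in> null_sets lebesgue" by (rule null_sets_completion_subset)
  moreover have Ns: "{x. ?P x \<in> N} \<in> sets lborel"
    using measurable_sets[of ?P "lborel" borel N] by (simp add: vimage_def)
  ultimately have null: "emeasure lborel {x. ?P x \<in> N} = 0"
    using null_sets_completion_iff by blast
  have "ennreal pi * emeasure lborel N = ennreal pi * (\<integral>\<^sup>+w. indicator N w * indicator {0..} w \<partial>lborel)"
  proof -
    have "(\<integral>\<^sup>+w. indicator N w * indicator {0..} w \<partial>lborel) = (\<integral>\<^sup>+w. indicator N w \<partial>lborel)"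
      by (intro nn_integral_cong) (auto simp: N_def split: split_indicator)
    then show ?thesis by simp
  qed
  also have "\<dots> = (\<integral>\<^sup>+x. indicator N (?P x) \<partial>lborel)"
    by (rule nn_integral_norm_square[symmetric]) simp
  also have "\<dots> = (\<integral>\<^sup>+x. indicator {x. ?P x \<in> N} x \<partial>lborel)"
    by (intro nn_integral_cong) (auto split: split_indicator)
  also have "\<dots> = 0" using Ns null by simp
  finally have "N \<in> null_sets lborel" by (auto simp: null_sets_def)
  moreover have "x \<in> S \<longleftrightarrow> ?P x \<in> ?P ` C" if "?P x \<notin> N" for x
  proof
    assume "?P x \<in> ?P ` C"
    then obtain y where "y \<in> C" "norm x = norm y" by auto
    then show "x \<in> S" using rad C(3) by blast
  next
    assume x: "x \<in> S"
    have "?P x \<notin> ?P ` C'"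
    proof
      assume "?P x \<in> ?P ` C'"
      then obtain y where "y \<in> C'" "norm x = norm y" by auto
      then show False using rad C'(3) x by blast
    qed
    then show "?P x \<in> ?P ` C" using that unfolding N_def by auto
  qed
  ultimately show ?thesis using that img[OF C(1)] by blast
qed

text \<open>The profile is read off along a ray. The ray is a null set of the plane, so its
  measurability has to come from radiality: preimages of open sets are radial sets, to which the
  previous lemma applies. Finally the Lebesgue measurable profile is replaced by a Borel
  version.\<close>

lemma radial_fun_borel_mod_null:
  fixes f :: "real^2 \<Rightarrow> complex"
  assumes f: "f \<in> borel_measurable lebesgue" and rad: "radial f"
  obtains \<phi> N where "\<phi> \<in> borel_measurable borel" "N \<in> null_sets lborel"
    "\<And>x. (norm x)\<^sup>2 \<notin> N \<Longrightarrow> f x = \<phi> ((norm x)\<^sup>2)"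
proof -
  define e :: "real \<Rightarrow> real^2" where "e w = sqrt w *\<^sub>R axis 1 1" for w
  have e: "(norm (e w))\<^sup>2 = w" if "0 \<le> w" for w
    using that by (simp add: e_def norm_axis_1)
  define \<phi>0 where "\<phi>0 w = (if 0 \<le> w then f (e w) else 0)" for w
  have "\<phi>0 \<in> borel_measurable lebesgue"
  proof (rule borel_measurableI)
    fix U :: "complex set" assume "open U"
    then have "f -` U \<in> sets lebesgue" using f measurable_sets[OF f, of U] by simp
    moreover have "norm x = norm y \<Longrightarrow> x \<in> f -` U \<longleftrightarrow> y \<in> f -` U" for x y
      using rad unfolding radial_def vimage_eq by metis
    ultimately obtain B N where BN: "B \<in> sets borel" "N \<in> null_sets lborel"
      "\<And>x. (norm x)\<^sup>2 \<notin> N \<Longrightarrow> x \<in> f -` U \<longleftrightarrow> (norm x)\<^sup>2 \<in> B"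
      by (rule radial_set_borel_mod_null) auto
    let ?X = "\<phi>0 -` U \<inter> {0..}"
    have "w \<in> ?X \<longleftrightarrow> w \<in> B" if "0 \<le> w" "w \<notin> N" for w
      using BN(3)[of "e w"] e[OF that(1)] that by (auto simp: \<phi>0_def)
    then have X: "?X = (B \<inter> {0..} - N) \<union> (?X \<inter> N)" by auto
    have "?X \<inter> N \<in> null_sets lebesgue"
      using null_sets_completion_subset[of "?X \<inter> N" N lborel] BN(2) null_sets_completionI by blast
    moreover have "B \<inter> {0..} - N \<in> sets lebesgue" using BN by auto
    ultimately have "?X \<in> sets lebesgue" by (subst X) auto
    moreover have "\<phi>0 -` U \<inter> {..<0} = (if 0 \<in> U then {..<0} else {})"
      by (auto simp: \<phi>0_def)
    then have "\<phi>0 -` U \<inter> {..<0} \<in> sets lebesgue" by simp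
    ultimately have "?X \<union> (\<phi>0 -` U \<inter> {..<0}) \<in> sets lebesgue" by blast
    moreover have "?X \<union> (\<phi>0 -` U \<inter> {..<0}) = \<phi>0 -` U \<inter> space lebesgue" by auto
    ultimately show "\<phi>0 -` U \<inter> space lebesgue \<in> sets lebesgue" by simp
  qed
  then have "(\<lambda>w. Re (\<phi>0 w)) \<in> borel_measurable lebesgue" "(\<lambda>w. Im (\<phi>0 w)) \<in> borel_measurable lebesgue"
    by (auto intro: borel_measurable_Re borel_measurable_Im)
  from this[THEN completion_ex_borel_measurable_real]
  obtain a b where ab[measurable]: "a \<in> borel_measurable lborel" "b \<in> borel_measurable lborel"
    and ae: "AE w in lborel. Re (\<phi>0 w) = a w" "AE w in lborel. Im (\<phi>0 w) = b w" by auto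
  have "AE w in lborel. \<phi>0 w = Complex (a w) (b w)"
    using ae by eventually_elim (auto simp: complex_eq_iff)
  then obtain N where N: "{w \<in> space lborel. \<phi>0 w \<noteq> Complex (a w) (b w)} \<subseteq> N" "N \<in> null_sets lborel"
    unfolding eventually_ae_filter by blast
  show ?thesis
  proof (rule that[of "\<lambda>w. Complex (a w) (b w)" N])
    have "(\<lambda>w. Complex (a w) (b w)) = (\<lambda>w. of_real (a w) + \<i> * of_real (b w))"
      by (simp add: complex_eq_iff fun_eq_iff)
    then show "(\<lambda>w. Complex (a w) (b w)) \<in> borel_measurable borel"
      using ab by (simp add: measurable_lborel1)
    show "N \<in> null_sets lborel" by fact
    fix x :: "real^2" assume x: "(norm x)\<^sup>2 \<notin> N"
    have "norm x = norm (e ((norm x)\<^sup>2))" by (simp add: e_def norm_axis_1)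
    then have "f x = f (e ((norm x)\<^sup>2))" using rad unfolding radial_def by blast
    then have "f x = \<phi>0 ((norm x)\<^sup>2)" unfolding \<phi>0_def by simp
    also have "\<dots> = Complex (a ((norm x)\<^sup>2)) (b ((norm x)\<^sup>2))" using x N(1) by auto
    finally show "f x = Complex (a ((norm x)\<^sup>2)) (b ((norm x)\<^sup>2))" .
  qed
qed

section \<open>Integrals over circles as integrals in the angle and in the squared radius\<close>

lemma nn_integral_periodic_shift:
  fixes h :: "real \<Rightarrow> ennreal"
  assumes [measurable]: "h \<in> borel_measurable borel" and per: "\<And>\<theta>. h (\<theta> + P) = h \<theta>"
    and c: "0 \<le> c" "c \<le> P"
  shows "(\<integral>\<^sup>+\<theta>. h (\<theta> - c) * indicator {0..P} \<theta> \<partial>lborel) = (\<integral>\<^sup>+\<theta>. h \<theta> * indicator {0..P} \<theta> \<partial>lborel)"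
proof -
  have "(\<integral>\<^sup>+\<theta>. h (\<theta> - c) * indicator {0..P} \<theta> \<partial>lborel) = (\<integral>\<^sup>+\<theta>. h \<theta> * indicator {0..P} (c + \<theta>) \<partial>lborel)"
    using nn_integral_real_affine[of "\<lambda>\<theta>. h (\<theta> - c) * indicator {0..P} \<theta>" 1 c] by simp
  also have "\<dots> = (\<integral>\<^sup>+\<theta>. h \<theta> * indicator {-c..<0} \<theta> + h \<theta> * indicator {0..P-c} \<theta> \<partial>lborel)"
    using c by (intro nn_integral_cong) (auto split: split_indicator)
  also have "\<dots> = (\<integral>\<^sup>+\<theta>. h \<theta> * indicator {-c..<0} \<theta> \<partial>lborel) + (\<integral>\<^sup>+\<theta>. h \<theta> * indicator {0..P-c} \<theta> \<partial>lborel)"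
    by (intro nn_integral_add) auto
  also have "(\<integral>\<^sup>+\<theta>. h \<theta> * indicator {-c..<0} \<theta> \<partial>lborel)
      = (\<integral>\<^sup>+\<theta>. h (-P + \<theta>) * indicator {-c..<0} (-P + \<theta>) \<partial>lborel)"
    using nn_integral_real_affine[of "\<lambda>\<theta>. h \<theta> * indicator {-c..<0} \<theta>" 1 "-P"] by simp
  also have "\<dots> = (\<integral>\<^sup>+\<theta>. h \<theta> * indicator {P-c..<P} \<theta> \<partial>lborel)"
    using per[of "\<theta> - P" for \<theta>] by (intro nn_integral_cong) (auto split: split_indicator)
  also have "\<dots> + (\<integral>\<^sup>+\<theta>. h \<theta> * indicator {0..P-c} \<theta> \<partial>lborel)
      = (\<integral>\<^sup>+\<theta>. h \<theta> * indicator {P-c..<P} \<theta> + h \<theta> * indicator {0..P-c} \<theta> \<partial>lborel)"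
    by (intro nn_integral_add[symmetric]) auto
  also have "\<dots> = (\<integral>\<^sup>+\<theta>. h \<theta> * indicator {0..P} \<theta> \<partial>lborel)"
  proof (intro nn_integral_cong_AE AE_I'[of "{P, P-c}"])
    show "{\<theta> \<in> space lborel. h \<theta> * indicator {P-c..<P} \<theta> + h \<theta> * indicator {0..P-c} \<theta>
        \<noteq> h \<theta> * indicator {0..P} \<theta>} \<subseteq> {P, P-c}"
      using c by (auto split: split_indicator)
  qed (auto intro: finite_imp_null_set_lborel)
  finally show ?thesis .
qed

text \<open>The two half periods contribute equally, whence the factor 2. The minus sign is chosen
  so that the squared radius along the circle increases with the angle on [0, pi].\<close>

lemma nn_integral_cos_shift:
  fixes H :: "real \<Rightarrow> ennreal"
  assumes [measurable]: "H \<in> borel_measurable borel" and c: "0 \<le> c" "c \<le> 2 * pi"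
  shows "(\<integral>\<^sup>+\<theta>. H (cos (\<theta> - c)) * indicator {0..2*pi} \<theta> \<partial>lborel)
       = 2 * (\<integral>\<^sup>+\<theta>. H (- cos \<theta>) * indicator {0..pi} \<theta> \<partial>lborel)"
proof -
  have "(\<integral>\<^sup>+\<theta>. H (cos (\<theta> - c)) * indicator {0..2*pi} \<theta> \<partial>lborel)
      = (\<integral>\<^sup>+\<theta>. H (cos \<theta>) * indicator {0..2*pi} \<theta> \<partial>lborel)"
    by (rule nn_integral_periodic_shift) (use c in auto)
  also have "\<dots> = (\<integral>\<^sup>+\<theta>. H (cos \<theta>) * indicator {0..<pi} \<theta> + H (cos \<theta>) * indicator {pi..2*pi} \<theta> \<partial>lborel)"
    by (intro nn_integral_cong) (auto split: split_indicator)
  also have "\<dots> = (\<integral>\<^sup>+\<theta>. H (cos \<theta>) * indicator {0..<pi} \<theta> \<partial>lborel)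
                + (\<integral>\<^sup>+\<theta>. H (cos \<theta>) * indicator {pi..2*pi} \<theta> \<partial>lborel)"
    by (intro nn_integral_add) auto
  also have "(\<integral>\<^sup>+\<theta>. H (cos \<theta>) * indicator {pi..2*pi} \<theta> \<partial>lborel)
      = (\<integral>\<^sup>+\<theta>. H (- cos \<theta>) * indicator {0..pi} \<theta> \<partial>lborel)"
  proof -
    have "(\<integral>\<^sup>+\<theta>. H (cos \<theta>) * indicator {pi..2*pi} \<theta> \<partial>lborel)
        = (\<integral>\<^sup>+\<theta>. H (cos (pi + \<theta>)) * indicator {pi..2*pi} (pi + \<theta>) \<partial>lborel)"
      using nn_integral_real_affine[of "\<lambda>\<theta>. H (cos \<theta>) * indicator {pi..2*pi} \<theta>" 1 pi] by simp
    also have "\<dots> = (\<integral>\<^sup>+\<theta>. H (- cos \<theta>) * indicator {0..pi} \<theta> \<partial>lborel)"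
      by (intro nn_integral_cong) (auto simp: cos_add split: split_indicator)
    finally show ?thesis .
  qed
  also have "(\<integral>\<^sup>+\<theta>. H (cos \<theta>) * indicator {0..<pi} \<theta> \<partial>lborel)
      = (\<integral>\<^sup>+\<theta>. H (- cos \<theta>) * indicator {0..pi} \<theta> \<partial>lborel)"
  proof -
    have "(\<integral>\<^sup>+\<theta>. H (cos \<theta>) * indicator {0..<pi} \<theta> \<partial>lborel)
        = (\<integral>\<^sup>+\<theta>. H (cos (pi - \<theta>)) * indicator {0..<pi} (pi - \<theta>) \<partial>lborel)"
      using nn_integral_real_affine[of "\<lambda>\<theta>. H (cos \<theta>) * indicator {0..<pi} \<theta>" "-1" pi] by simp
    also have "\<dots> = (\<integral>\<^sup>+\<theta>. H (- cos \<theta>) * indicator {0..pi} \<theta> \<partial>lborel)"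
    proof (intro nn_integral_cong_AE AE_I'[of "{0}"])
      show "{\<theta> \<in> space lborel. H (cos (pi - \<theta>)) * indicator {0..<pi} (pi - \<theta>)
          \<noteq> H (- cos \<theta>) * indicator {0..pi} \<theta>} \<subseteq> {0}"
        by (auto simp: cos_diff split: split_indicator)
    qed auto
    finally show ?thesis .
  qed
  finally show ?thesis unfolding mult_2 .
qed

lemma norm_circle_pt:
  fixes x :: "real^2"
  obtains c where "0 \<le> c" "c \<le> 2 * pi"
    "\<And>t \<theta>. (norm (circle_pt x t \<theta>))\<^sup>2 = (norm x)\<^sup>2 + t\<^sup>2 + 2 * norm x * t * cos (\<theta> - c)"
proof -
  have nx: "(norm y)\<^sup>2 = (y$1)\<^sup>2 + (y$2)\<^sup>2" for y :: "real^2"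
    unfolding power2_norm_eq_inner inner_vec_def sum_2 by (simp add: power2_eq_square)
  obtain c where c: "0 \<le> c" "c \<le> 2 * pi" "x$1 = norm x * cos c" "x$2 = norm x * sin c"
  proof (cases "x = 0")
    case True
    then show ?thesis using that[of 0] by simp
  next
    case False
    then have "(x$1 / norm x)\<^sup>2 + (x$2 / norm x)\<^sup>2 = 1"
      by (simp add: power_divide add_divide_distrib[symmetric] nx[symmetric])
    then obtain c where "0 \<le> c" "c < 2 * pi" "x$1 / norm x = cos c" "x$2 / norm x = sin c"
      by (rule sincos_total_2pi)
    then show ?thesis using that[of c] False by (auto simp: field_simps)
  qed
  have "(norm (circle_pt x t \<theta>))\<^sup>2 = (norm x)\<^sup>2 + t\<^sup>2 + 2 * norm x * t * cos (\<theta> - c)" for t \<theta>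
  proof -
    have ident: "(a + t * c)\<^sup>2 + (b + t * s)\<^sup>2 = (a\<^sup>2 + b\<^sup>2) + t\<^sup>2 * (c\<^sup>2 + s\<^sup>2) + 2 * t * (a * c + b * s)"
      for a b c s :: real by (simp add: power2_eq_square algebra_simps)
    have "(norm (circle_pt x t \<theta>))\<^sup>2 = (x$1 + t * cos \<theta>)\<^sup>2 + (x$2 + t * sin \<theta>)\<^sup>2"
      unfolding nx by (simp add: circle_pt_def)
    also have "(x$1 + t * cos \<theta>)\<^sup>2 + (x$2 + t * sin \<theta>)\<^sup>2 = ((x$1)\<^sup>2 + (x$2)\<^sup>2) + t\<^sup>2 * ((cos \<theta>)\<^sup>2 + (sin \<theta>)\<^sup>2)
        + 2 * t * (x$1 * cos \<theta> + x$2 * sin \<theta>)"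
      by (rule ident)
    also have "\<dots> = (norm x)\<^sup>2 + t\<^sup>2 + 2 * norm x * t * cos (\<theta> - c)"
      unfolding nx[symmetric] unfolding c(3,4) by (simp add: cos_diff algebra_simps)
    finally show ?thesis .
  qed
  with c that show ?thesis by blast
qed

lemma borel_measurable_norm_circle_pt:
  "(\<lambda>\<theta>. (norm (circle_pt x t \<theta>))\<^sup>2) \<in> borel_measurable borel"
proof -
  obtain c where c: "\<And>\<theta>. (norm (circle_pt x t \<theta>))\<^sup>2 = (norm x)\<^sup>2 + t\<^sup>2 + 2 * norm x * t * cos (\<theta> - c)"
    using norm_circle_pt[of x] by metis
  show ?thesis unfolding c by measurable
qed

text \<open>The law of cosines: the squared distance to the origin from the point of the circle of
  radius t about a point at distance r, with \<open>\<theta>\<close> measured from the direction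
  towards the origin. The ends 0 and pi give (r - t)^2 and (r + t)^2, the two tangencies with
  circles about the origin.\<close>

abbreviation chord_sq :: "real \<Rightarrow> real \<Rightarrow> real \<Rightarrow> real" where
  "chord_sq r t \<theta> \<equiv> r\<^sup>2 + t\<^sup>2 - 2 * r * t * cos \<theta>"

lemma nn_integral_circle:
  fixes H :: "real \<Rightarrow> ennreal" and x :: "real^2"
  assumes [measurable]: "H \<in> borel_measurable borel"
  shows "(\<integral>\<^sup>+\<theta>. H ((norm (circle_pt x t \<theta>))\<^sup>2) * indicator {0..2*pi} \<theta> \<partial>lborel)
       = 2 * (\<integral>\<^sup>+\<theta>. H (chord_sq (norm x) t \<theta>) * indicator {0..pi} \<theta> \<partial>lborel)"
proof -
  obtain c where c: "0 \<le> c" "c \<le> 2 * pi"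
    "\<And>\<theta>. (norm (circle_pt x t \<theta>))\<^sup>2 = (norm x)\<^sup>2 + t\<^sup>2 + 2 * norm x * t * cos (\<theta> - c)"
    using norm_circle_pt[of x] by metis
  show ?thesis unfolding c(3)
    using nn_integral_cos_shift[OF _ c(1,2), of "\<lambda>y. H ((norm x)\<^sup>2 + t\<^sup>2 + 2 * norm x * t * y)"] by simp
qed

lemma nn_integral_cosine_substitution:
  fixes H :: "real \<Rightarrow> ennreal"
  assumes [measurable]: "H \<in> borel_measurable borel" and rt: "0 < r" "0 < t"
  shows "(\<integral>\<^sup>+\<theta>. H (chord_sq r t \<theta>) * ennreal (2 * r * t * sin \<theta>) * indicator {0..pi} \<theta> \<partial>lborel)
       = (\<integral>\<^sup>+w. H w * indicator {(r-t)\<^sup>2..(r+t)\<^sup>2} w \<partial>lborel)"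
proof -
  let ?g = "\<lambda>\<theta>. chord_sq r t \<theta>"
  have "(?g has_real_derivative 2 * r * t * sin x) (at x)" for x
    by (auto intro!: derivative_eq_intros)
  moreover have "continuous_on {0..pi} (\<lambda>\<theta>. 2 * r * t * sin \<theta>)" by (intro continuous_intros)
  moreover have "0 \<le> 2 * r * t * sin x" if "x \<in> {0..pi}" for x
    using that rt by (auto intro!: mult_nonneg_nonneg sin_ge_zero)
  ultimately have "(\<integral>\<^sup>+w. H w * indicator {?g 0..?g pi} w \<partial>lborel)
     = (\<integral>\<^sup>+\<theta>. H (?g \<theta>) * ennreal (2 * r * t * sin \<theta>) * indicator {0..pi} \<theta> \<partial>lborel)"
    by (intro nn_integral_substitution_aux) auto
  then show ?thesis by (simp add: power2_eq_square algebra_simps)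
qed

text \<open>The Jacobian 2 r t sin \<open>\<theta>\<close> of the squared radius vanishes at two
  angles of the half circle only, so null sets of squared radii pull back to null sets of angles.
  About the origin this fails, because the whole circle then has a single radius.\<close>

lemma AE_circle_notin:
  fixes x :: "real^2"
  assumes N: "N \<in> null_sets lborel" and x: "x \<noteq> 0" and t: "0 < t"
  shows "AE \<theta> in lborel. \<theta> \<in> {0..2*pi} \<longrightarrow> (norm (circle_pt x t \<theta>))\<^sup>2 \<notin> N"
proof -
  have [measurable]: "N \<in> sets borel" using N by auto
  have circ[measurable]: "(\<lambda>\<theta>. (norm (circle_pt x t \<theta>))\<^sup>2) \<in> borel_measurable borel"
    by (rule borel_measurable_norm_circle_pt)
  let ?w = "\<lambda>\<theta>. chord_sq (norm x) t \<theta>"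
  have r: "0 < norm x" using x by simp
  have "(\<integral>\<^sup>+w. indicator N w * indicator {(norm x-t)\<^sup>2..(norm x+t)\<^sup>2} w \<partial>lborel)
      \<le> (\<integral>\<^sup>+w. indicator N w \<partial>lborel)"
    by (intro nn_integral_mono) (auto split: split_indicator)
  also have "\<dots> = 0" using N by auto
  finally have "(\<integral>\<^sup>+\<theta>. indicator N (?w \<theta>) * ennreal (2 * norm x * t * sin \<theta>) * indicator {0..pi} \<theta> \<partial>lborel) = 0"
    by (subst nn_integral_cosine_substitution[OF _ r t]) auto
  then have "AE \<theta> in lborel. indicator N (?w \<theta>) * ennreal (2 * norm x * t * sin \<theta>) * indicator {0..pi} \<theta> = 0"
    by (subst (asm) nn_integral_0_iff_AE) auto
  moreover have "AE \<theta> in lborel. \<theta> \<notin> {0, pi}"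
    by (intro AE_not_in finite_imp_null_set_lborel) simp
  ultimately have "AE \<theta> in lborel. indicator N (?w \<theta>) * indicator {0..pi} \<theta> = (0::ennreal)"
  proof eventually_elim
    case (elim \<theta>)
    show ?case
    proof (cases "\<theta> \<in> {0..pi}")
      case True
      then have "0 < sin \<theta>" using elim(2) by (intro sin_gt_zero) auto
      then show ?thesis using elim(1) True r t by auto
    qed auto
  qed
  then have "(\<integral>\<^sup>+\<theta>. indicator N (?w \<theta>) * indicator {0..pi} \<theta> \<partial>lborel) = 0"
    by (subst nn_integral_0_iff_AE) auto
  then have "(\<integral>\<^sup>+\<theta>. indicator N ((norm (circle_pt x t \<theta>))\<^sup>2) * indicator {0..2*pi} \<theta> \<partial>lborel) = 0"
    by (subst nn_integral_circle) auto
  then have "AE \<theta> in lborel. indicator N ((norm (circle_pt x t \<theta>))\<^sup>2) * indicator {0..2*pi} \<theta> = (0::ennreal)"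
    by (subst (asm) nn_integral_0_iff_AE) auto
  then show ?thesis by eventually_elim (auto split: split_indicator_asm)
qed

text \<open>If the right-hand side is infinite the bound is trivial; otherwise f is integrable on
  the circle and the infinite default value of \<open>abs_circle_avg\<close> is not taken. The
  constant is 1 / (2 pi) times the factor 2 from the two half circles.\<close>

lemma abs_circle_avg_le:
  fixes f :: "real^2 \<Rightarrow> complex"
  assumes \<phi>[measurable]: "\<phi> \<in> borel_measurable borel" and N: "N \<in> null_sets lborel"
    and f: "\<And>x. (norm x)\<^sup>2 \<notin> N \<Longrightarrow> f x = \<phi> ((norm x)\<^sup>2)"
    and x: "x \<noteq> 0" and t: "0 < t"
  shows "abs_circle_avg t f x \<le> ennreal (1 / pi) *
    (\<integral>\<^sup>+\<theta>. ennreal (cmod (\<phi> (chord_sq (norm x) t \<theta>))) * indicator {0..pi} \<theta> \<partial>lborel)"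
proof -
  let ?h = "\<lambda>\<theta>. indicator {0..2*pi} \<theta> *\<^sub>R \<phi> ((norm (circle_pt x t \<theta>))\<^sup>2)"
  let ?f = "\<lambda>\<theta>. indicator {0..2*pi} \<theta> *\<^sub>R f (circle_pt x t \<theta>)"
  have circ[measurable]: "(\<lambda>\<theta>. (norm (circle_pt x t \<theta>))\<^sup>2) \<in> borel_measurable borel"
    by (rule borel_measurable_norm_circle_pt)
  have ae: "AE \<theta> in lebesgue. ?h \<theta> = ?f \<theta>"
    using AE_completion[OF AE_circle_notin[OF N x t]]
    by eventually_elim (auto simp: f split: split_indicator)
  have "?h \<in> borel_measurable lborel" by measurable
  then have "?h \<in> borel_measurable lebesgue" by (rule measurable_completion)
  then have meas: "?f \<in> borel_measurable lebesgue" using ae by (rule borel_measurable_AE)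
  have "(\<integral>\<^sup>+\<theta>. ennreal (norm (?f \<theta>)) \<partial>lebesgue) = (\<integral>\<^sup>+\<theta>. ennreal (norm (?h \<theta>)) \<partial>lebesgue)"
    using ae by (intro nn_integral_cong_AE) (auto elim: eventually_mono)
  also have "\<dots> = (\<integral>\<^sup>+\<theta>. ennreal (cmod (\<phi> ((norm (circle_pt x t \<theta>))\<^sup>2))) * indicator {0..2*pi} \<theta> \<partial>lborel)"
    unfolding nn_integral_completion by (intro nn_integral_cong) (auto split: split_indicator)
  also have "\<dots> = 2 * (\<integral>\<^sup>+\<theta>. ennreal (cmod (\<phi> (chord_sq (norm x) t \<theta>))) * indicator {0..pi} \<theta> \<partial>lborel)"
    (is "_ = 2 * ?I") by (rule nn_integral_circle) measurable
  finally have I: "(\<integral>\<^sup>+\<theta>. ennreal (norm (?f \<theta>)) \<partial>lebesgue) = 2 * ?I" .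
  show ?thesis
  proof (cases "?I = \<infinity>")
    case True
    then show ?thesis by (simp add: ennreal_mult_top)
  next
    case False
    then have int: "integrable lebesgue ?f"
      using meas I by (intro integrableI_bounded) (auto simp: ennreal_mult_less_top top.not_eq_extremum)
    then have "abs_circle_avg t f x = ennreal (1 / (2 * pi) * norm (integral\<^sup>L lebesgue ?f))"
      by (simp add: abs_circle_avg_def set_integrable_def circle_avg_def set_lebesgue_integral_def)
    also have "\<dots> = ennreal (1 / (2 * pi)) * ennreal (norm (integral\<^sup>L lebesgue ?f))"
      by (rule ennreal_mult) auto
    also have "\<dots> \<le> ennreal (1 / (2 * pi)) * (\<integral>\<^sup>+\<theta>. ennreal (norm (?f \<theta>)) \<partial>lebesgue)"
      by (intro mult_left_mono integral_norm_bound_ennreal int) auto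
    also have "\<dots> = (ennreal (1 / (2 * pi)) * ennreal 2) * ?I" unfolding I by (simp add: mult_ac)
    also have "ennreal (1 / (2 * pi)) * ennreal 2 = ennreal (1 / pi)"
      by (subst ennreal_mult[symmetric]) auto
    finally show ?thesis .
  qed
qed

section \<open>A weighted Hoelder inequality\<close>

text \<open>Hoelder's inequality with exponents \<open>1 / v\<close>, \<open>1 / (u - v)\<close>, \<open>1 / (1 - u)\<close> in pointwise form: a weighted
  geometric mean of three numbers is at most their sum.\<close>

lemma weighted_young:
  fixes F k lam u v e :: real
  assumes uv: "0 < v" "v < u" "u < 1" and pos: "0 \<le> F" "0 < k" "0 < lam"
    and b: "b = (e * (1 - u) - (u - v)) / v"
  shows "F \<le> lam powr (1 - 1 / v) * (F powr (1 / u) * k powr b) + lam * (F powr (1 / u) * k + k powr (- e))"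
proof (cases "F = 0")
  case True
  then show ?thesis using pos by simp
next
  case False
  then have F: "0 < F" using pos by simp
  define X where "X = lam powr (- 1 / v) * (F powr (1 / u) * k powr b)"
  define Y where "Y = F powr (1 / u) * k"
  define Z where "Z = k powr (- e)"
  define T where "T = X + Y + Z"
  have XYZ: "0 < X" "0 < Y" "0 < Z" using F pos by (auto simp: X_def Y_def Z_def)
  have bv: "b * v = e * (1 - u) - (u - v)" using b uv by simp
  have lnX: "v * ln X = - ln lam + v / u * ln F + (e * (1 - u) - (u - v)) * ln k"
    unfolding bv[symmetric] using F pos uv
    by (simp add: X_def ln_mult ln_powr field_simps)
  have lnY: "ln Y = 1 / u * ln F + ln k" using F pos by (simp add: Y_def ln_mult ln_powr)
  have lnZ: "ln Z = - e * ln k" using pos by (simp add: Z_def ln_powr)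
  \<comment> \<open>The weights v, u - v, 1 - u sum to 1, and \<open>b\<close> is the exponent for
    which all powers of \<open>k\<close> cancel.\<close>
  have "ln F - ln lam = v * ln X + (u - v) * ln Y + (1 - u) * ln Z"
    unfolding lnX lnY lnZ using uv by (simp add: field_simps)
  also have "\<dots> \<le> v * ln T + (u - v) * ln T + (1 - u) * ln T"
    using XYZ uv by (intro add_mono mult_left_mono) (auto simp: T_def)
  also have "\<dots> = ln T" by (simp add: algebra_simps)
  finally have "ln (F / lam) \<le> ln T" using F pos by (simp add: ln_div)
  then have "F / lam \<le> T" using F pos XYZ by (subst (asm) ln_le_cancel_iff) (auto simp: T_def)
  then have "F \<le> lam * T" using pos by (simp add: field_simps)
  also have "\<dots> = lam powr (1 - 1 / v) * (F powr (1 / u) * k powr b) + lam * (F powr (1 / u) * k + k powr (- e))"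
  proof -
    have "lam * lam powr (- 1 / v) = lam powr (1 - 1 / v)"
      using pos powr_add[of lam 1 "- 1 / v"] by simp
    then have "lam * X = lam powr (1 - 1 / v) * (F powr (1 / u) * k powr b)"
      unfolding X_def by (simp add: mult.assoc[symmetric])
    then show ?thesis by (simp add: T_def Y_def Z_def distrib_left)
  qed
  finally show ?thesis .
qed

text \<open>Integrating \<open>weighted_young\<close> bounds A by two terms that pull in opposite
  directions as \<open>lam\<close> varies; optimising over \<open>lam\<close> recovers the
  multiplicative inequality, A at most a constant times Z^v.\<close>

lemma nn_integral_young_bound:
  fixes F k :: "'a \<Rightarrow> real"
  assumes uv: "0 < v" "v < u" "u < 1" and b: "b = (e * (1 - u) - (u - v)) / v"
    and [measurable]: "F \<in> borel_measurable M" "k \<in> borel_measurable M"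
    and F: "\<And>x. 0 \<le> F x" and k: "AE x in M. 0 < k x"
    and I: "(\<integral>\<^sup>+x. ennreal (F x powr (1 / u) * k x) \<partial>M) \<le> 1"
    and B: "(\<integral>\<^sup>+x. ennreal (k x powr (- e)) \<partial>M) \<le> ennreal B" and "0 \<le> B"
  shows "ennreal_powr (\<integral>\<^sup>+x. ennreal (F x) \<partial>M) (1 / v)
     \<le> ennreal ((2 + B) powr (1 / v)) * (\<integral>\<^sup>+x. ennreal (F x powr (1 / u) * k x powr b) \<partial>M)"
proof -
  define Z where "Z = (\<integral>\<^sup>+x. ennreal (F x powr (1 / u) * k x powr b) \<partial>M)"
  define A where "A = (\<integral>\<^sup>+x. ennreal (F x) \<partial>M)"
  have main: "A \<le> ennreal (lam powr (1 - 1 / v)) * Z + ennreal lam * ennreal (1 + B)" if lam: "0 < lam" for lam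
  proof -
    have "A \<le> (\<integral>\<^sup>+x. ennreal (lam powr (1 - 1 / v)) * ennreal (F x powr (1 / u) * k x powr b)
        + ennreal lam * (ennreal (F x powr (1 / u) * k x) + ennreal (k x powr (- e))) \<partial>M)"
      unfolding A_def
    proof (rule nn_integral_mono_AE)
      show "AE x in M. ennreal (F x) \<le> ennreal (lam powr (1 - 1 / v)) * ennreal (F x powr (1 / u) * k x powr b)
        + ennreal lam * (ennreal (F x powr (1 / u) * k x) + ennreal (k x powr (- e)))"
        using k
      proof eventually_elim
        case (elim x)
        have "ennreal (lam powr (1 - 1 / v)) * ennreal (F x powr (1 / u) * k x powr b)
            + ennreal lam * (ennreal (F x powr (1 / u) * k x) + ennreal (k x powr (- e)))
          = ennreal (lam powr (1 - 1 / v) * (F x powr (1 / u) * k x powr b) + lam * (F x powr (1 / u) * k x + k x powr (- e)))"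
          using elim lam by (simp add: ennreal_mult ennreal_plus)
        then show ?case using weighted_young[OF uv F elim lam b] by (simp add: ennreal_leI)
      qed
    qed
    also have "\<dots> = ennreal (lam powr (1 - 1 / v)) * Z
        + ennreal lam * ((\<integral>\<^sup>+x. ennreal (F x powr (1 / u) * k x) \<partial>M) + (\<integral>\<^sup>+x. ennreal (k x powr (- e)) \<partial>M))"
      unfolding Z_def by (simp add: nn_integral_add nn_integral_cmult)
    also have "\<dots> \<le> ennreal (lam powr (1 - 1 / v)) * Z + ennreal lam * (1 + ennreal B)"
      by (intro add_left_mono mult_left_mono add_mono I B) auto
    also have "1 + ennreal B = ennreal (1 + B)" using \<open>0 \<le> B\<close> by (simp add: ennreal_plus)
    finally show ?thesis .
  qed
  have C: "0 < (2 + B) powr (1 / v)" using \<open>0 \<le> B\<close> by simp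
  have "ennreal_powr A (1 / v) \<le> ennreal ((2 + B) powr (1 / v)) * Z"
  proof (cases "Z = \<infinity>")
    case True
    then show ?thesis using C by (simp add: ennreal_mult_top)
  next
    case False
    then obtain z where z: "Z = ennreal z" "0 \<le> z" by (cases Z) auto
    have A1: "A \<le> ennreal (lam powr (1 - 1 / v) * z + lam * (1 + B))" if "0 < lam" for lam
      using main[OF that] z that \<open>0 \<le> B\<close> by (simp add: ennreal_mult ennreal_plus)
    then have "A < \<infinity>" using le_less_trans[OF A1[of 1]] by simp
    then obtain a where a: "A = ennreal a" "0 \<le> a" by (cases A) auto
    have A2: "a \<le> lam powr (1 - 1 / v) * z + lam * (1 + B)" if "0 < lam" for lam
      using A1[OF that] z that \<open>0 \<le> B\<close> unfolding a(1) by (subst (asm) ennreal_le_iff) auto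
    have "a powr (1 / v) \<le> (2 + B) powr (1 / v) * z"
    proof (cases "z = 0")
      case True
      have "a \<le> 0"
      proof (rule field_le_epsilon)
        fix \<epsilon> :: real assume "0 < \<epsilon>"
        then show "a \<le> 0 + \<epsilon>" using A2[of "\<epsilon> / (1 + B)"] True \<open>0 \<le> B\<close> by simp
      qed
      then show ?thesis using a True uv by simp
    next
      case False
      then have z0: "0 < z" using z by simp
      \<comment> \<open>\<open>lam = z powr v\<close> balances the two terms: both become multiples
        of z^v. For z = 0 the same was achieved above by letting \<open>lam\<close> tend to
        0.\<close>
      have "a \<le> (z powr v) powr (1 - 1 / v) * z + z powr v * (1 + B)" using A2[of "z powr v"] z0 by simp
      also have "(z powr v) powr (1 - 1 / v) * z = z powr v"
      proof -
        have "(z powr v) powr (1 - 1 / v) * z = z powr (v - 1) * z powr 1"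
          using z0 uv by (simp add: powr_powr right_diff_distrib)
        also have "\<dots> = z powr v" by (subst powr_add[symmetric]) simp
        finally show ?thesis .
      qed
      finally have "a \<le> (2 + B) * z powr v" by (simp add: algebra_simps)
      then have "a powr (1 / v) \<le> ((2 + B) * z powr v) powr (1 / v)"
        using a uv by (intro powr_mono2) auto
      also have "\<dots> = (2 + B) powr (1 / v) * z" using z0 uv \<open>0 \<le> B\<close> by (simp add: powr_mult powr_powr)
      finally show ?thesis .
    qed
    then show ?thesis using a z C by (simp add: ennreal_powr_def ennreal_mult[symmetric] ennreal_leI)
  qed
  then show ?thesis unfolding A_def Z_def .
qed

lemma sin_ge_quarter:
  assumes "0 \<le> x" "x \<le> pi / 2"
  shows "x / 4 \<le> sin x"
proof (cases "x \<le> pi / 3")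
  case True
  have "(\<lambda>x. sin x - x / 4) 0 \<le> (\<lambda>x. sin x - x / 4) x"
  proof (rule DERIV_nonneg_imp_nondecreasing[OF assms(1)])
    fix y assume y: "0 \<le> y" "y \<le> x"
    have "cos (pi / 3) \<le> cos y" using y True pi_gt_zero by (intro cos_monotone_0_pi_le) auto
    then have "0 \<le> cos y - 1 / 4" by (simp add: cos_60)
    moreover have "((\<lambda>x. sin x - x / 4) has_real_derivative cos y - 1 / 4) (at y)"
      by (auto intro!: derivative_eq_intros)
    ultimately show "\<exists>z. ((\<lambda>x. sin x - x / 4) has_real_derivative z) (at y) \<and> 0 \<le> z" by blast
  qed
  then show ?thesis by simp
next
  case False
  have "sin (pi / 3) \<le> sin x" using False assms pi_gt_zero by (intro sin_monotone_2pi_le) auto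
  moreover have "1 / 2 \<le> sin (pi / 3)" unfolding sin_60
    using real_le_rsqrt[of 1 3] by simp
  moreover have "x / 4 \<le> 1 / 2" using assms pi_less_4 by simp
  ultimately show ?thesis by linarith
qed

lemma nn_integral_sin_powr_finite:
  assumes e: "0 \<le> e" "e < 1"
  shows "(\<integral>\<^sup>+\<theta>. ennreal (sin \<theta> powr (- e)) * indicator {0..pi} \<theta> \<partial>lborel) < \<infinity>"
proof -
  have "((\<lambda>x. x powr (- e)) has_integral (pi powr (- e + 1) / (- e + 1))) {0..pi}"
    using e by (intro has_integral_powr_from_0) auto
  then have I: "(\<integral>\<^sup>+x. ennreal (x powr (- e)) * indicator {0..pi} x \<partial>lborel) = ennreal (pi powr (- e + 1) / (- e + 1))"
    by (intro nn_integral_has_integral_lebesgue') auto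
  have I': "(\<integral>\<^sup>+x. ennreal ((pi - x) powr (- e)) * indicator {0..pi} x \<partial>lborel)
       = (\<integral>\<^sup>+x. ennreal (x powr (- e)) * indicator {0..pi} x \<partial>lborel)"
  proof -
    have "(\<integral>\<^sup>+x. ennreal (x powr (- e)) * indicator {0..pi} x \<partial>lborel)
       = (\<integral>\<^sup>+x. ennreal ((pi - x) powr (- e)) * indicator {0..pi} (pi - x) \<partial>lborel)"
      using nn_integral_real_affine[of "\<lambda>x. ennreal (x powr (- e)) * indicator {0..pi} x" "-1" pi] by simp
    also have "\<dots> = (\<integral>\<^sup>+x. ennreal ((pi - x) powr (- e)) * indicator {0..pi} x \<partial>lborel)"
      by (intro nn_integral_cong) (auto split: split_indicator)
    finally show ?thesis ..
  qed
  have "(\<integral>\<^sup>+\<theta>. ennreal (sin \<theta> powr (- e)) * indicator {0..pi} \<theta> \<partial>lborel)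
    \<le> (\<integral>\<^sup>+x. ennreal (4 powr e) * (ennreal (x powr (- e)) * indicator {0..pi} x
              + ennreal ((pi - x) powr (- e)) * indicator {0..pi} x) \<partial>lborel)"
  proof (rule nn_integral_mono_AE)
    have "AE x in lborel. x \<notin> {0, pi}"
      by (intro AE_not_in finite_imp_null_set_lborel) simp
    then show "AE \<theta> in lborel. ennreal (sin \<theta> powr (- e)) * indicator {0..pi} \<theta>
       \<le> ennreal (4 powr e) * (ennreal (\<theta> powr (- e)) * indicator {0..pi} \<theta>
              + ennreal ((pi - \<theta>) powr (- e)) * indicator {0..pi} \<theta>)"
    proof eventually_elim
      case (elim x)
      show ?case
      proof (cases "x \<in> {0..pi}")
        case True
        then have x: "0 < x" "x < pi" using elim by auto
        \<comment> \<open>The distance to the nearer zero of the sine, where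
          \<open>sin_ge_quarter\<close> applies.\<close>
        define m where "m = min x (pi - x)"
        have m: "0 < m" "m \<le> pi / 2" using x unfolding m_def min_def by (simp, simp split: if_splits)
        have "sin m = sin x" by (simp add: m_def min_def)
        then have "m / 4 \<le> sin x" using sin_ge_quarter[of m] m by simp
        then have "sin x powr (- e) \<le> (m / 4) powr (- e)"
          using m e by (intro powr_mono2') auto
        also have "\<dots> = 4 powr e * m powr (- e)" using m by (simp add: powr_divide powr_minus divide_simps)
        also have "\<dots> \<le> 4 powr e * (x powr (- e) + (pi - x) powr (- e))"
          by (intro mult_left_mono) (auto simp: m_def min_def)
        finally have "ennreal (sin x powr (- e)) \<le> ennreal (4 powr e * (x powr (- e) + (pi - x) powr (- e)))"
          by (rule ennreal_leI)
        then show ?thesis using True by (simp add: ennreal_mult)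
      qed auto
    qed
  qed
  also have "\<dots> = ennreal (4 powr e) * ((\<integral>\<^sup>+x. ennreal (x powr (- e)) * indicator {0..pi} x \<partial>lborel)
      + (\<integral>\<^sup>+x. ennreal ((pi - x) powr (- e)) * indicator {0..pi} x \<partial>lborel))"
    by (simp add: nn_integral_add nn_integral_cmult)
  also have "\<dots> < \<infinity>" unfolding I' I by (simp add: ennreal_mult_less_top)
  finally show ?thesis .
qed

section \<open>Counting radii\<close>

lemma dyadic_scale:
  fixes x :: real
  assumes "0 < x" "x \<le> 1"
  obtains k where "(1/2)^(Suc k) < x" "x \<le> (1/2)^k"
proof -
  obtain n where n: "(1/2)^n < x" using real_arch_pow_inv[of x "1/2"] assms by auto
  define m where "m = (LEAST n. (1/2)^n < x)"
  have m: "(1/2)^m < x" unfolding m_def using n by (rule LeastI)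
  then have "m \<noteq> 0" using assms by (intro notI) simp
  then obtain k where k: "m = Suc k" by (cases m) auto
  have "\<not> (1/2)^k < x" using not_less_Least[of k "\<lambda>n. (1/2)^n < x"] k unfolding m_def by simp
  then show ?thesis using that[of k] m k by simp
qed

lemma abs_diff_squares_less:
  fixes s \<rho> :: real
  assumes "\<bar>s\<^sup>2 - \<rho>\<^sup>2\<bar> < B" "0 \<le> s" "0 \<le> \<rho>" "0 < D" "D \<le> s + \<rho>"
  shows "\<bar>s - \<rho>\<bar> < B / D"
proof -
  have "\<bar>s - \<rho>\<bar> * D \<le> \<bar>s - \<rho>\<bar> * (s + \<rho>)" using assms by (intro mult_left_mono) auto
  also have "\<dots> = \<bar>s\<^sup>2 - \<rho>\<^sup>2\<bar>" using assms by (simp add: power2_eq_square square_diff_square_factored abs_mult mult.commute)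
  finally show ?thesis using assms by (simp add: field_simps)
qed

text \<open>The parameters stand for \<open>P = q / p\<close> and \<open>A = q / p - q / 2\<close>, while \<open>\<eta>\<close> is the gain that makes the sums over
  dyadic scales converge; \<open>P - A - 1 = q / 2 - 1\<close> is the argument of \<open>\<nu>\<^sup>\<sharp>\<close>.\<close>

locale dilation_bounds =
  fixes E :: "real set" and P A \<eta> C :: real
  assumes E: "E \<subseteq> {1..2}" and P: "1 \<le> P" and \<eta>: "0 < \<eta>" and C: "0 \<le> C"
    and local_bound: "\<And>a L \<delta>. 0 < \<delta> \<Longrightarrow> \<delta> \<le> L \<Longrightarrow> L \<le> 1 \<Longrightarrow>
      \<delta> * real (covering_number (E \<inter> {a..a+L}) \<delta>) \<le> C * \<delta> powr (\<eta> + A) * L powr (P - A - 1)"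
    and global_bound: "\<And>\<delta>. 0 < \<delta> \<Longrightarrow> \<delta> \<le> 1 \<Longrightarrow>
      \<delta> * real (covering_number E \<delta>) \<le> C * \<delta> powr (\<eta> + 2 * A)"
begin

text \<open>Near-tangency at scale \<open>\<tau>\<close>: \<open>\<sigma>\<close> = 1 is the far
  point of the circle and \<open>\<sigma>\<close> = -1 the near point. At an angle with 1 - |cos| at
  most \<open>\<tau>\<close>, the deviation is 2 r t (1 - |cos|), at most 4 r \<open>\<tau>\<close>
  since t is at most 2; the factor 8 permits a strict inequality and thus an open set. The supremum
  over E is hidden in the existential quantifier.\<close>

definition near_sq :: "real \<Rightarrow> real \<Rightarrow> real \<Rightarrow> real \<Rightarrow> bool" where
  "near_sq \<sigma> \<tau> r w \<longleftrightarrow> (\<exists>t\<in>E. \<bar>w - (r + \<sigma> * t)\<^sup>2\<bar> < 8 * r * \<tau>)"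

text \<open>The weight is the product of r from polar coordinates and of r^(-P) from the Hoelder
  bound for a single circle.\<close>

definition weighted :: "real set \<Rightarrow> ennreal" where
  "weighted S = (\<integral>\<^sup>+r. ennreal (r powr (1 - P)) * indicator S r \<partial>lborel)"

lemma open_near_sq: "open {p. near_sq \<sigma> \<tau> (fst p) (snd p)}"
proof -
  have "{p. near_sq \<sigma> \<tau> (fst p) (snd p)} = (\<Union>t\<in>E. {p. \<bar>snd p - (fst p + \<sigma> * t)\<^sup>2\<bar> < 8 * fst p * \<tau>})"
    unfolding near_sq_def by auto
  also have "open \<dots>" by (intro open_UN ballI open_Collect_less continuous_intros)
  finally show ?thesis .
qed

lemma measurable_near_sq_pair [measurable]:
  "(\<lambda>p. indicator {p. near_sq \<sigma> \<tau> (fst p) (snd p)} p :: ennreal) \<in> borel_measurable borel"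
  using open_near_sq by (intro borel_measurable_indicator) auto

lemma open_near_sq_section: "open {r. near_sq \<sigma> \<tau> r w}"
proof -
  have "{r. near_sq \<sigma> \<tau> r w} = (\<Union>t\<in>E. {r. \<bar>w - (r + \<sigma> * t)\<^sup>2\<bar> < 8 * r * \<tau>})"
    unfolding near_sq_def by auto
  also have "open \<dots>" by (intro open_UN ballI open_Collect_less continuous_intros)
  finally show ?thesis .
qed

lemma weighted_Un:
  assumes "S \<subseteq> T \<union> U" and [measurable]: "T \<in> sets borel" "U \<in> sets borel"
  shows "weighted S \<le> weighted T + weighted U"
proof -
  have "weighted S \<le> (\<integral>\<^sup>+r. ennreal (r powr (1 - P)) * indicator T r + ennreal (r powr (1 - P)) * indicator U r \<partial>lborel)"
    unfolding weighted_def using assms(1) by (intro nn_integral_mono) (auto split: split_indicator)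
  also have "\<dots> = weighted T + weighted U" unfolding weighted_def by (intro nn_integral_add) auto
  finally show ?thesis .
qed

lemma weighted_translates:
  assumes F: "F \<subseteq> {1..2}" and S: "S \<subseteq> {r. \<exists>t\<in>F. \<bar>r - (c + \<sigma> * t)\<bar> < K * \<delta>}"
    and M: "\<And>r. r \<in> S \<Longrightarrow> r powr (1 - P) \<le> M" and "0 \<le> M" "0 < \<delta>" "0 \<le> K" "\<bar>\<sigma>\<bar> = 1"
    and b: "\<delta> * real (covering_number F \<delta>) \<le> b"
  shows "weighted S \<le> ennreal (M * (2 * K + 1) * b)"
proof -
  let ?T = "{r. \<exists>t\<in>F. \<bar>r - (c + \<sigma> * t)\<bar> < K * \<delta>}"
  have "weighted S \<le> (\<integral>\<^sup>+r. ennreal M * indicator ?T r \<partial>lborel)"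
    unfolding weighted_def using S M
    by (intro nn_integral_mono) (auto split: split_indicator intro: ennreal_leI)
  also have "\<dots> = ennreal M * emeasure lborel ?T"
    using open_translates[of F c \<sigma> "K * \<delta>"] by (intro nn_integral_cmult_indicator) simp
  also have "\<dots> \<le> ennreal M * ennreal ((2 * K + 1) * (\<delta> * real (covering_number F \<delta>)))"
    using assms by (intro mult_left_mono emeasure_translates_le[OF F]) auto
  also have "\<dots> \<le> ennreal M * ennreal ((2 * K + 1) * b)"
    using assms by (intro mult_left_mono ennreal_leI) auto
  also have "\<dots> = ennreal (M * (2 * K + 1) * b)"
    using \<open>0 \<le> M\<close> by (simp add: ennreal_mult'[symmetric] mult.assoc)
  finally show ?thesis .
qed

lemma powr_le_near:
  assumes "1/64 \<le> r" shows "r powr (1 - P) \<le> (1/64) powr (1 - P)"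
  using assms P by (intro powr_mono2') auto

lemma unit_bound:
  assumes "0 < \<tau>" "\<tau> \<le> 1"
  shows "\<tau> * real (covering_number E \<tau>) \<le> C * \<tau> powr (\<eta> + A)"
proof -
  have "E \<inter> {1..1+1} = E" using E by auto
  then show ?thesis using local_bound[of \<tau> 1 1] assms by simp
qed

text \<open>Here r + \<open>\<sigma>\<close> t is at least r / 2, so taking square roots divides the
  tolerance 8 r \<open>\<tau>\<close> by r / 2 and the dependence on r cancels. What remains is a
  neighbourhood of a copy of E at the scale \<open>\<tau>\<close> itself.\<close>

lemma weighted_outer:
  assumes \<tau>: "0 < \<tau>" "\<tau> \<le> 1" and s: "0 \<le> s" and \<sigma>: "\<bar>\<sigma>\<bar> = 1" and S: "\<And>r. r \<in> S \<Longrightarrow> 1/64 \<le> r \<and> (\<sigma> = 1 \<or> 4 \<le> r) \<and> near_sq \<sigma> \<tau> r (s\<^sup>2)"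
  shows "weighted S \<le> ennreal ((1/64) powr (1 - P) * (2 * 16 + 1) * (C * \<tau> powr (\<eta> + A)))"
proof (rule weighted_translates[where F = E and c = s and \<sigma> = "- \<sigma>" and \<delta> = \<tau>])
  show "S \<subseteq> {r. \<exists>t\<in>E. \<bar>r - (s + - \<sigma> * t)\<bar> < 16 * \<tau>}"
  proof
    fix r assume "r \<in> S"
    note r = S[OF this]
    then obtain t where t: "t \<in> E" "\<bar>s\<^sup>2 - (r + \<sigma> * t)\<^sup>2\<bar> < 8 * r * \<tau>" unfolding near_sq_def by auto
    have t12: "1 \<le> t" "t \<le> 2" using t(1) E by auto
    have s1: "\<sigma> = 1 \<or> \<sigma> = -1" using \<sigma> by auto
    have half: "r / 2 \<le> r + \<sigma> * t" using r s1 t12 by auto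
    have "\<bar>s - (r + \<sigma> * t)\<bar> < 8 * r * \<tau> / (r / 2)"
      by (rule abs_diff_squares_less[OF t(2)]) (use s r half in auto)
    then have "\<bar>s - (r + \<sigma> * t)\<bar> < 16 * \<tau>" using r by simp
    then have "\<bar>r - (s + - \<sigma> * t)\<bar> < 16 * \<tau>" by (simp add: abs_less_iff)
    then show "r \<in> {r. \<exists>t\<in>E. \<bar>r - (s + - \<sigma> * t)\<bar> < 16 * \<tau>}" using t(1) by blast
  qed
qed (use E \<tau> \<sigma> S powr_le_near unit_bound[OF \<tau>] in auto)

text \<open>When w is at most comparable to \<open>\<tau>\<close>, the circle passes so close to the
  origin that |r - t| is only known to be of order sqrt \<open>\<tau>\<close>. Counting E at that
  coarser scale is where \<open>global_bound\<close> with its exponent 2 A is forced; half of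
  \<open>\<eta>\<close> survives.\<close>

lemma weighted_middle_small:
  assumes \<tau>: "0 < \<tau>" "\<tau> \<le> 1" and s: "0 \<le> s" "s\<^sup>2 < 64 * \<tau>"
    and S: "\<And>r. r \<in> S \<Longrightarrow> 1/64 \<le> r \<and> r \<le> 4 \<and> near_sq (-1) \<tau> r (s\<^sup>2)"
  shows "weighted S \<le> ennreal ((1/64) powr (1 - P) * (2 * 10 + 1) * (C * \<tau> powr (\<eta> / 2 + A)))"
proof (rule weighted_translates[where F = E and c = 0 and \<sigma> = 1 and \<delta> = "sqrt \<tau>"])
  show "S \<subseteq> {r. \<exists>t\<in>E. \<bar>r - (0 + 1 * t)\<bar> < 10 * sqrt \<tau>}"
  proof
    fix r assume "r \<in> S"
    note r = S[OF this]
    then obtain t where t: "t \<in> E" "\<bar>s\<^sup>2 - (r + (-1) * t)\<^sup>2\<bar> < 8 * r * \<tau>" unfolding near_sq_def by auto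
    have "8 * r * \<tau> \<le> 32 * \<tau>" using r \<tau> by simp
    moreover have "\<bar>s\<^sup>2 - (r - t)\<^sup>2\<bar> < 8 * r * \<tau>" using t(2) by simp
    \<comment> \<open>64 \<open>\<tau>\<close> from w and 32 \<open>\<tau>\<close> from the
      tolerance, rounded up to a square.\<close>
    ultimately have "(r - t)\<^sup>2 < 100 * \<tau>" using s(2) \<tau>(1) by linarith
    from real_sqrt_less_mono[OF this] have "\<bar>r - t\<bar> < 10 * sqrt \<tau>" by (simp add: real_sqrt_mult)
    then show "r \<in> {r. \<exists>t\<in>E. \<bar>r - (0 + 1 * t)\<bar> < 10 * sqrt \<tau>}" using t(1) by auto
  qed
  have "sqrt \<tau> * real (covering_number E (sqrt \<tau>)) \<le> C * sqrt \<tau> powr (\<eta> + 2 * A)"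
    using \<tau> by (intro global_bound) auto
  also have "sqrt \<tau> powr (\<eta> + 2 * A) = \<tau> powr (\<eta> / 2 + A)"
    using \<tau> by (simp add: powr_half_sqrt[symmetric] powr_powr algebra_simps)
  finally show "sqrt \<tau> * real (covering_number E (sqrt \<tau>)) \<le> C * \<tau> powr (\<eta> / 2 + A)" .
qed (use E \<tau> S powr_le_near in auto)

text \<open>The scale \<open>\<tau> / s\<close> ranges from about \<open>\<tau>\<close> to about
  sqrt \<open>\<tau>\<close>. For A > 0 it is bounded by the coarse end, where
  \<open>global_bound\<close> applies; for A at most 0 the power s^(-A) is bounded because s is at
  most 7, and the bound for the unit interval suffices.\<close>

lemma middle_scale_bound:
  assumes \<tau>: "0 < \<tau>" "\<tau> \<le> 1" and s: "0 \<le> s" "64 * \<tau> \<le> s\<^sup>2" "s \<le> 7"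
  shows "\<tau> / s * real (covering_number E (\<tau> / s)) \<le> C * (1 + 7 powr (- A)) * \<tau> powr (\<eta> / 2 + A)"
proof -
  have "sqrt (64 * \<tau>) \<le> s" using s by (simp add: real_le_lsqrt)
  then have s8: "8 * sqrt \<tau> \<le> s" by (simp add: real_sqrt_mult)
  have sq: "0 < sqrt \<tau>" "sqrt \<tau> \<le> 1" using \<tau> by auto
  have s0: "0 < s" using s8 sq by linarith
  have "\<tau> = sqrt \<tau> * sqrt \<tau>" using \<tau> by simp
  also have "\<dots> \<le> sqrt \<tau> * s" using s8 sq by (intro mult_left_mono) linarith+
  finally have d1: "\<tau> / s \<le> sqrt \<tau>" using s0 by (simp add: field_simps)
  have d0: "0 < \<tau> / s" using s0 \<tau> by simp
  have dle: "\<tau> / s \<le> 1" using d1 sq by linarith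
  have "(\<tau> / s) powr \<eta> \<le> sqrt \<tau> powr \<eta>" using d0 d1 \<eta> by (intro powr_mono2) auto
  also have "\<dots> = \<tau> powr (\<eta> / 2)" using \<tau> by (simp add: powr_half_sqrt[symmetric] powr_powr)
  finally have e: "(\<tau> / s) powr \<eta> \<le> \<tau> powr (\<eta> / 2)" .
  show ?thesis
  proof (cases "0 < A")
    case True
    have "(\<tau> / s) powr (2 * A) \<le> sqrt \<tau> powr (2 * A)" using d0 d1 True by (intro powr_mono2) auto
    also have "\<dots> = \<tau> powr A" using \<tau> by (simp add: powr_half_sqrt[symmetric] powr_powr)
    finally have f: "(\<tau> / s) powr (2 * A) \<le> \<tau> powr A" .
    have "\<tau> / s * real (covering_number E (\<tau> / s)) \<le> C * (\<tau> / s) powr (\<eta> + 2 * A)"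
      by (rule global_bound[OF d0 dle])
    also have "(\<tau> / s) powr (\<eta> + 2 * A) = (\<tau> / s) powr \<eta> * (\<tau> / s) powr (2 * A)" by (rule powr_add)
    also have "C * \<dots> \<le> C * (\<tau> powr (\<eta> / 2) * \<tau> powr A)" using e f C by (intro mult_left_mono mult_mono) auto
    also have "\<dots> = C * 1 * \<tau> powr (\<eta> / 2 + A)" by (simp add: powr_add)
    also have "\<dots> \<le> C * (1 + 7 powr (- A)) * \<tau> powr (\<eta> / 2 + A)"
      using C by (intro mult_right_mono mult_left_mono) auto
    finally show ?thesis .
  next
    case False
    have "(\<tau> / s) powr A = \<tau> powr A * s powr (- A)" using s0 \<tau> by (simp add: powr_divide powr_minus divide_simps)
    also have "\<dots> \<le> \<tau> powr A * 7 powr (- A)" using s0 s(3) False by (intro mult_left_mono powr_mono2) auto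
    finally have f: "(\<tau> / s) powr A \<le> \<tau> powr A * 7 powr (- A)" .
    have "\<tau> / s * real (covering_number E (\<tau> / s)) \<le> C * (\<tau> / s) powr (\<eta> + A)"
      by (rule unit_bound[OF d0 dle])
    also have "(\<tau> / s) powr (\<eta> + A) = (\<tau> / s) powr \<eta> * (\<tau> / s) powr A" by (rule powr_add)
    also have "C * \<dots> \<le> C * (\<tau> powr (\<eta> / 2) * (\<tau> powr A * 7 powr (- A)))"
      using e f C by (intro mult_left_mono mult_mono) auto
    also have "\<dots> = C * (7 powr (- A)) * \<tau> powr (\<eta> / 2 + A)" by (simp add: powr_add)
    also have "\<dots> \<le> C * (1 + 7 powr (- A)) * \<tau> powr (\<eta> / 2 + A)"
      using C by (intro mult_right_mono mult_left_mono) auto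
    finally show ?thesis .
  qed
qed

text \<open>Division by s, which is at least 8 sqrt \<open>\<tau>\<close>, turns the tolerance on
  squares into 32 \<open>\<tau>\<close> / s on s - |r - t|. The absolute value yields two copies of
  E, centred at s and -s.\<close>

lemma weighted_middle_large:
  assumes \<tau>: "0 < \<tau>" "\<tau> \<le> 1" and s: "0 \<le> s" "64 * \<tau> \<le> s\<^sup>2"
    and S: "\<And>r. r \<in> S \<Longrightarrow> 1/64 \<le> r \<and> r \<le> 4 \<and> near_sq (-1) \<tau> r (s\<^sup>2)"
  shows "weighted S \<le> ennreal (2 * ((1/64) powr (1 - P) * (2 * 32 + 1) * (C * (1 + 7 powr (- A)) * \<tau> powr (\<eta> / 2 + A))))"
proof -
  have s0: "0 < s" using s \<tau> by (cases "s = 0") auto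
  have near: "\<exists>t\<in>E. \<bar>s - \<bar>r - t\<bar>\<bar> < 32 * (\<tau> / s) \<and> s < 7" if "r \<in> S" for r
  proof -
    note r = S[OF that]
    then obtain t where t: "t \<in> E" "\<bar>s\<^sup>2 - (r + (-1) * t)\<^sup>2\<bar> < 8 * r * \<tau>" unfolding near_sq_def by auto
    have t12: "1 \<le> t" "t \<le> 2" using t(1) E by auto
    have "8 * r * \<tau> \<le> 32 * \<tau>" using r \<tau> by simp
    moreover have "\<bar>s\<^sup>2 - \<bar>r - t\<bar>\<^sup>2\<bar> < 8 * r * \<tau>" using t(2) by simp
    ultimately have t2: "\<bar>s\<^sup>2 - \<bar>r - t\<bar>\<^sup>2\<bar> < 32 * \<tau>" by linarith
    have 1: "\<bar>s - \<bar>r - t\<bar>\<bar> < 32 * \<tau> / s"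
      by (rule abs_diff_squares_less[OF t2]) (use s0 in auto)
    have "\<bar>r - t\<bar> \<le> 4" using r t12 by auto
    then have "\<bar>r - t\<bar>\<^sup>2 \<le> 4\<^sup>2" by (intro power_mono) auto
    \<comment> \<open>16 from |r - t| and 32 from the tolerance stay below 49; for larger s the set
      is empty.\<close>
    then have "s\<^sup>2 < 7\<^sup>2" using t2 \<tau> by (simp add: abs_less_iff)
    then have "s < 7" by (rule power2_less_imp_less) simp
    then show ?thesis using 1 t(1) by auto
  qed
  show ?thesis
  proof (cases "s \<le> 7")
    case False
    then have "S = {}" using near by fastforce
    then show ?thesis by (simp add: weighted_def)
  next
    case True
    let ?B = "C * (1 + 7 powr (- A)) * \<tau> powr (\<eta> / 2 + A)"
    let ?b = "(1/64) powr (1 - P) * (2 * 32 + 1) * ?B"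
    let ?T1 = "{1/64..} \<inter> {r. \<exists>t\<in>E. \<bar>r - (s + 1 * t)\<bar> < 32 * (\<tau> / s)}"
    let ?T2 = "{1/64..} \<inter> {r. \<exists>t\<in>E. \<bar>r - (- s + 1 * t)\<bar> < 32 * (\<tau> / s)}"
    note mb = middle_scale_bound[OF \<tau> s True]
    have T: "weighted ({1/64..} \<inter> {r. \<exists>t\<in>E. \<bar>r - (c + 1 * t)\<bar> < 32 * (\<tau> / s)}) \<le> ennreal ?b" for c
      by (rule weighted_translates[where c = c and \<sigma> = 1, OF E _ _ _ _ _ _ mb]) (use \<tau> s0 powr_le_near in auto)
    have "S \<subseteq> ?T1 \<union> ?T2"
    proof
      fix r assume r: "r \<in> S"
      obtain t where t: "t \<in> E" "\<bar>s - \<bar>r - t\<bar>\<bar> < 32 * (\<tau> / s)" using near[OF r] by auto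
      have "\<bar>r - (s + 1 * t)\<bar> < 32 * (\<tau> / s) \<or> \<bar>r - (- s + 1 * t)\<bar> < 32 * (\<tau> / s)"
        using t(2) by (cases "t \<le> r") (auto simp: abs_less_iff)
      then show "r \<in> ?T1 \<union> ?T2" using t(1) S[OF r] by blast
    qed
    then have "weighted S \<le> weighted ?T1 + weighted ?T2"
      using open_translates[of E s 1] open_translates[of E "-s" 1] by (intro weighted_Un) auto
    also have "weighted ?T1 + weighted ?T2 \<le> ennreal ?b + ennreal ?b" by (intro add_mono T)
    also have "ennreal ?b + ennreal ?b = ennreal (2 * ?b)" using C by (subst ennreal_plus[symmetric]) auto
    finally show ?thesis .
  qed
qed

text \<open>For r of size R the root t + \<open>\<sigma>\<close> r is bounded below, so t is located
  up to 32 R \<open>\<tau>\<close> around a number within 2 R of s: only E in an interval of length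
  68 R counts, at scale R \<open>\<tau>\<close>. The powers of R from the weight and from
  \<open>local_bound\<close> multiply to R^\<open>\<eta>\<close>, which is why
  \<open>local_bound\<close> carries the exponent \<open>P - A - 1\<close>.\<close>

lemma weighted_inner_piece:
  assumes \<tau>: "0 < \<tau>" "\<tau> \<le> 1" and s: "0 \<le> s" and \<sigma>: "\<bar>\<sigma>\<bar> = 1" and R: "0 < R" "R \<le> 1/128"
    and S: "\<And>r. r \<in> S \<Longrightarrow> R \<le> r \<and> r \<le> 2 * R \<and> near_sq \<sigma> \<tau> r (s\<^sup>2)"
  shows "weighted S \<le> ennreal ((2 * 32 + 1) * C * 68 powr (P - A - 1) * \<tau> powr (\<eta> + A) * R powr \<eta>)"
proof -
  \<comment> \<open>34 R = 32 R \<open>\<tau>\<close> + 2 R at worst, with \<open>\<tau>\<close> at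
    most 1. The hypothesis that R is at most 1/128 keeps the length 68 R below 1.\<close>
  let ?F = "E \<inter> {s - 34 * R .. s - 34 * R + 68 * R}"
  let ?b = "C * (R * \<tau>) powr (\<eta> + A) * (68 * R) powr (P - A - 1)"
  have R\<tau>: "R * \<tau> \<le> R" using R \<tau> by (simp add: mult_left_le)
  have "weighted S \<le> ennreal (R powr (1 - P) * (2 * 32 + 1) * ?b)"
  proof (rule weighted_translates[where F = ?F and c = "\<sigma> * s" and \<sigma> = "- \<sigma>" and \<delta> = "R * \<tau>"])
    show "S \<subseteq> {r. \<exists>t\<in>?F. \<bar>r - (\<sigma> * s + - \<sigma> * t)\<bar> < 32 * (R * \<tau>)}"
    proof
      fix r assume "r \<in> S"
      note r = S[OF this]
      then obtain t where t: "t \<in> E" "\<bar>s\<^sup>2 - (r + \<sigma> * t)\<^sup>2\<bar> < 8 * r * \<tau>" unfolding near_sq_def by auto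
      have t12: "1 \<le> t" "t \<le> 2" using t(1) E by auto
      have s1: "\<sigma> = 1 \<or> \<sigma> = -1" using \<sigma> by auto
      have "(r + \<sigma> * t)\<^sup>2 = (t + \<sigma> * r)\<^sup>2" using s1 by (auto simp: power2_eq_square algebra_simps)
      then have "\<bar>s\<^sup>2 - (t + \<sigma> * r)\<^sup>2\<bar> < 8 * r * \<tau>" using t(2) by simp
      also have "8 * r * \<tau> \<le> 8 * (2 * R) * \<tau>" using r \<tau> by (intro mult_right_mono mult_left_mono) auto
      finally have t2: "\<bar>s\<^sup>2 - (t + \<sigma> * r)\<^sup>2\<bar> < 16 * R * \<tau>" by simp
      have half: "1 / 2 \<le> t + \<sigma> * r" using s1 r R t12 by auto
      have "\<bar>s - (t + \<sigma> * r)\<bar> < 16 * R * \<tau> / (1/2)"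
        by (rule abs_diff_squares_less[OF t2]) (use s half in auto)
      then have 1: "\<bar>s - (t + \<sigma> * r)\<bar> < 32 * (R * \<tau>)" by simp
      then have "\<bar>r - (\<sigma> * s + - \<sigma> * t)\<bar> < 32 * (R * \<tau>)" using s1 by (auto simp: abs_less_iff)
      moreover have "t \<in> {s - 34 * R .. s - 34 * R + 68 * R}"
        using 1 s1 r R\<tau> by (auto simp: abs_less_iff)
      ultimately show "r \<in> {r. \<exists>t\<in>?F. \<bar>r - (\<sigma> * s + - \<sigma> * t)\<bar> < 32 * (R * \<tau>)}" using t(1) by blast
    qed
    show "R * \<tau> * real (covering_number ?F (R * \<tau>)) \<le> ?b"
      using R \<tau> R\<tau> by (intro local_bound) auto
    show "r powr (1 - P) \<le> R powr (1 - P)" if "r \<in> S" for r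
      using S[OF that] R P by (intro powr_mono2') auto
  qed (use E R \<tau> \<sigma> in auto)
  also have "R powr (1 - P) * (2 * 32 + 1) * ?b
     = (2 * 32 + 1) * C * 68 powr (P - A - 1) * \<tau> powr (\<eta> + A) * R powr \<eta>"
  proof -
    have "R powr (1 - P) * (R powr (\<eta> + A) * R powr (P - A - 1)) = R powr \<eta>"
      by (simp add: powr_add[symmetric])
    then show ?thesis using R \<tau> by (simp add: powr_mult ac_simps)
  qed
  finally show ?thesis .
qed

lemma weighted_inner:
  assumes \<tau>: "0 < \<tau>" "\<tau> \<le> 1" and s: "0 \<le> s" and \<sigma>: "\<bar>\<sigma>\<bar> = 1"
  shows "weighted {r. 0 < r \<and> r \<le> 1/64 \<and> near_sq \<sigma> \<tau> r (s\<^sup>2)}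
     \<le> ennreal ((2 * 32 + 1) * C * 68 powr (P - A - 1) * \<tau> powr (\<eta> + A) * (1 / (1 - (1/2) powr \<eta>)))"
proof -
  \<comment> \<open>The exponent \<open>Suc m\<close> makes \<open>R m\<close> the lower end of the
    dyadic shell (R, 2 R], so that the shells exhaust (0, 1/64] and the largest R is 1/128. The
    bounds R^\<open>\<eta>\<close> then form a convergent geometric series.\<close>
  define R :: "nat \<Rightarrow> real" where "R m = (1/2) ^ Suc m / 64" for m
  define S where "S m = {r. R m < r \<and> r \<le> 2 * R m \<and> near_sq \<sigma> \<tau> r (s\<^sup>2)}" for m
  let ?c = "(2 * 32 + 1) * C * 68 powr (P - A - 1) * \<tau> powr (\<eta> + A)"
  have R0: "0 < R m" "R m \<le> 1/128" for m
    using power_le_one[of "1/2::real" m] by (auto simp: R_def)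
  have Rp: "R m powr \<eta> \<le> ((1/2) powr \<eta>) ^ m" for m
  proof -
    have "R m \<le> (1/2) ^ m" by (simp add: R_def)
    then have "R m powr \<eta> \<le> ((1/2) ^ m) powr \<eta>" using R0(1)[of m] \<eta> by (intro powr_mono2) auto
    also have "\<dots> = ((1/2) powr \<eta>) ^ m"
      by (simp add: powr_realpow[symmetric] powr_powr mult.commute)
    finally show ?thesis .
  qed
  have [measurable]: "S m \<in> sets borel" for m
  proof -
    have "S m = {R m<..2 * R m} \<inter> {r. near_sq \<sigma> \<tau> r (s\<^sup>2)}" by (auto simp: S_def)
    then show ?thesis using open_near_sq_section by auto
  qed
  have "weighted {r. 0 < r \<and> r \<le> 1/64 \<and> near_sq \<sigma> \<tau> r (s\<^sup>2)}
      \<le> (\<integral>\<^sup>+r. (\<Sum>m. ennreal (r powr (1 - P)) * indicator (S m) r) \<partial>lborel)"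
    unfolding weighted_def
  proof (rule nn_integral_mono)
    fix r :: real
    show "ennreal (r powr (1 - P)) * indicator {r. 0 < r \<and> r \<le> 1/64 \<and> near_sq \<sigma> \<tau> r (s\<^sup>2)} r
       \<le> (\<Sum>m. ennreal (r powr (1 - P)) * indicator (S m) r)"
    proof (cases "r \<in> {r. 0 < r \<and> r \<le> 1/64 \<and> near_sq \<sigma> \<tau> r (s\<^sup>2)}")
      case True
      then obtain m where "(1/2) ^ Suc m < 64 * r" "64 * r \<le> (1/2) ^ m"
        using dyadic_scale[of "64 * r"] by auto
      then have "r \<in> S m" using True by (simp add: S_def R_def)
      let ?f = "\<lambda>m. ennreal (r powr (1 - P)) * indicator (S m) r"
      have "sum ?f {m} \<le> suminf ?f" by (rule sum_le_suminf) auto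
      moreover have "sum ?f {m} = ?f m" by (subst sum.insert) auto
      ultimately show ?thesis using True \<open>r \<in> S m\<close> by simp
    qed simp
  qed
  also have "\<dots> = (\<Sum>m. weighted (S m))"
    unfolding weighted_def by (rule nn_integral_suminf) measurable
  also have "\<dots> \<le> (\<Sum>m. ennreal (?c * ((1/2) powr \<eta>) ^ m))"
  proof (rule suminf_le)
    fix m
    have "weighted (S m) \<le> ennreal (?c * R m powr \<eta>)"
      using \<tau> s \<sigma> R0[of m] by (rule weighted_inner_piece) (auto simp: S_def)
    also have "\<dots> \<le> ennreal (?c * ((1/2) powr \<eta>) ^ m)"
      using C Rp[of m] by (intro ennreal_leI mult_left_mono) auto
    finally show "weighted (S m) \<le> ennreal (?c * ((1/2) powr \<eta>) ^ m)" .
  qed auto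
  also have "\<dots> = ennreal (?c * (1 / (1 - (1/2) powr \<eta>)))"
  proof -
    have "(1/2) powr \<eta> < (1/2::real) powr 0" using \<eta> by (intro powr_less_mono') auto
    then have "(\<lambda>m. ((1/2::real) powr \<eta>) ^ m) sums (1 / (1 - (1/2) powr \<eta>))"
      by (intro geometric_sums) auto
    then have "(\<lambda>m. ?c * ((1/2::real) powr \<eta>) ^ m) sums (?c * (1 / (1 - (1/2) powr \<eta>)))"
      by (rule sums_mult)
    then show ?thesis using C by (intro suminf_ennreal_eq) auto
  qed
  finally show ?thesis .
qed

text \<open>Small r gives the local condition; large r, and the far tangency at moderate r, give the
  trivial scale; the near tangency at moderate r is the only case that halves \<open>\<eta>\<close>.
  The constant does not depend on w, as Tonelli requires.\<close>

lemma weighted_near_sq: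
  obtains K where "0 \<le> K" "\<And>\<sigma> \<tau> w. \<sigma> = 1 \<or> \<sigma> = -1 \<Longrightarrow> 0 < \<tau> \<Longrightarrow> \<tau> \<le> 1 \<Longrightarrow> 0 \<le> w \<Longrightarrow>
    weighted {r. 0 < r \<and> near_sq \<sigma> \<tau> r w} \<le> ennreal (K * \<tau> powr (\<eta> / 2 + A))"
proof -
  define K1 where "K1 = (2 * 32 + 1) * C * 68 powr (P - A - 1) * (1 / (1 - (1/2) powr \<eta>))"
  define K2 where "K2 = (1/64) powr (1 - P) * (2 * 16 + 1) * C"
  define K3 where "K3 = (1/64) powr (1 - P) * (2 * 10 + 1) * C + 2 * ((1/64) powr (1 - P) * (2 * 32 + 1) * (C * (1 + 7 powr (- A))))"
  have "(1/2) powr \<eta> < (1/2::real) powr 0" using \<eta> by (intro powr_less_mono') auto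
  then have K: "0 \<le> K1" "0 \<le> K2" "0 \<le> K3" using C by (auto simp: K1_def K2_def K3_def)
  have "weighted {r. 0 < r \<and> near_sq \<sigma> \<tau> r w} \<le> ennreal ((K1 + (K2 + K3)) * \<tau> powr (\<eta> / 2 + A))"
    if \<sigma>: "\<sigma> = 1 \<or> \<sigma> = -1" and \<tau>: "0 < \<tau>" "\<tau> \<le> 1" and w: "0 \<le> w" for \<sigma> \<tau> w
  proof -
    define s where "s = sqrt w"
    have s: "0 \<le> s" "s\<^sup>2 = w" using w by (auto simp: s_def)
    have s1: "\<bar>\<sigma>\<bar> = 1" using \<sigma> by auto
    have \<tau>p: "\<tau> powr (\<eta> + A) \<le> \<tau> powr (\<eta> / 2 + A)" using \<tau> \<eta> by (intro powr_mono') auto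
    let ?T = "\<tau> powr (\<eta> / 2 + A)"
    have meas: "{r. Q r \<and> near_sq \<sigma> \<tau> r w} \<in> sets borel" if "{r. Q r} \<in> sets borel" for Q
      using sets.Int[OF that, of "{r. near_sq \<sigma> \<tau> r w}"] open_near_sq_section[of \<sigma> \<tau> w] by (simp add: Collect_conj_eq)
    let ?I = "{r. (0 < r \<and> r \<le> 1/64) \<and> near_sq \<sigma> \<tau> r w}"
    let ?O = "{r. (1/64 < r \<and> (\<sigma> = 1 \<or> 4 \<le> r)) \<and> near_sq \<sigma> \<tau> r w}"
    let ?M = "{r. (1/64 < r \<and> \<sigma> = -1 \<and> r \<le> 4) \<and> near_sq \<sigma> \<tau> r w}"
    have I: "weighted ?I \<le> ennreal (K1 * ?T)"
    proof -
      have "weighted ?I \<le> ennreal ((2 * 32 + 1) * C * 68 powr (P - A - 1) * \<tau> powr (\<eta> + A) * (1 / (1 - (1/2) powr \<eta>)))"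
        using weighted_inner[OF \<tau> s(1) s1] unfolding s(2) by simp
      also have "\<dots> = ennreal (K1 * \<tau> powr (\<eta> + A))" by (simp add: K1_def)
      also have "\<dots> \<le> ennreal (K1 * ?T)" using K \<tau>p by (intro ennreal_leI mult_left_mono) auto
      finally show ?thesis .
    qed
    have O: "weighted ?O \<le> ennreal (K2 * ?T)"
    proof -
      have "weighted ?O \<le> ennreal ((1/64) powr (1 - P) * (2 * 16 + 1) * (C * \<tau> powr (\<eta> + A)))"
        using weighted_outer[OF \<tau> s(1) s1, of ?O] unfolding s(2) by auto
      also have "\<dots> = ennreal (K2 * \<tau> powr (\<eta> + A))" by (simp add: K2_def mult.assoc)
      also have "\<dots> \<le> ennreal (K2 * ?T)" using K \<tau>p by (intro ennreal_leI mult_left_mono) auto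
      finally show ?thesis .
    qed
    have M: "weighted ?M \<le> ennreal (K3 * ?T)"
    proof (cases "\<sigma> = -1")
      case False
      then show ?thesis by (simp add: weighted_def)
    next
      case True
      show ?thesis
      proof (cases "s\<^sup>2 < 64 * \<tau>")
        case True
        have "weighted ?M \<le> ennreal ((1/64) powr (1 - P) * (2 * 10 + 1) * (C * ?T))"
          using weighted_middle_small[OF \<tau> s(1) True, of ?M] \<open>\<sigma> = -1\<close> unfolding s(2) by auto
        also have "\<dots> \<le> ennreal (K3 * ?T)"
          unfolding K3_def using C by (intro ennreal_leI) (simp add: algebra_simps)
        finally show ?thesis .
      next
        case False
        then have "64 * \<tau> \<le> s\<^sup>2" by simp
        from weighted_middle_large[OF \<tau> s(1) this, of ?M]
        have "weighted ?M \<le> ennreal (2 * ((1/64) powr (1 - P) * (2 * 32 + 1) * (C * (1 + 7 powr (- A)) * ?T)))"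
          using \<open>\<sigma> = -1\<close> unfolding s(2) by auto
        also have "\<dots> \<le> ennreal (K3 * ?T)"
          unfolding K3_def using C by (intro ennreal_leI) (simp add: algebra_simps)
        finally show ?thesis .
      qed
    qed
    have "weighted {r. 0 < r \<and> near_sq \<sigma> \<tau> r w} \<le> weighted ?I + weighted (?O \<union> ?M)"
    proof (rule weighted_Un)
      show "{r. 0 < r \<and> near_sq \<sigma> \<tau> r w} \<subseteq> ?I \<union> (?O \<union> ?M)" using \<sigma> by auto
    qed (intro meas sets.Un; measurable)+
    also have "weighted (?O \<union> ?M) \<le> weighted ?O + weighted ?M"
      by (rule weighted_Un[OF order_refl]) (intro meas; measurable)+
    also have "weighted ?I + (weighted ?O + weighted ?M) \<le> ennreal (K1 * ?T) + (ennreal (K2 * ?T) + ennreal (K3 * ?T))"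
      by (intro add_mono I O M)
    also have "\<dots> = ennreal ((K1 + (K2 + K3)) * ?T)"
      using K by (simp add: ennreal_plus[symmetric] algebra_simps del: ennreal_plus)
    finally show ?thesis by (simp add: add_left_mono)
  qed
  then show ?thesis using that[of "K1 + (K2 + K3)"] K by auto
qed

end

section \<open>Sufficiency\<close>

lemma ennreal_powr_ennreal: "0 \<le> a \<Longrightarrow> ennreal_powr (ennreal a) s = ennreal (a powr s)"
  by (simp add: ennreal_powr_def)

lemma ennreal_powr_mono:
  assumes "a \<le> b" "0 < s" shows "ennreal_powr a s \<le> ennreal_powr b s"
proof (cases "b = \<infinity>")
  case False
  then have "a \<noteq> \<infinity>" using assms(1) by (auto simp: top_unique)
  then show ?thesis using False assms
    by (auto simp: ennreal_powr_def intro!: ennreal_leI powr_mono2 enn2real_mono simp: top.not_eq_extremum)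
qed (simp add: ennreal_powr_def)

lemma ennreal_powr_inverse:
  assumes "0 < s" shows "ennreal_powr (ennreal_powr a s) (1 / s) = a"
proof (cases "a = \<infinity>")
  case False
  then obtain x where "a = ennreal x" "0 \<le> x" by (cases a) auto
  then show ?thesis using assms by (simp add: ennreal_powr_ennreal powr_powr)
qed (simp add: ennreal_powr_def)

lemma ennreal_powr_cmult:
  assumes "0 < c" shows "ennreal_powr (ennreal c * a) s = ennreal (c powr s) * ennreal_powr a s"
proof (cases "a = \<infinity>")
  case False
  then obtain x where "a = ennreal x" "0 \<le> x" by (cases a) auto
  then show ?thesis using assms by (simp add: ennreal_mult[symmetric] ennreal_powr_ennreal powr_mult)
qed (use assms in \<open>simp add: ennreal_powr_def ennreal_mult_top\<close>)

context dilation_bounds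
begin

text \<open>A dyadic majorant of sin^(-2 \<open>\<gamma>\<close>) along all circles with t in E at
  once. The sets of pairs (r, w) are open as unions over t, so the kernel is jointly measurable for
  arbitrary E.\<close>

definition scale_sum :: "real \<Rightarrow> real \<Rightarrow> real \<Rightarrow> ennreal" where
  "scale_sum \<gamma> r w = (\<Sum>k. ennreal (2 powr (real k * \<gamma>)) *
     (indicator {p. near_sq 1 ((1/2)^k) (fst p) (snd p)} (r, w) +
      indicator {p. near_sq (-1) ((1/2)^k) (fst p) (snd p)} (r, w)))"

lemma measurable_scale_sum [measurable]:
  "(\<lambda>p. scale_sum \<gamma> (fst p) (snd p)) \<in> borel_measurable (borel \<Otimes>\<^sub>M borel)"
proof -
  have "(\<lambda>p. scale_sum \<gamma> (fst p) (snd p)) \<in> borel_measurable (borel :: (real \<times> real) measure)"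
    unfolding scale_sum_def prod.collapse by measurable
  then show ?thesis by (simp add: borel_prod)
qed

lemma measurable_scale_sum_sections [measurable]:
  "scale_sum \<gamma> r \<in> borel_measurable borel" "(\<lambda>r. scale_sum \<gamma> r w) \<in> borel_measurable borel"
proof -
  have "(\<lambda>w. (r, w)) \<in> borel \<rightarrow>\<^sub>M borel \<Otimes>\<^sub>M borel" "(\<lambda>r. (r, w)) \<in> borel \<rightarrow>\<^sub>M borel \<Otimes>\<^sub>M borel"
    by measurable
  from this[THEN measurable_compose, OF measurable_scale_sum[of \<gamma>]]
  show "scale_sum \<gamma> r \<in> borel_measurable borel" "(\<lambda>r. scale_sum \<gamma> r w) \<in> borel_measurable borel"
    by simp_all
qed

text \<open>The quantity 1 - |cos| is comparable to sin^2 and measures the distance of the squared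
  radius to its value at the nearer tangency. If it is of size 2^(-k), then sin^(-2
  \<open>\<gamma>\<close>) is of size 2^(k \<open>\<gamma>\<close>), the coefficient of the k-th
  term. One factor sin is kept as the Jacobian.\<close>

lemma sin_powr_le_scale_sum:
  assumes r: "0 < r" and t: "t \<in> E" and \<theta>: "0 < \<theta>" "\<theta> < pi"
  shows "ennreal (sin \<theta> powr (1 - 2 * \<gamma>))
     \<le> ennreal (2 powr \<bar>\<gamma>\<bar>) * (scale_sum \<gamma> r (chord_sq r t \<theta>) * ennreal (sin \<theta>))"
proof -
  have t12: "1 \<le> t" "t \<le> 2" using t E by auto
  let ?w = "chord_sq r t \<theta>"
  \<comment> \<open>A nonnegative cosine means the half of the circle facing the origin, where (r -
    t)^2 is the nearer tangential value.\<close>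
  define \<sigma> :: real where "\<sigma> = (if 0 \<le> cos \<theta> then -1 else 1)"
  define m where "m = 1 - \<bar>cos \<theta>\<bar>"
  have sin: "0 < sin \<theta>" using \<theta> by (rule sin_gt_zero)
  have sin2: "(sin \<theta>)\<^sup>2 = m * (2 - m)"
    by (simp add: m_def sin_squared_eq power2_eq_square algebra_simps abs_mult_self_eq)
  have m: "0 < m" "m \<le> 1"
  proof -
    have "0 < m * (2 - m)" using sin sin2 by (metis zero_less_power)
    moreover have "m \<le> 1" unfolding m_def by simp
    ultimately show "0 < m" "m \<le> 1" by (auto simp: zero_less_mult_iff)
  qed
  obtain k where k: "(1/2)^(Suc k) < m" "m \<le> (1/2)^k" using dyadic_scale[OF m] .
  define y where "y = (sin \<theta>)\<^sup>2 * 2 ^ k"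
  have y: "1/2 \<le> y" "y \<le> 2"
  proof -
    have "m \<le> (sin \<theta>)\<^sup>2" "(sin \<theta>)\<^sup>2 \<le> 2 * m" using m unfolding sin2 by (auto simp: algebra_simps mult_left_le power2_eq_square)
    then have "(1/2)^(Suc k) \<le> (sin \<theta>)\<^sup>2" "(sin \<theta>)\<^sup>2 \<le> 2 * (1/2)^k" using k by linarith+
    then have "(1/2)^(Suc k) * 2^k \<le> y" "y \<le> (2 * (1/2)^k) * 2^k"
      unfolding y_def by (simp_all only: mult_right_mono zero_le_numeral zero_le_power)
    then show "1/2 \<le> y" "y \<le> 2" by (simp_all add: power_one_over)
  qed
  have "?w - (r + \<sigma> * t)\<^sup>2 = (if 0 \<le> cos \<theta> then 2 * r * t * m else - (2 * r * t * m))"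
    by (auto simp: \<sigma>_def m_def power2_eq_square algebra_simps)
  then have "\<bar>?w - (r + \<sigma> * t)\<^sup>2\<bar> = 2 * r * t * m" using r t12 m by (simp add: abs_mult)
  also have "\<dots> \<le> 2 * r * 2 * (1/2)^k" using r t12 m k by (intro mult_mono) auto
  also have "\<dots> < 8 * r * (1/2)^k" using r by simp
  finally have near: "near_sq \<sigma> ((1/2)^k) r ?w" unfolding near_sq_def using t by blast
  have "sin \<theta> powr (1 - 2 * \<gamma>) = sin \<theta> powr (- 2 * \<gamma>) * sin \<theta>"
    using sin powr_add[of "sin \<theta>" "- 2 * \<gamma>" 1] by simp
  also have "sin \<theta> powr (- 2 * \<gamma>) = ((sin \<theta>)\<^sup>2) powr (- \<gamma>)"
    using sin powr_powr[of "sin \<theta>" 2 "- \<gamma>"] by (simp add: powr_numeral)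
  also have "(sin \<theta>)\<^sup>2 = y * 2 powr (- real k)"
    by (simp add: y_def powr_minus powr_realpow)
  also have "(y * 2 powr (- real k)) powr (- \<gamma>) = y powr (- \<gamma>) * 2 powr (real k * \<gamma>)"
    using y by (simp add: powr_mult powr_powr)
  also have "y powr (- \<gamma>) \<le> 2 powr \<bar>\<gamma>\<bar>"
  proof (cases "0 \<le> \<gamma>")
    case True
    have "y powr (- \<gamma>) \<le> (1/2) powr (- \<gamma>)" using y True by (intro powr_mono2') auto
    then show ?thesis using True by (simp add: powr_divide powr_minus divide_simps)
  next
    case False
    then show ?thesis using y by (simp add: powr_mono2)
  qed
  finally have "sin \<theta> powr (1 - 2 * \<gamma>) \<le> 2 powr \<bar>\<gamma>\<bar> * 2 powr (real k * \<gamma>) * sin \<theta>"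
    using sin by (simp add: mult_right_mono)
  then have "ennreal (sin \<theta> powr (1 - 2 * \<gamma>)) \<le> ennreal (2 powr \<bar>\<gamma>\<bar>) * (ennreal (2 powr (real k * \<gamma>)) * ennreal (sin \<theta>))"
    using sin by (simp add: ennreal_mult[symmetric] ennreal_leI mult.assoc)
  also have "ennreal (2 powr (real k * \<gamma>)) \<le> scale_sum \<gamma> r ?w"
  proof -
    let ?f = "\<lambda>k. ennreal (2 powr (real k * \<gamma>)) *
     (indicator {p. near_sq 1 ((1/2)^k) (fst p) (snd p)} (r, ?w) +
      indicator {p. near_sq (-1) ((1/2)^k) (fst p) (snd p)} (r, ?w))"
    have "(1::ennreal) \<le> indicator {p. near_sq 1 ((1/2)^k) (fst p) (snd p)} (r, ?w) +
      indicator {p. near_sq (-1) ((1/2)^k) (fst p) (snd p)} (r, ?w)"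
      using near by (auto simp: \<sigma>_def split: if_splits)
    then have "ennreal (2 powr (real k * \<gamma>)) * 1 \<le> ?f k" by (intro mult_left_mono) auto
    also have "?f k = sum ?f {k}" by (subst sum.insert) auto
    also have "\<dots> \<le> suminf ?f" by (rule sum_le_suminf) auto
    finally show ?thesis unfolding scale_sum_def by simp
  qed
  finally show ?thesis by (simp add: mult_left_mono mult_right_mono)
qed

text \<open>The k-th scale contributes 2^(k \<open>\<gamma>\<close>) times 2^(-k (A +
  \<open>\<eta>\<close> / 2)), at most 2^(-k \<open>\<eta>\<close> / 4): a quarter of
  \<open>\<eta>\<close> is left for convergence after \<open>\<gamma>\<close> has used a
  quarter.\<close>

lemma weighted_scale_sum:
  assumes "\<gamma> \<le> A + \<eta> / 4"
  obtains K where "0 \<le> K" "\<And>w. 0 \<le> w \<Longrightarrow>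
    (\<integral>\<^sup>+r. ennreal (r powr (1 - P)) * (scale_sum \<gamma> r w * indicator {0<..} r) \<partial>lborel) \<le> ennreal K"
proof -
  obtain K where K: "0 \<le> K" "\<And>\<sigma> \<tau> w. \<sigma> = 1 \<or> \<sigma> = -1 \<Longrightarrow> 0 < \<tau> \<Longrightarrow> \<tau> \<le> 1 \<Longrightarrow> 0 \<le> w \<Longrightarrow>
    weighted {r. 0 < r \<and> near_sq \<sigma> \<tau> r w} \<le> ennreal (K * \<tau> powr (\<eta> / 2 + A))"
    using weighted_near_sq by blast
  define \<rho> :: real where "\<rho> = (1/2) powr (\<eta> / 4)"
  have "(1/2) powr (\<eta> / 4) < (1/2::real) powr 0" using \<eta> by (intro powr_less_mono') auto
  then have \<rho>: "0 \<le> \<rho>" "\<rho> < 1" by (auto simp: \<rho>_def)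
  have "(\<integral>\<^sup>+r. ennreal (r powr (1 - P)) * (scale_sum \<gamma> r w * indicator {0<..} r) \<partial>lborel) \<le> ennreal (2 * K * (1 / (1 - \<rho>)))"
    if w: "0 \<le> w" for w
  proof -
    let ?S = "\<lambda>\<sigma> k. {r. 0 < r \<and> near_sq \<sigma> ((1/2)^k) r w}"
    have S: "?S \<sigma> k \<in> sets borel" for \<sigma> k
    proof -
      have "?S \<sigma> k = {0<..} \<inter> {r. near_sq \<sigma> ((1/2)^k) r w}" by auto
      then show ?thesis using open_near_sq_section by auto
    qed
    have "(\<integral>\<^sup>+r. ennreal (r powr (1 - P)) * (scale_sum \<gamma> r w * indicator {0<..} r) \<partial>lborel)
      = (\<integral>\<^sup>+r. (\<Sum>k. ennreal (2 powr (real k * \<gamma>)) * (ennreal (r powr (1 - P)) * indicator (?S 1 k) r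
           + ennreal (r powr (1 - P)) * indicator (?S (-1) k) r)) \<partial>lborel)"
    proof (intro nn_integral_cong)
      fix r
      show "ennreal (r powr (1 - P)) * (scale_sum \<gamma> r w * indicator {0<..} r)
        = (\<Sum>k. ennreal (2 powr (real k * \<gamma>)) * (ennreal (r powr (1 - P)) * indicator (?S 1 k) r
           + ennreal (r powr (1 - P)) * indicator (?S (-1) k) r))"
        unfolding scale_sum_def ennreal_suminf_multc[symmetric] ennreal_suminf_cmult[symmetric]
        by (intro suminf_cong) (auto split: split_indicator simp: algebra_simps)
    qed
    also have "\<dots> = (\<Sum>k. ennreal (2 powr (real k * \<gamma>)) * (weighted (?S 1 k) + weighted (?S (-1) k)))"
      unfolding weighted_def using S by (subst nn_integral_suminf) (auto simp: nn_integral_cmult nn_integral_add)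
    also have "\<dots> \<le> (\<Sum>k. ennreal (2 * K * \<rho> ^ k))"
    proof (rule suminf_le)
      fix k
      have half: "((1/2)^k) powr (\<eta> / 2 + A) = 2 powr (- real k * (\<eta> / 2 + A))"
        using powr_powr[of 2 "- real k" "\<eta> / 2 + A"] by (simp add: powr_minus powr_realpow power_one_over inverse_eq_divide)
      have "weighted (?S \<sigma> k) \<le> ennreal (K * 2 powr (- real k * (\<eta> / 2 + A)))" if "\<sigma> = 1 \<or> \<sigma> = -1" for \<sigma>
        using K(2)[OF that _ _ w, of "(1/2)^k"] unfolding half by (simp add: power_le_one)
      then have "ennreal (2 powr (real k * \<gamma>)) * (weighted (?S 1 k) + weighted (?S (-1) k))
         \<le> ennreal (2 powr (real k * \<gamma>)) * (ennreal (K * 2 powr (- real k * (\<eta> / 2 + A))) + ennreal (K * 2 powr (- real k * (\<eta> / 2 + A))))"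
        by (intro mult_left_mono add_mono) auto
      also have "\<dots> = ennreal (2 * K * (2 powr (real k * \<gamma>) * 2 powr (- real k * (\<eta> / 2 + A))))"
        using K(1) by (simp add: ennreal_plus[symmetric] ennreal_mult[symmetric] algebra_simps del: ennreal_plus)
      also have "2 powr (real k * \<gamma>) * 2 powr (- real k * (\<eta> / 2 + A)) = 2 powr (real k * (\<gamma> - A - \<eta> / 2))"
        by (simp add: powr_add[symmetric] algebra_simps)
      also have "ennreal (2 * K * 2 powr (real k * (\<gamma> - A - \<eta> / 2))) \<le> ennreal (2 * K * 2 powr (real k * (- \<eta> / 4)))"
        using K(1) assms by (intro ennreal_leI mult_left_mono powr_mono) auto
      also have "2 powr (real k * (- \<eta> / 4)) = \<rho> ^ k"
        unfolding \<rho>_def by (simp add: powr_realpow[symmetric] powr_powr powr_divide powr_minus divide_simps mult.commute)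
      finally show "ennreal (2 powr (real k * \<gamma>)) * (weighted (?S 1 k) + weighted (?S (-1) k)) \<le> ennreal (2 * K * \<rho> ^ k)" .
    qed auto
    also have "\<dots> = ennreal (2 * K * (1 / (1 - \<rho>)))"
      using \<rho> K(1) by (intro suminf_ennreal_eq sums_mult geometric_sums) auto
    finally show ?thesis .
  qed
  then show ?thesis using that[of "2 * K * (1 / (1 - \<rho>))"] K(1) \<rho> by auto
qed

text \<open>Hoelder in the angle with weight sin: the normalisation of G controls the middle factor,
  and the exponent of sin in the remaining kernel is 1 - 2 \<open>\<gamma>\<close>. The majorant no
  longer refers to t, which is what makes the supremum harmless.\<close>

lemma circle_avg_power_bound:
  assumes uv: "0 < v" "v < u" "u < 1" and P: "P = u / v" and e: "0 \<le> e" "e < 1"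
    and \<gamma>: "\<gamma> = P - 1 / (2 * v) + (1 - e) * (1 - u) / (2 * v)"
  obtains K where "0 \<le> K" "\<And>G r t. G \<in> borel_measurable borel \<Longrightarrow> (\<And>w. 0 \<le> G w) \<Longrightarrow>
      (\<integral>\<^sup>+w. ennreal (G w powr (1 / u)) * indicator {0..} w \<partial>lborel) \<le> 1 \<Longrightarrow> 0 < r \<Longrightarrow> t \<in> E \<Longrightarrow>
      ennreal_powr (\<integral>\<^sup>+\<theta>. ennreal (G (chord_sq r t \<theta>)) * indicator {0..pi} \<theta> \<partial>lborel) (1 / v)
      \<le> ennreal (K * r powr (- P)) * (\<integral>\<^sup>+w. ennreal (G w powr (1 / u)) * indicator {0..} w * scale_sum \<gamma> r w \<partial>lborel)"
proof -
  obtain B where B: "0 \<le> B" "(\<integral>\<^sup>+\<theta>. ennreal (sin \<theta> powr (- e)) * indicator {0..pi} \<theta> \<partial>lborel) = ennreal B"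
    using nn_integral_sin_powr_finite[OF e]
    by (cases "\<integral>\<^sup>+\<theta>. ennreal (sin \<theta> powr (- e)) * indicator {0..pi} \<theta> \<partial>lborel") auto
  define b where "b = (e * (1 - u) - (u - v)) / v"
  have b\<gamma>: "b = 1 - 2 * \<gamma>" unfolding b_def \<gamma> P using uv by (simp add: field_simps)
  have bound: "ennreal_powr (\<integral>\<^sup>+\<theta>. ennreal (G (chord_sq r t \<theta>)) * indicator {0..pi} \<theta> \<partial>lborel) (1 / v)
      \<le> ennreal ((2 + B) powr (1 / v) * 2 powr \<bar>\<gamma>\<bar> * r powr (- P)) * (\<integral>\<^sup>+w. ennreal (G w powr (1 / u)) * indicator {0..} w * scale_sum \<gamma> r w \<partial>lborel)"
    if [measurable]: "G \<in> borel_measurable borel" and G: "\<And>w. 0 \<le> G w"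
      and I: "(\<integral>\<^sup>+w. ennreal (G w powr (1 / u)) * indicator {0..} w \<partial>lborel) \<le> 1" and r: "0 < r" and t: "t \<in> E"
    for G r t
  proof -
    have t12: "1 \<le> t" "t \<le> 2" using t E by auto
    let ?w = "\<lambda>\<theta>. chord_sq r t \<theta>"
    let ?M = "restrict_space lborel {0..pi}"
    \<comment> \<open>The true Jacobian is 2 r t sin \<open>\<theta>\<close>. Since t is at least 1
      it dominates r sin \<open>\<theta>\<close>, and enlarging the range of w to the half-line
      removes the remaining dependence on t.\<close>
    have subst: "(\<integral>\<^sup>+\<theta>. H (?w \<theta>) * ennreal (r * sin \<theta>) * indicator {0..pi} \<theta> \<partial>lborel)
       \<le> (\<integral>\<^sup>+w. H w * indicator {0..} w \<partial>lborel)" if [measurable]: "H \<in> borel_measurable borel" for H :: "real \<Rightarrow> ennreal"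
    proof -
      have "(\<integral>\<^sup>+\<theta>. H (?w \<theta>) * ennreal (r * sin \<theta>) * indicator {0..pi} \<theta> \<partial>lborel)
        \<le> (\<integral>\<^sup>+\<theta>. H (?w \<theta>) * ennreal (2 * r * t * sin \<theta>) * indicator {0..pi} \<theta> \<partial>lborel)"
      proof (intro nn_integral_mono)
        fix \<theta>
        show "H (?w \<theta>) * ennreal (r * sin \<theta>) * indicator {0..pi} \<theta> \<le> H (?w \<theta>) * ennreal (2 * r * t * sin \<theta>) * indicator {0..pi} \<theta>"
        proof (cases "\<theta> \<in> {0..pi}")
          case True
          then have "0 \<le> sin \<theta>" by (intro sin_ge_zero) auto
          moreover have "r * 1 \<le> r * (2 * t)" using r t12 by (intro mult_left_mono) auto
          ultimately have "r * sin \<theta> \<le> 2 * r * t * sin \<theta>" by (intro mult_right_mono) auto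
          from ennreal_leI[OF this] show ?thesis by (intro mult_right_mono mult_left_mono) auto
        qed simp
      qed
      also have "\<dots> = (\<integral>\<^sup>+w. H w * indicator {(r-t)\<^sup>2..(r+t)\<^sup>2} w \<partial>lborel)"
        using r t12 by (intro nn_integral_cosine_substitution) auto
      also have "\<dots> \<le> (\<integral>\<^sup>+w. H w * indicator {0..} w \<partial>lborel)"
        by (intro nn_integral_mono mult_left_mono) (auto split: split_indicator intro: order_trans[OF zero_le_power2])
      finally show ?thesis .
    qed
    \<comment> \<open>The factor r^u makes F^(1/u) sin equal to G^(1/u) r sin, so that the
      substitution bounds its integral by 1. Raised to the power 1 / v it becomes r^P.\<close>
    let ?F = "\<lambda>\<theta>. r powr u * G (?w \<theta>)"
    have Fp: "?F \<theta> powr (1 / u) = r * G (?w \<theta>) powr (1 / u)" for \<theta>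
      using r uv G by (simp add: powr_mult powr_powr)
    have pos: "AE \<theta> in ?M. 0 < sin \<theta>"
    proof -
      have "AE \<theta> in lborel. \<theta> \<notin> {0, pi}" by (intro AE_not_in finite_imp_null_set_lborel) simp
      then have "AE \<theta> in lborel. \<theta> \<in> {0..pi} \<longrightarrow> 0 < sin \<theta>"
        by eventually_elim (auto intro!: sin_gt_zero)
      then show ?thesis by (subst AE_restrict_space_iff) auto
    qed
    have res: "(\<integral>\<^sup>+\<theta>. h \<theta> \<partial>?M) = (\<integral>\<^sup>+\<theta>. h \<theta> * indicator {0..pi} \<theta> \<partial>lborel)" for h :: "real \<Rightarrow> ennreal"
      by (rule nn_integral_restrict_space) simp
    have "ennreal_powr (\<integral>\<^sup>+\<theta>. ennreal (?F \<theta>) \<partial>?M) (1 / v)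
      \<le> ennreal ((2 + B) powr (1 / v)) * (\<integral>\<^sup>+\<theta>. ennreal (?F \<theta> powr (1 / u) * sin \<theta> powr b) \<partial>?M)"
    proof (rule nn_integral_young_bound[OF uv b_def])
      show "?F \<in> borel_measurable ?M" "sin \<in> borel_measurable ?M"
        by (rule measurable_restrict_space1, measurable)+
      show "0 \<le> ?F \<theta>" for \<theta> using G by simp
      show "AE \<theta> in ?M. 0 < sin \<theta>" by (rule pos)
      show "(\<integral>\<^sup>+\<theta>. ennreal (sin \<theta> powr (- e)) \<partial>?M) \<le> ennreal B" unfolding res B(2) ..
      have "(\<integral>\<^sup>+\<theta>. ennreal (?F \<theta> powr (1 / u) * sin \<theta>) \<partial>?M)
         = (\<integral>\<^sup>+\<theta>. ennreal (G (?w \<theta>) powr (1 / u)) * ennreal (r * sin \<theta>) * indicator {0..pi} \<theta> \<partial>lborel)"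
        unfolding res Fp by (intro nn_integral_cong) (use r in \<open>auto split: split_indicator simp: ennreal_mult[symmetric] sin_ge_zero mult_ac\<close>)
      also have "\<dots> \<le> (\<integral>\<^sup>+w. ennreal (G w powr (1 / u)) * indicator {0..} w \<partial>lborel)"
        by (rule subst) measurable
      finally show "(\<integral>\<^sup>+\<theta>. ennreal (?F \<theta> powr (1 / u) * sin \<theta>) \<partial>?M) \<le> 1" using I by simp
    qed (use B in auto)
    also have "(\<integral>\<^sup>+\<theta>. ennreal (?F \<theta>) \<partial>?M)
       = ennreal (r powr u) * (\<integral>\<^sup>+\<theta>. ennreal (G (?w \<theta>)) * indicator {0..pi} \<theta> \<partial>lborel)"
      unfolding res by (subst nn_integral_cmult[symmetric]) (auto intro!: nn_integral_cong simp: ennreal_mult G mult.assoc)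
    also have "ennreal_powr \<dots> (1 / v) = ennreal (r powr P) * ennreal_powr (\<integral>\<^sup>+\<theta>. ennreal (G (?w \<theta>)) * indicator {0..pi} \<theta> \<partial>lborel) (1 / v)"
      using r by (simp add: ennreal_powr_cmult powr_powr P)
    finally have main: "ennreal (r powr P) * ennreal_powr (\<integral>\<^sup>+\<theta>. ennreal (G (?w \<theta>)) * indicator {0..pi} \<theta> \<partial>lborel) (1 / v)
      \<le> ennreal ((2 + B) powr (1 / v)) * (\<integral>\<^sup>+\<theta>. ennreal (?F \<theta> powr (1 / u) * sin \<theta> powr b) \<partial>?M)" .
    have "(\<integral>\<^sup>+\<theta>. ennreal (?F \<theta> powr (1 / u) * sin \<theta> powr b) \<partial>?M)
       \<le> (\<integral>\<^sup>+\<theta>. ennreal (2 powr \<bar>\<gamma>\<bar>) * (ennreal (G (?w \<theta>) powr (1 / u)) * scale_sum \<gamma> r (?w \<theta>) * ennreal (r * sin \<theta>) * indicator {0..pi} \<theta>) \<partial>lborel)"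
      unfolding res Fp
    proof (rule nn_integral_mono_AE)
      have "AE \<theta> in lborel. \<theta> \<notin> {0, pi}" by (intro AE_not_in finite_imp_null_set_lborel) simp
      then show "AE \<theta> in lborel. ennreal (r * G (?w \<theta>) powr (1 / u) * sin \<theta> powr b) * indicator {0..pi} \<theta>
        \<le> ennreal (2 powr \<bar>\<gamma>\<bar>) * (ennreal (G (?w \<theta>) powr (1 / u)) * scale_sum \<gamma> r (?w \<theta>) * ennreal (r * sin \<theta>) * indicator {0..pi} \<theta>)"
      proof eventually_elim
        case (elim \<theta>)
        show ?case
        proof (cases "\<theta> \<in> {0..pi}")
          case True
          then have \<theta>: "0 < \<theta>" "\<theta> < pi" using elim by auto
          have s: "0 < sin \<theta>" using \<theta> by (rule sin_gt_zero)
          have "ennreal (r * G (?w \<theta>) powr (1 / u) * sin \<theta> powr b)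
             = ennreal (r * G (?w \<theta>) powr (1 / u)) * ennreal (sin \<theta> powr (1 - 2 * \<gamma>))"
            unfolding b\<gamma> using r by (intro ennreal_mult) auto
          also have "\<dots> \<le> ennreal (r * G (?w \<theta>) powr (1 / u)) * (ennreal (2 powr \<bar>\<gamma>\<bar>) * (scale_sum \<gamma> r (?w \<theta>) * ennreal (sin \<theta>)))"
            by (intro mult_left_mono sin_powr_le_scale_sum r t \<theta>) auto
          also have "\<dots> = ennreal (2 powr \<bar>\<gamma>\<bar>) * (ennreal (G (?w \<theta>) powr (1 / u)) * scale_sum \<gamma> r (?w \<theta>) * ennreal (r * sin \<theta>))"
            using r s by (simp add: ennreal_mult mult_ac)
          finally show ?thesis using True by simp
        qed simp
      qed
    qed
    also have "\<dots> = ennreal (2 powr \<bar>\<gamma>\<bar>) * (\<integral>\<^sup>+\<theta>. (ennreal (G (?w \<theta>) powr (1 / u)) * scale_sum \<gamma> r (?w \<theta>)) * ennreal (r * sin \<theta>) * indicator {0..pi} \<theta> \<partial>lborel)"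
      by (rule nn_integral_cmult) measurable
    also have "\<dots> \<le> ennreal (2 powr \<bar>\<gamma>\<bar>) * (\<integral>\<^sup>+w. (ennreal (G w powr (1 / u)) * scale_sum \<gamma> r w) * indicator {0..} w \<partial>lborel)"
      by (intro mult_left_mono subst) auto
    finally have Z: "(\<integral>\<^sup>+\<theta>. ennreal (?F \<theta> powr (1 / u) * sin \<theta> powr b) \<partial>?M)
       \<le> ennreal (2 powr \<bar>\<gamma>\<bar>) * (\<integral>\<^sup>+w. ennreal (G w powr (1 / u)) * indicator {0..} w * scale_sum \<gamma> r w \<partial>lborel)"
      (is "_ \<le> _ * ?J") by (simp add: mult_ac)
    have "ennreal_powr (\<integral>\<^sup>+\<theta>. ennreal (G (?w \<theta>)) * indicator {0..pi} \<theta> \<partial>lborel) (1 / v)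
      = ennreal (r powr (- P)) * (ennreal (r powr P) * ennreal_powr (\<integral>\<^sup>+\<theta>. ennreal (G (?w \<theta>)) * indicator {0..pi} \<theta> \<partial>lborel) (1 / v))"
      using r by (simp add: mult.assoc[symmetric] ennreal_mult[symmetric] powr_add[symmetric])
    also have "\<dots> \<le> ennreal (r powr (- P)) * (ennreal ((2 + B) powr (1 / v)) * (ennreal (2 powr \<bar>\<gamma>\<bar>) * ?J))"
      by (intro mult_left_mono order_trans[OF main] Z) auto
    also have "\<dots> = ennreal ((2 + B) powr (1 / v) * 2 powr \<bar>\<gamma>\<bar> * r powr (- P)) * ?J"
      by (simp add: ennreal_mult mult_ac)
    finally show ?thesis .
  qed
  show ?thesis
    using that[of "(2 + B) powr (1 / v) * 2 powr \<bar>\<gamma>\<bar>"] bound by auto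
qed

end

lemma AE_norm_square_notin:
  assumes N: "N \<in> null_sets lborel"
  shows "AE x in (lborel :: (real^2) measure). (norm x)\<^sup>2 \<notin> N"
proof -
  have [measurable]: "N \<in> sets borel" using N by auto
  have "(\<integral>\<^sup>+x. indicator N ((norm x)\<^sup>2) \<partial>(lborel :: (real^2) measure))
     = ennreal pi * (\<integral>\<^sup>+w. indicator N w * indicator {0..} w \<partial>lborel)"
    by (rule nn_integral_norm_square) measurable
  also have "(\<integral>\<^sup>+w. indicator N w * indicator {0..} w \<partial>lborel) \<le> (\<integral>\<^sup>+w. indicator N w \<partial>lborel)"
    by (intro nn_integral_mono) (auto split: split_indicator)
  also have "\<dots> = 0" using N by auto
  finally have "(\<integral>\<^sup>+x. indicator N ((norm x)\<^sup>2) \<partial>(lborel :: (real^2) measure)) = 0"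
    by (simp add: mult_left_mono)
  then have "AE x in (lborel :: (real^2) measure). indicator N ((norm x)\<^sup>2) = (0::ennreal)"
    by (subst (asm) nn_integral_0_iff_AE) auto
  then show ?thesis by eventually_elim (auto split: split_indicator_asm)
qed

lemma Lp_norm_ennreal:
  assumes "0 < s"
  shows "Lp_norm (ennreal (1 / s)) g = ennreal_powr (\<integral>\<^sup>+x. ennreal_powr (g x) (1 / s) \<partial>lborel) s"
  using assms by (simp add: Lp_norm_def nn_integral_completion)

lemma nn_integral_radial_power:
  fixes f :: "real^2 \<Rightarrow> complex"
  assumes \<phi>[measurable]: "\<phi> \<in> borel_measurable borel" and N: "N \<in> null_sets lborel"
    and f: "\<And>x. (norm x)\<^sup>2 \<notin> N \<Longrightarrow> f x = \<phi> ((norm x)\<^sup>2)"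
  shows "(\<integral>\<^sup>+x. ennreal_powr (ennreal (cmod (f x))) s \<partial>lborel)
     = ennreal pi * (\<integral>\<^sup>+w. ennreal (cmod (\<phi> w) powr s) * indicator {0..} w \<partial>lborel)"
proof -
  have "(\<integral>\<^sup>+x. ennreal_powr (ennreal (cmod (f x))) s \<partial>lborel)
      = (\<integral>\<^sup>+x. ennreal (cmod (\<phi> ((norm x)\<^sup>2)) powr s) \<partial>(lborel :: (real^2) measure))"
    using AE_norm_square_notin[OF N]
    by (intro nn_integral_cong_AE) (auto elim!: eventually_mono simp: f ennreal_powr_ennreal)
  also have "\<dots> = ennreal pi * (\<integral>\<^sup>+w. ennreal (cmod (\<phi> w) powr s) * indicator {0..} w \<partial>lborel)"
    by (rule nn_integral_norm_square) measurable
  finally show ?thesis .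
qed

text \<open>The majorant \<open>D\<close> is uniform in t, so the supremum is taken pointwise before
  any integration. The constant \<open>c\<close> rescales the profile to the normalisation demanded
  by the Hoelder bound.\<close>

lemma max_fun_le:
  assumes E: "E \<subseteq> {1..2}"
    and \<phi>[measurable]: "\<phi> \<in> borel_measurable borel" and N: "N \<in> null_sets lborel"
    and f: "\<And>x. (norm x)\<^sup>2 \<notin> N \<Longrightarrow> f x = \<phi> ((norm x)\<^sup>2)" and x: "x \<noteq> 0"
    and c: "0 < c" and v: "0 < v"
    and D: "\<And>t. t \<in> E \<Longrightarrow> ennreal_powr (\<integral>\<^sup>+\<theta>. ennreal (c * cmod (\<phi> (chord_sq (norm x) t \<theta>))) * indicator {0..pi} \<theta> \<partial>lborel) (1 / v) \<le> D"
  shows "ennreal_powr (max_fun E f x) (1 / v) \<le> ennreal (c powr (- (1 / v))) * D"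
proof -
  have "ennreal c * max_fun E f x \<le> ennreal_powr D v"
    unfolding max_fun_def SUP_mult_left_ennreal
  proof (rule SUP_least)
    fix t assume t: "t \<in> E"
    then have t0: "0 < t" using E by force
    let ?a = "\<integral>\<^sup>+\<theta>. ennreal (cmod (\<phi> (chord_sq (norm x) t \<theta>))) * indicator {0..pi} \<theta> \<partial>lborel"
    let ?b = "\<integral>\<^sup>+\<theta>. ennreal (c * cmod (\<phi> (chord_sq (norm x) t \<theta>))) * indicator {0..pi} \<theta> \<partial>lborel"
    have "abs_circle_avg t f x \<le> ennreal (1 / pi) * ?a"
      by (rule abs_circle_avg_le[OF \<phi> N f x t0])
    also have "\<dots> \<le> 1 * ?a" using pi_ge_two by (intro mult_right_mono) auto
    finally have "ennreal c * abs_circle_avg t f x \<le> ennreal c * ?a" by (simp add: mult_left_mono)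
    also have "\<dots> = ?b"
      using c by (subst nn_integral_cmult[symmetric]) (auto intro!: nn_integral_cong simp: ennreal_mult mult.assoc)
    also have "?b = ennreal_powr (ennreal_powr ?b (1 / v)) (1 / (1 / v))"
      using v by (subst ennreal_powr_inverse) auto
    also have "\<dots> \<le> ennreal_powr D (1 / (1 / v))" using D[OF t] v by (intro ennreal_powr_mono) auto
    finally show "ennreal c * abs_circle_avg t f x \<le> ennreal_powr D v" by simp
  qed
  then have "ennreal_powr (ennreal c * max_fun E f x) (1 / v) \<le> ennreal_powr (ennreal_powr D v) (1 / v)"
    using v by (intro ennreal_powr_mono) auto
  then have *: "ennreal (c powr (1 / v)) * ennreal_powr (max_fun E f x) (1 / v) \<le> D"
    using v c by (simp add: ennreal_powr_inverse ennreal_powr_cmult)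
  have "ennreal_powr (max_fun E f x) (1 / v)
      = ennreal (c powr (- (1 / v))) * (ennreal (c powr (1 / v)) * ennreal_powr (max_fun E f x) (1 / v))"
    using c by (simp add: mult.assoc[symmetric] ennreal_mult[symmetric] powr_add[symmetric])
  also have "\<dots> \<le> ennreal (c powr (- (1 / v))) * D" by (intro mult_left_mono *) simp
  finally show ?thesis .
qed

context dilation_bounds
begin

text \<open>Integrated in polar coordinates, the bound for single circles becomes a double integral
  of |f|^p against \<open>scale_sum\<close>. With w as the outer variable, the inner integral in r
  is bounded uniformly, leaving the normalised norm of f.\<close>

theorem max_bounded_rad_of_exponents:
  assumes uv: "0 < v" "v < u" "u < 1" and Pu: "P = u / v" and A: "A = P - 1 / (2 * v)"
  shows "max_bounded_rad E (ennreal (1 / u)) (ennreal (1 / v))"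
proof -
  \<comment> \<open>Close enough to 1 that \<open>\<gamma>\<close> - A = (1 - e) (1 - u) / (2 v) is
    at most \<open>\<eta>\<close> / 4; the maximum keeps e nonnegative.\<close>
  define e where "e = max 0 (1 - \<eta> * v / (2 * (1 - u)))"
  have e: "0 \<le> e" "e < 1" using uv \<eta> by (auto simp: e_def)
  define \<gamma> where "\<gamma> = P - 1 / (2 * v) + (1 - e) * (1 - u) / (2 * v)"
  have "\<gamma> \<le> A + \<eta> / 4"
  proof -
    have "1 - e \<le> \<eta> * v / (2 * (1 - u))" by (simp add: e_def)
    then have "(1 - e) * (1 - u) \<le> \<eta> * v / (2 * (1 - u)) * (1 - u)" using uv by (intro mult_right_mono) auto
    also have "\<dots> = \<eta> * v / 2" using uv by (simp add: divide_simps)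
    finally have "(1 - e) * (1 - u) / (2 * v) \<le> (\<eta> * v / 2) / (2 * v)" using uv by (intro divide_right_mono) auto
    also have "\<dots> = \<eta> / 4" using uv by simp
    finally show ?thesis unfolding \<gamma>_def A by simp
  qed
  then obtain K1 where K1: "0 \<le> K1" "\<And>w. 0 \<le> w \<Longrightarrow>
    (\<integral>\<^sup>+r. ennreal (r powr (1 - P)) * (scale_sum \<gamma> r w * indicator {0<..} r) \<partial>lborel) \<le> ennreal K1"
    using weighted_scale_sum by blast
  obtain K2 where K2: "0 \<le> K2" "\<And>G r t. G \<in> borel_measurable borel \<Longrightarrow> (\<And>w. 0 \<le> G w) \<Longrightarrow>
      (\<integral>\<^sup>+w. ennreal (G w powr (1 / u)) * indicator {0..} w \<partial>lborel) \<le> 1 \<Longrightarrow> 0 < r \<Longrightarrow> t \<in> E \<Longrightarrow>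
      ennreal_powr (\<integral>\<^sup>+\<theta>. ennreal (G (chord_sq r t \<theta>)) * indicator {0..pi} \<theta> \<partial>lborel) (1 / v)
      \<le> ennreal (K2 * r powr (- P)) * (\<integral>\<^sup>+w. ennreal (G w powr (1 / u)) * indicator {0..} w * scale_sum \<gamma> r w \<partial>lborel)"
    using circle_avg_power_bound[OF uv Pu e \<gamma>_def] by blast
  define K where "K = 2 * pi * K2 * K1"
  have K0: "0 \<le> K" using K1(1) K2(1) by (simp add: K_def)
  have main: "(\<integral>\<^sup>+x. ennreal_powr (max_fun E f x) (1 / v) \<partial>lborel) \<le> ennreal (c powr (- (1 / v)) * K)"
    if \<phi>[measurable]: "\<phi> \<in> borel_measurable borel" and N: "N \<in> null_sets lborel"
      and f: "\<And>x. (norm x)\<^sup>2 \<notin> N \<Longrightarrow> f x = \<phi> ((norm x)\<^sup>2)" and c: "0 < c"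
      and I: "(\<integral>\<^sup>+w. ennreal ((c * cmod (\<phi> w)) powr (1 / u)) * indicator {0..} w \<partial>lborel) \<le> 1"
    for f \<phi> N c
  proof -
    define g where "g w = ennreal ((c * cmod (\<phi> w)) powr (1 / u)) * indicator {0..} w" for w
    have [measurable]: "g \<in> borel_measurable borel" unfolding g_def by measurable
    define D where "D r = ennreal (K2 * r powr (- P)) * (\<integral>\<^sup>+w. g w * scale_sum \<gamma> r w \<partial>lborel)" for r
    have [measurable]: "(\<lambda>(r, w). g w * scale_sum \<gamma> r w) \<in> borel_measurable (borel \<Otimes>\<^sub>M lborel)"
      using measurable_scale_sum[of \<gamma>] by (simp add: split_beta' cong: measurable_cong_sets)
    have Dm[measurable]: "D \<in> borel_measurable borel" unfolding D_def by measurable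
    have ae: "AE x in (lborel :: (real^2) measure). x \<noteq> 0"
      using AE_not_in[OF finite_imp_null_set_lborel[of "{0::real^2}"]] by simp
    have "(\<integral>\<^sup>+x. ennreal_powr (max_fun E f x) (1 / v) \<partial>lborel)
       \<le> (\<integral>\<^sup>+x. ennreal (c powr (- (1 / v))) * D (norm x) \<partial>(lborel :: (real^2) measure))"
    proof (rule nn_integral_mono_AE)
      show "AE x in lborel. ennreal_powr (max_fun E f x) (1 / v) \<le> ennreal (c powr (- (1 / v))) * D (norm x)"
        using ae
      proof eventually_elim
        case (elim x)
        show ?case
        proof (rule max_fun_le[OF E \<phi> N f elim c uv(1)])
          fix t assume t: "t \<in> E"
          show "ennreal_powr (\<integral>\<^sup>+\<theta>. ennreal (c * cmod (\<phi> (chord_sq (norm x) t \<theta>))) * indicator {0..pi} \<theta> \<partial>lborel) (1 / v) \<le> D (norm x)"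
            unfolding D_def g_def
            using K2(2)[of "\<lambda>w. c * cmod (\<phi> w)" "norm x" t] c I elim t by simp
        qed
      qed
    qed
    also have "\<dots> = ennreal (c powr (- (1 / v))) * (\<integral>\<^sup>+x. D (norm x) \<partial>(lborel :: (real^2) measure))"
      by (rule nn_integral_cmult) measurable
    also have "(\<integral>\<^sup>+x. D (norm x) \<partial>(lborel :: (real^2) measure))
       = ennreal pi * (\<integral>\<^sup>+r. D r * ennreal (2 * r) * indicator {0..} r \<partial>lborel)"
      by (rule nn_integral_polar) measurable
    also have "(\<integral>\<^sup>+r. D r * ennreal (2 * r) * indicator {0..} r \<partial>lborel)
       = (\<integral>\<^sup>+r. ennreal (2 * K2) * (\<integral>\<^sup>+w. g w * (ennreal (r powr (1 - P)) * (scale_sum \<gamma> r w * indicator {0<..} r)) \<partial>lborel) \<partial>lborel)"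
    proof (rule nn_integral_cong)
      fix r :: real
      show "D r * ennreal (2 * r) * indicator {0..} r
         = ennreal (2 * K2) * (\<integral>\<^sup>+w. g w * (ennreal (r powr (1 - P)) * (scale_sum \<gamma> r w * indicator {0<..} r)) \<partial>lborel)"
      proof (cases "0 < r")
        case True
        have "r powr (- P) * r = r powr (1 - P)" using True powr_add[of r "- P" 1] by simp
        then have rr: "K2 * r powr (- P) * (2 * r) = 2 * K2 * r powr (1 - P)" by (simp add: mult_ac)
        have "D r * ennreal (2 * r) = ennreal (2 * K2 * r powr (1 - P)) * (\<integral>\<^sup>+w. g w * scale_sum \<gamma> r w \<partial>lborel)"
          unfolding D_def rr[symmetric] using True K2(1) by (simp add: ennreal_mult mult_ac)
        also have "\<dots> = ennreal (2 * K2) * (ennreal (r powr (1 - P)) * (\<integral>\<^sup>+w. g w * scale_sum \<gamma> r w \<partial>lborel))"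
          using K2(1) by (simp add: ennreal_mult mult.assoc)
        also have "ennreal (r powr (1 - P)) * (\<integral>\<^sup>+w. g w * scale_sum \<gamma> r w \<partial>lborel)
           = (\<integral>\<^sup>+w. g w * (ennreal (r powr (1 - P)) * (scale_sum \<gamma> r w * indicator {0<..} r)) \<partial>lborel)"
          using True by (subst nn_integral_cmult[symmetric]) (auto intro!: nn_integral_cong simp: mult_ac)
        finally show ?thesis using True by simp
      next
        case False
        then show ?thesis by (cases "r = 0") auto
      qed
    qed
    also have "\<dots> = ennreal (2 * K2) * (\<integral>\<^sup>+r. (\<integral>\<^sup>+w. g w * (ennreal (r powr (1 - P)) * (scale_sum \<gamma> r w * indicator {0<..} r)) \<partial>lborel) \<partial>lborel)"
    proof (rule nn_integral_cmult)
      have "(\<lambda>(r, w). g w * (ennreal (r powr (1 - P)) * (scale_sum \<gamma> r w * indicator {0<..} r))) \<in> borel_measurable (borel \<Otimes>\<^sub>M lborel)"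
        using measurable_scale_sum[of \<gamma>] by (simp add: split_beta' cong: measurable_cong_sets)
      then show "(\<lambda>r. \<integral>\<^sup>+w. g w * (ennreal (r powr (1 - P)) * (scale_sum \<gamma> r w * indicator {0<..} r)) \<partial>lborel) \<in> borel_measurable lborel"
        by measurable
    qed
    also have "(\<integral>\<^sup>+r. (\<integral>\<^sup>+w. g w * (ennreal (r powr (1 - P)) * (scale_sum \<gamma> r w * indicator {0<..} r)) \<partial>lborel) \<partial>lborel)
       = (\<integral>\<^sup>+w. (\<integral>\<^sup>+r. g w * (ennreal (r powr (1 - P)) * (scale_sum \<gamma> r w * indicator {0<..} r)) \<partial>lborel) \<partial>lborel)"
      by (rule lborel_pair.Fubini'[symmetric])
         (use measurable_scale_sum[of \<gamma>] in \<open>simp add: split_beta' cong: measurable_cong_sets\<close>)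
    also have "\<dots> \<le> (\<integral>\<^sup>+w. g w * ennreal K1 \<partial>lborel)"
    proof (rule nn_integral_mono)
      fix w :: real
      have "(\<integral>\<^sup>+r. g w * (ennreal (r powr (1 - P)) * (scale_sum \<gamma> r w * indicator {0<..} r)) \<partial>lborel)
         = g w * (\<integral>\<^sup>+r. ennreal (r powr (1 - P)) * (scale_sum \<gamma> r w * indicator {0<..} r) \<partial>lborel)"
        by (rule nn_integral_cmult) measurable
      also have "\<dots> \<le> g w * ennreal K1"
      proof (cases "0 \<le> w")
        case True
        then show ?thesis by (intro mult_left_mono K1(2)) auto
      qed (simp add: g_def)
      finally show "(\<integral>\<^sup>+r. g w * (ennreal (r powr (1 - P)) * (scale_sum \<gamma> r w * indicator {0<..} r)) \<partial>lborel) \<le> g w * ennreal K1" .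
    qed
    also have "\<dots> = (\<integral>\<^sup>+w. g w \<partial>lborel) * ennreal K1" by (rule nn_integral_multc) measurable
    also have "\<dots> \<le> 1 * ennreal K1" using I unfolding g_def by (intro mult_right_mono) auto
    finally have "(\<integral>\<^sup>+x. ennreal_powr (max_fun E f x) (1 / v) \<partial>lborel)
       \<le> ennreal (c powr (- (1 / v))) * (ennreal pi * (ennreal (2 * K2) * ennreal K1))"
      by (simp add: mult_left_mono)
    also have "\<dots> = ennreal (c powr (- (1 / v)) * K)"
      using K1(1) K2(1) by (simp add: K_def ennreal_mult[symmetric] mult_ac)
    finally show ?thesis .
  qed
  define C' where "C' = K powr v * pi powr (- u)"
  show ?thesis unfolding max_bounded_rad_def
  proof (intro exI ballI)
    fix f assume "f \<in> Lp_rad (ennreal (1 / u))"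
    then have fm: "f \<in> borel_measurable lebesgue" "radial f"
      and fin: "Lp_norm (ennreal (1 / u)) (\<lambda>x. ennreal (cmod (f x))) < \<infinity>" by (auto simp: Lp_rad_def)
    obtain \<phi> N where \<phi>[measurable]: "\<phi> \<in> borel_measurable borel" and N: "N \<in> null_sets lborel"
      and f: "\<And>x. (norm x)\<^sup>2 \<notin> N \<Longrightarrow> f x = \<phi> ((norm x)\<^sup>2)"
      using radial_fun_borel_mod_null[OF fm] by blast
    define I where "I = (\<integral>\<^sup>+w. ennreal (cmod (\<phi> w) powr (1 / u)) * indicator {0..} w \<partial>lborel)"
    define J where "J = (\<integral>\<^sup>+x. ennreal_powr (max_fun E f x) (1 / v) \<partial>lborel)"
    have u0: "0 < u" using uv by simp
    have normf: "Lp_norm (ennreal (1 / u)) (\<lambda>x. ennreal (cmod (f x))) = ennreal_powr (ennreal pi * I) u"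
      unfolding Lp_norm_ennreal[OF u0] I_def by (subst nn_integral_radial_power[OF \<phi> N f]) auto
    have normM: "Lp_norm (ennreal (1 / v)) (max_fun E f) = ennreal_powr J v"
      unfolding Lp_norm_ennreal[OF uv(1)] J_def ..
    have "I \<noteq> \<infinity>" using fin unfolding normf by (auto simp: ennreal_powr_def ennreal_mult_top)
    then obtain i where i: "I = ennreal i" "0 \<le> i" by (cases I) auto
    have Jle: "J \<le> ennreal (c powr (- (1 / v)) * K)" if c: "0 < c" "c powr (1 / u) * i \<le> 1" for c
      unfolding J_def
    proof (rule main[OF \<phi> N f c(1)])
      have "(\<integral>\<^sup>+w. ennreal ((c * cmod (\<phi> w)) powr (1 / u)) * indicator {0..} w \<partial>lborel)
        = ennreal (c powr (1 / u)) * I"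
        unfolding I_def using c
        by (subst nn_integral_cmult[symmetric]) (auto intro!: nn_integral_cong simp: powr_mult ennreal_mult mult.assoc)
      also have "\<dots> = ennreal (c powr (1 / u) * i)" using i by (simp add: ennreal_mult)
      also have "\<dots> \<le> 1" using c(2) by simp
      finally show "(\<integral>\<^sup>+w. ennreal ((c * cmod (\<phi> w)) powr (1 / u)) * indicator {0..} w \<partial>lborel) \<le> 1" .
    qed auto
    show "Lp_norm (ennreal (1 / v)) (max_fun E f) \<le> ennreal C' * Lp_norm (ennreal (1 / u)) (\<lambda>x. ennreal (cmod (f x)))"
    proof (cases "i = 0")
      case True
      \<comment> \<open>Here f vanishes almost everywhere, every multiple of it is normalised, and
        letting the multiplier \<open>c\<close> grow forces \<open>J\<close> to be 0.\<close>
      have "J \<le> 0 + ennreal \<epsilon>" if "0 < \<epsilon>" for \<epsilon>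
      proof -
        define c where "c = ((K + 1) / \<epsilon>) powr v"
        have "0 < (K + 1) / \<epsilon>" using K0 that by simp
        then have c: "0 < c" "c powr (- (1 / v)) = \<epsilon> / (K + 1)"
          using uv(1) that K0 by (auto simp: c_def powr_powr powr_minus)
        have "J \<le> ennreal (\<epsilon> / (K + 1) * K)" using Jle[of c] c True by simp
        also have "\<dots> \<le> ennreal \<epsilon>" using that K0 by (intro ennreal_leI) (simp add: field_simps)
        finally show ?thesis by simp
      qed
      then have "J = 0" by (metis ennreal_le_epsilon le_zero_eq add_0)
      then show ?thesis unfolding normM using uv by (simp add: ennreal_powr_def)
    next
      case False
      then have i0: "0 < i" using i by simp
      \<comment> \<open>\<open>c = i powr (- u)\<close> normalises the profile exactly, and
        homogeneity restores the norm of f with exponent u.\<close>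
      have "(i powr (- u)) powr (1 / u) = i powr (- 1)" using u0 by (simp only: powr_powr) simp
      then have "(i powr (- u)) powr (1 / u) * i \<le> 1" using i0 by (simp add: powr_minus)
      from Jle[OF _ this] have "J \<le> ennreal (i powr (u / v) * K)"
        using i0 by (simp add: powr_powr)
      then have "ennreal_powr J v \<le> ennreal_powr (ennreal (i powr (u / v) * K)) v"
        using uv by (intro ennreal_powr_mono) auto
      also have "\<dots> = ennreal ((i powr (u / v) * K) powr v)" using K0 by (intro ennreal_powr_ennreal) simp
      also have "(i powr (u / v) * K) powr v = C' * (pi * i) powr u"
        using i0 K0 uv by (simp add: C'_def powr_mult powr_powr powr_minus)
      also have "ennreal (C' * (pi * i) powr u) = ennreal C' * ennreal_powr (ennreal pi * I) u"
        using i by (simp add: ennreal_mult[symmetric] ennreal_powr_ennreal C'_def)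
      finally show ?thesis unfolding normM normf .
    qed
  qed
qed

end

section \<open>Necessity\<close>

definition radial_indicator :: "real set \<Rightarrow> real^2 \<Rightarrow> complex" where
  "radial_indicator B x = of_real (indicator B (norm x))"

lemma radial_indicator_measurable [measurable]:
  assumes [measurable]: "B \<in> sets borel"
  shows "radial_indicator B \<in> borel_measurable borel"
  unfolding radial_indicator_def[abs_def] by measurable

lemma abs_circle_avg_indicator_ge:
  assumes B[measurable]: "B \<in> sets borel" and \<alpha>\<beta>: "0 \<le> \<alpha>" "\<alpha> \<le> \<beta>" "\<beta> \<le> pi"
    and in_B: "\<And>\<theta>. \<alpha> \<le> \<theta> \<Longrightarrow> \<theta> \<le> \<beta> \<Longrightarrow> sqrt (chord_sq (norm x) t \<theta>) \<in> B"
  shows "ennreal ((\<beta> - \<alpha>) / pi) \<le> abs_circle_avg t (radial_indicator B) x"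
proof -
  note borel_measurable_norm_circle_pt[measurable]
  define g :: "real \<Rightarrow> real" where
    "g \<theta> = indicator {0..2*pi} \<theta> * indicator B (sqrt ((norm (circle_pt x t \<theta>))\<^sup>2))" for \<theta>
  have [measurable]: "g \<in> borel_measurable lborel" unfolding g_def by measurable
  have g: "indicator {0..2*pi} \<theta> *\<^sub>R radial_indicator B (circle_pt x t \<theta>) = of_real (g \<theta>)" for \<theta>
    by (simp add: g_def radial_indicator_def scaleR_conv_of_real)
  have g0: "0 \<le> g \<theta>" for \<theta> by (simp add: g_def)
  have "integrable lborel (\<lambda>\<theta>. indicator {0..2*pi} \<theta> :: real)" by simp
  then have gint: "integrable lborel g"
    by (rule Bochner_Integration.integrable_bound) (auto simp: g_def split: split_indicator)
  then have gint': "integrable lebesgue g" by (simp add: integrable_completion)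
  have si: "set_integrable lebesgue {0..2*pi} (\<lambda>\<theta>. radial_indicator B (circle_pt x t \<theta>))"
    unfolding set_integrable_def g using gint' by (rule integrable_of_real)
  have "circle_avg t (radial_indicator B) x = of_real (integral\<^sup>L lborel g / (2 * pi))"
    unfolding circle_avg_def set_lebesgue_integral_def g
    by (simp add: integral_completion scaleR_conv_of_real)
  then have avg: "abs_circle_avg t (radial_indicator B) x = ennreal (integral\<^sup>L lborel g / (2 * pi))"
    using si g0 by (simp add: abs_circle_avg_def norm_divide)
  have "ennreal (2 * (\<beta> - \<alpha>)) = 2 * emeasure lborel {\<alpha>..\<beta>}"
    using \<alpha>\<beta> ennreal_mult'[of 2 "\<beta> - \<alpha>"] by (simp del: right_diff_distrib_numeral)
  also have "\<dots> = 2 * (\<integral>\<^sup>+\<theta>. indicator {\<alpha>..\<beta>} \<theta> \<partial>lborel)" by simp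
  also have "\<dots> \<le> 2 * (\<integral>\<^sup>+\<theta>. indicator B (sqrt (chord_sq (norm x) t \<theta>)) * indicator {0..pi} \<theta> \<partial>lborel)"
    using \<alpha>\<beta> in_B by (intro mult_left_mono nn_integral_mono) (auto split: split_indicator)
  also have "\<dots> = (\<integral>\<^sup>+\<theta>. indicator B (sqrt ((norm (circle_pt x t \<theta>))\<^sup>2)) * indicator {0..2*pi} \<theta> \<partial>lborel)"
    by (rule nn_integral_circle[symmetric, where H = "\<lambda>w. indicator B (sqrt w)"]) measurable
  also have "\<dots> = (\<integral>\<^sup>+\<theta>. ennreal (g \<theta>) \<partial>lborel)"
    unfolding g_def by (intro nn_integral_cong) (auto split: split_indicator)
  also have "\<dots> = ennreal (integral\<^sup>L lborel g)"
    using gint g0 by (intro nn_integral_eq_integral) auto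
  finally have "2 * (\<beta> - \<alpha>) \<le> integral\<^sup>L lborel g"
    using g0 by (subst (asm) ennreal_le_iff) (auto intro: Bochner_Integration.integral_nonneg)
  from divide_right_mono[OF this, of "2 * pi"] show ?thesis
    unfolding avg by (intro ennreal_leI) (simp del: right_diff_distrib_numeral)
qed

lemma emeasure_norm_in:
  assumes [measurable]: "B \<in> sets borel"
  shows "emeasure lborel {x::real^2. norm x \<in> B}
     = ennreal pi * (\<integral>\<^sup>+r. indicator B r * ennreal (2 * r) * indicator {0..} r \<partial>lborel)"
proof -
  have "{x::real^2. norm x \<in> B} \<in> sets lborel"
    using measurable_sets[of norm "lborel :: (real^2) measure" borel B] by (simp add: vimage_def)
  then have "emeasure lborel {x::real^2. norm x \<in> B} = (\<integral>\<^sup>+x. indicator {x::real^2. norm x \<in> B} x \<partial>lborel)" by simp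
  also have "\<dots> = (\<integral>\<^sup>+x. indicator B (norm (x::real^2)) \<partial>lborel)"
    by (intro nn_integral_cong) (auto split: split_indicator)
  also have "\<dots> = ennreal pi * (\<integral>\<^sup>+r. indicator B r * ennreal (2 * r) * indicator {0..} r \<partial>lborel)"
    by (rule nn_integral_polar) measurable
  finally show ?thesis .
qed

lemma emeasure_norm_in_le:
  assumes "0 \<le> b" "a \<le> b"
  shows "emeasure lborel {x::real^2. norm x \<in> {a..b}} \<le> ennreal (2 * pi * b * (b - a))"
proof -
  have "(\<integral>\<^sup>+r. indicator {a..b} r * ennreal (2 * r) * indicator {0..} r \<partial>lborel)
     \<le> (\<integral>\<^sup>+r. ennreal (2 * b) * indicator {a..b} r \<partial>lborel)"
    by (intro nn_integral_mono) (auto split: split_indicator intro: ennreal_leI)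
  also have "\<dots> = ennreal (2 * b) * emeasure lborel {a..b}" by (rule nn_integral_cmult_indicator) simp
  also have "\<dots> = ennreal (2 * b * (b - a))" using assms by (simp add: ennreal_mult)
  finally have "emeasure lborel {x::real^2. norm x \<in> {a..b}} \<le> ennreal pi * ennreal (2 * b * (b - a))"
    by (subst emeasure_norm_in) (auto intro: mult_left_mono)
  then show ?thesis using assms by (simp add: ennreal_mult[symmetric] mult_ac)
qed

lemma emeasure_norm_in_ge:
  assumes [measurable]: "U \<in> sets borel" and U: "\<And>r. r \<in> U \<Longrightarrow> \<rho> \<le> r" "0 \<le> \<rho>"
    and m: "0 \<le> m" "ennreal m \<le> emeasure lborel U"
  shows "ennreal (2 * pi * \<rho> * m) \<le> emeasure lborel {x::real^2. norm x \<in> U}"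
proof -
  have "ennreal (2 * pi * \<rho> * m) = ennreal pi * (ennreal (2 * \<rho>) * ennreal m)"
    using m U(2) by (simp add: ennreal_mult[symmetric] mult_ac)
  also have "\<dots> \<le> ennreal pi * (ennreal (2 * \<rho>) * emeasure lborel U)"
    by (intro mult_left_mono m) auto
  also have "ennreal (2 * \<rho>) * emeasure lborel U = (\<integral>\<^sup>+r. ennreal (2 * \<rho>) * indicator U r \<partial>lborel)"
    by (rule nn_integral_cmult_indicator[symmetric]) simp
  also have "ennreal pi * \<dots> \<le> ennreal pi * (\<integral>\<^sup>+r. indicator U r * ennreal (2 * r) * indicator {0..} r \<partial>lborel)"
    using U by (intro mult_left_mono nn_integral_mono) (fastforce split: split_indicator intro: ennreal_leI)+
  finally show ?thesis by (subst emeasure_norm_in) auto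
qed

text \<open>The endpoint is covered by the same formula: for infinite p the exponent
  \<open>enn2real (1 / p)\<close> is 0, and \<open>m powr 0 = 1\<close> because m is
  positive.\<close>

lemma Lp_norm_radial_indicator_le:
  assumes B[measurable]: "B \<in> sets borel" and m: "0 < m" "emeasure lborel {x::real^2. norm x \<in> B} \<le> ennreal m"
    and p: "1 \<le> p"
  shows "Lp_norm p (\<lambda>x. ennreal (cmod (radial_indicator B x))) \<le> ennreal (m powr enn2real (1 / p))"
proof (cases "p = \<infinity>")
  case True
  have "Inf {c. AE x in lebesgue. ennreal (cmod (radial_indicator B x)) \<le> c} \<le> 1"
    by (rule Inf_lower) (auto simp: radial_indicator_def split: split_indicator)
  then show ?thesis using True m by (simp add: Lp_norm_def)
next
  case False
  then obtain s where s: "p = ennreal s" "1 \<le> s" using p by (cases p) auto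
  have inv: "1 / p = ennreal (1 / s)" using s by (simp add: divide_ennreal[symmetric])
  have [measurable]: "{x::real^2. norm x \<in> B} \<in> sets lborel"
    using measurable_sets[of norm "lborel :: (real^2) measure" borel B] by (simp add: vimage_def)
  have "(\<integral>\<^sup>+x. ennreal_powr (ennreal (cmod (radial_indicator B x))) s \<partial>lebesgue)
    = (\<integral>\<^sup>+x. indicator {x::real^2. norm x \<in> B} x \<partial>lborel)"
    unfolding nn_integral_completion using s
    by (intro nn_integral_cong) (auto simp: radial_indicator_def ennreal_powr_def split: split_indicator)
  also have "\<dots> \<le> ennreal m" using m(2) by simp
  finally have "ennreal_powr (\<integral>\<^sup>+x. ennreal_powr (ennreal (cmod (radial_indicator B x))) s \<partial>lebesgue) (1 / s) \<le> ennreal_powr (ennreal m) (1 / s)"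
    using s by (intro ennreal_powr_mono) auto
  then show ?thesis using False s m inv by (simp add: Lp_norm_def ennreal_powr_ennreal)
qed

lemma Lp_norm_ge:
  assumes U[measurable]: "U \<in> sets borel" and m: "0 < m" "ennreal m \<le> emeasure lborel {x::real^2. norm x \<in> U}"
    and h: "0 < h" "\<And>x. norm x \<in> U \<Longrightarrow> ennreal h \<le> g x" and q: "1 \<le> q"
  shows "ennreal (h * m powr enn2real (1 / q)) \<le> Lp_norm q g"
proof -
  have Um[measurable]: "{x::real^2. norm x \<in> U} \<in> sets lborel"
    using measurable_sets[of norm "lborel :: (real^2) measure" borel U] by (simp add: vimage_def)
  show ?thesis
  proof (cases "q = \<infinity>")
    case True
    have "ennreal h \<le> c" if "AE x in lebesgue. g x \<le> c" for c
    proof (rule ccontr)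
      assume "\<not> ennreal h \<le> c"
      have "AE x in lborel. x \<notin> {x::real^2. norm x \<in> U}"
        using that unfolding AE_completion_iff
        by eventually_elim (use h(2) \<open>\<not> ennreal h \<le> c\<close> in \<open>auto intro: order_trans\<close>)
      then have "emeasure lborel {x::real^2. norm x \<in> U} = 0"
        using AE_iff_null_sets[OF Um] by (auto simp: null_sets_def)
      then show False using m by simp
    qed
    then show ?thesis using True m by (auto simp: Lp_norm_def intro!: Inf_greatest)
  next
    case False
    then obtain s where s: "q = ennreal s" "1 \<le> s" using q by (cases q) auto
    have inv: "1 / q = ennreal (1 / s)" using s by (simp add: divide_ennreal[symmetric])
    have "ennreal (h powr s * m) = ennreal (h powr s) * ennreal m" using m by (simp add: ennreal_mult)
    also have "\<dots> \<le> ennreal (h powr s) * emeasure lborel {x::real^2. norm x \<in> U}" by (intro mult_left_mono m) simp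
    also have "\<dots> = (\<integral>\<^sup>+x. ennreal (h powr s) * indicator {x::real^2. norm x \<in> U} x \<partial>lborel)"
      by (rule nn_integral_cmult_indicator[symmetric]) measurable
    also have "\<dots> \<le> (\<integral>\<^sup>+x. ennreal_powr (g x) s \<partial>lebesgue)"
      unfolding nn_integral_completion
    proof (rule nn_integral_mono)
      fix x :: "real^2"
      show "ennreal (h powr s) * indicator {x. norm x \<in> U} x \<le> ennreal_powr (g x) s"
        using ennreal_powr_mono[OF h(2), of x s] s h(1) by (auto simp: ennreal_powr_ennreal split: split_indicator)
    qed
    finally have "ennreal_powr (ennreal (h powr s * m)) (1 / s) \<le> ennreal_powr (\<integral>\<^sup>+x. ennreal_powr (g x) s \<partial>lebesgue) (1 / s)"
      using s by (intro ennreal_powr_mono) auto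
    then show ?thesis using s h m inv by (simp add: Lp_norm_def ennreal_powr_ennreal powr_mult powr_powr)
  qed
qed

text \<open>The estimate tested on a radial indicator: if the maximal function is at least
  \<open>h\<close> on the set of x with |x| in U, then h |U|^(1/q) is at most C |B|^(1/p). Stated
  with the real exponents u and v, so that infinite p or q need no separate treatment later.\<close>

definition test_bound :: "real set \<Rightarrow> real \<Rightarrow> real \<Rightarrow> real \<Rightarrow> bool" where
  "test_bound E u v C \<longleftrightarrow> 0 < C \<and> (\<forall>B U m m' h. B \<in> sets borel \<longrightarrow> U \<in> sets borel \<longrightarrow> 0 < m \<longrightarrow> 0 < m' \<longrightarrow> 0 < h \<longrightarrow>
    emeasure lborel {x::real^2. norm x \<in> B} \<le> ennreal m \<longrightarrow> ennreal m' \<le> emeasure lborel {x::real^2. norm x \<in> U} \<longrightarrow>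
    (\<forall>x. norm x \<in> U \<longrightarrow> (\<exists>t\<in>E. ennreal h \<le> abs_circle_avg t (radial_indicator B) x)) \<longrightarrow>
    h * m' powr v \<le> C * m powr u)"

lemma test_boundD:
  assumes "test_bound E u v C"
  shows "0 < C" "\<And>B U m m' h. B \<in> sets borel \<Longrightarrow> U \<in> sets borel \<Longrightarrow> 0 < m \<Longrightarrow> 0 < m' \<Longrightarrow> 0 < h \<Longrightarrow>
    emeasure lborel {x::real^2. norm x \<in> B} \<le> ennreal m \<Longrightarrow> ennreal m' \<le> emeasure lborel {x::real^2. norm x \<in> U} \<Longrightarrow>
    (\<And>x. norm x \<in> U \<Longrightarrow> \<exists>t\<in>E. ennreal h \<le> abs_circle_avg t (radial_indicator B) x) \<Longrightarrow>
    h * m' powr v \<le> C * m powr u"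
  using assms unfolding test_bound_def by metis+

lemma max_bounded_rad_test_bound:
  assumes bdd: "max_bounded_rad E p q" and p: "1 \<le> p" and q: "1 \<le> q"
  shows "\<exists>C. test_bound E (enn2real (1 / p)) (enn2real (1 / q)) C"
proof -
  obtain C where C: "\<And>f. f \<in> Lp_rad p \<Longrightarrow> Lp_norm q (max_fun E f) \<le> ennreal C * Lp_norm p (\<lambda>x. ennreal (cmod (f x)))"
    using bdd unfolding max_bounded_rad_def by blast
  \<comment> \<open>The constant in \<open>max_bounded_rad\<close> may be any real number;
    \<open>\<bar>C\<bar> + 1\<close> makes it positive.\<close>
  have "h * m' powr enn2real (1 / q) \<le> (\<bar>C\<bar> + 1) * m powr enn2real (1 / p)"
    if B: "B \<in> sets borel" and U: "U \<in> sets borel" and pos: "0 < m" "0 < m'" "0 < h"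
     and mB: "emeasure lborel {x::real^2. norm x \<in> B} \<le> ennreal m" and mU: "ennreal m' \<le> emeasure lborel {x::real^2. norm x \<in> U}"
     and avg: "\<And>x. norm x \<in> U \<Longrightarrow> \<exists>t\<in>E. ennreal h \<le> abs_circle_avg t (radial_indicator B) x" for B U m m' h
  proof -
    note nB = Lp_norm_radial_indicator_le[OF B pos(1) mB p]
    have "radial_indicator B \<in> borel_measurable lebesgue"
      using radial_indicator_measurable[OF B] by (intro measurable_completion) simp
    moreover have "radial (radial_indicator B)" by (auto simp: radial_def radial_indicator_def)
    ultimately have f: "radial_indicator B \<in> Lp_rad p"
      using nB by (auto simp: Lp_rad_def intro: le_less_trans)
    have "ennreal (h * m' powr enn2real (1 / q)) \<le> Lp_norm q (max_fun E (radial_indicator B))"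
    proof (rule Lp_norm_ge[OF U pos(2) mU pos(3) _ q])
      fix x :: "real^2" assume "norm x \<in> U"
      from avg[OF this] show "ennreal h \<le> max_fun E (radial_indicator B) x"
        unfolding max_fun_def by (auto intro: SUP_upper2)
    qed
    also have "\<dots> \<le> ennreal C * ennreal (m powr enn2real (1 / p))"
      by (intro order_trans[OF C[OF f]] mult_left_mono nB) simp
    also have "\<dots> \<le> ennreal (\<bar>C\<bar> + 1) * ennreal (m powr enn2real (1 / p))"
      by (intro mult_right_mono ennreal_leI) auto
    also have "\<dots> = ennreal ((\<bar>C\<bar> + 1) * m powr enn2real (1 / p))" by (simp add: ennreal_mult)
    finally show ?thesis by (subst (asm) ennreal_le_iff) auto
  qed
  then have "test_bound E (enn2real (1 / p)) (enn2real (1 / q)) (\<bar>C\<bar> + 1)"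
    unfolding test_bound_def by fastforce
  then show ?thesis ..
qed

lemma one_minus_cos_le: "1 - cos \<theta> \<le> \<theta>\<^sup>2 / 2" for \<theta> :: real
proof -
  have "cos \<theta> = 1 - 2 * (sin (\<theta> / 2))\<^sup>2" using cos_double_sin[of "\<theta> / 2"] by simp
  moreover have "(sin (\<theta> / 2))\<^sup>2 \<le> (\<theta> / 2)\<^sup>2"
    using power_mono[OF abs_sin_x_le_abs_x[of "\<theta> / 2"] abs_ge_zero, of 2] by (simp only: power2_abs)
  ultimately show ?thesis by (simp add: power_divide)
qed

lemma circle_dist_bounds:
  assumes "0 \<le> r" "0 \<le> (t::real)"
  shows "\<bar>r - t\<bar> \<le> sqrt (chord_sq r t \<theta>)" "sqrt (chord_sq r t \<theta>) \<le> r + t"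
proof -
  have rt: "0 \<le> r * t" using assms by simp
  have "r * t * cos \<theta> \<le> r * t * 1" "r * t * (-1) \<le> r * t * cos \<theta>"
    by (intro mult_left_mono rt; simp)+
  then have "(r - t)\<^sup>2 \<le> chord_sq r t \<theta>" "chord_sq r t \<theta> \<le> (r + t)\<^sup>2"
    by (auto simp: power2_eq_square algebra_simps)
  then show "\<bar>r - t\<bar> \<le> sqrt (chord_sq r t \<theta>)" "sqrt (chord_sq r t \<theta>) \<le> r + t"
    using real_sqrt_le_mono[of "(r - t)\<^sup>2"] assms by (auto intro: real_le_lsqrt)
qed

section \<open>The four families of test functions\<close>

context
  fixes E :: "real set" and p q :: ennreal and u v :: real
  assumes E: "E \<subseteq> {1..2}" "E \<noteq> {}" and p: "1 \<le> p" and q: "1 \<le> q"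
    and bdd: "max_bounded_rad E p q" and u: "u = enn2real (1 / p)" and v: "v = enn2real (1 / q)"
begin

text \<open>Averages of the indicator of a disc of radius 4 L are 1 on an annulus whose area is also
  of order L^2, because t is at most 2. So L^(2 (v - u)) stays bounded as L grows.\<close>

lemma necessary_large_balls: "v \<le> u"
proof (rule ccontr)
  assume "\<not> v \<le> u"
  obtain C where "test_bound E u v C"
    using max_bounded_rad_test_bound[OF bdd p q] unfolding u v by blast
  note C = test_boundD[OF this]
  obtain t where t: "t \<in> E" using E by auto
  then have t12: "1 \<le> t" "t \<le> 2" using E by auto
  have ineq: "(L\<^sup>2) powr v \<le> C * (32 * pi * L\<^sup>2) powr u" if L: "1 \<le> L" for L :: real
  proof -
    have L2: "0 < L\<^sup>2" using L by simp
    have "1 * (L\<^sup>2) powr v \<le> C * (32 * pi * L\<^sup>2) powr u"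
    proof (rule C(2)[where B = "{0..4 * L}" and U = "{L..2 * L}"])
      show "emeasure lborel {x::real^2. norm x \<in> {0..4 * L}} \<le> ennreal (32 * pi * L\<^sup>2)"
        using emeasure_norm_in_le[of "4 * L" 0] L by (simp add: power2_eq_square mult_ac)
      have "ennreal (2 * pi * L * L) \<le> emeasure lborel {x::real^2. norm x \<in> {L..2 * L}}"
        using L by (intro emeasure_norm_in_ge) auto
      moreover have "1 * L\<^sup>2 \<le> 2 * pi * L\<^sup>2" using pi_ge_two by (intro mult_right_mono) auto
      then have "ennreal (L\<^sup>2) \<le> ennreal (2 * pi * L * L)"
        by (intro ennreal_leI) (simp add: power2_eq_square mult.assoc)
      ultimately show "ennreal (L\<^sup>2) \<le> emeasure lborel {x::real^2. norm x \<in> {L..2 * L}}"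
        by (rule order_trans[rotated])
      fix x :: "real^2" assume "norm x \<in> {L..2 * L}"
      then have nx: "norm x \<le> 2 * L" by simp
      have "sqrt (chord_sq (norm x) t \<theta>) \<in> {0..4 * L}" for \<theta>
      proof -
        have "\<bar>norm x - t\<bar> \<le> sqrt (chord_sq (norm x) t \<theta>)"
          "sqrt (chord_sq (norm x) t \<theta>) \<le> norm x + t"
          using circle_dist_bounds[of "norm x" t \<theta>] t12 by auto
        then show ?thesis unfolding atLeastAtMost_iff using nx t12 L by (intro conjI; linarith)
      qed
      then have "ennreal ((pi - 0) / pi) \<le> abs_circle_avg t (radial_indicator {0..4 * L}) x"
        by (intro abs_circle_avg_indicator_ge) auto
      then show "\<exists>t\<in>E. ennreal 1 \<le> abs_circle_avg t (radial_indicator {0..4 * L}) x" using t by auto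
    qed (use L2 in auto)
    then show ?thesis by simp
  qed
  define D where "D = C * (32 * pi) powr u"
  have D0: "0 < D" using C(1) by (simp add: D_def)
  have le: "y powr (v - u) \<le> D" if y: "1 \<le> y" for y :: real
  proof -
    have "y powr v \<le> C * (32 * pi * y) powr u" using ineq[of "sqrt y"] y by simp
    also have "\<dots> = D * y powr u" using y by (simp add: D_def powr_mult)
    finally show ?thesis using y by (simp add: powr_diff divide_simps)
  qed
  have "((D + 1) powr (1 / (v - u))) powr (v - u) \<le> D"
    using D0 \<open>\<not> v \<le> u\<close> by (intro le) (simp add: ge_one_powr_ge_zero)
  then show False using D0 \<open>\<not> v \<le> u\<close> by (simp add: powr_powr)
qed

text \<open>If |x| is at most \<open>\<delta>\<close>, the whole circle of radius t about x lies in
  an annulus of width 2 \<open>\<delta>\<close>. Areas \<open>\<delta>\<close>^2 and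
  \<open>\<delta>\<close> are compared as \<open>\<delta>\<close> tends to 0.\<close>

lemma necessary_annulus: "u \<le> 2 * v"
proof (rule ccontr)
  assume "\<not> u \<le> 2 * v"
  obtain C where "test_bound E u v C"
    using max_bounded_rad_test_bound[OF bdd p q] unfolding u v by blast
  note C = test_boundD[OF this]
  obtain t where t: "t \<in> E" using E by auto
  then have t12: "1 \<le> t" "t \<le> 2" using E by auto
  have ineq: "((\<delta> / 2)\<^sup>2) powr v \<le> C * (12 * pi * \<delta>) powr u" if \<delta>: "0 < \<delta>" "\<delta> \<le> 1" for \<delta> :: real
  proof -
    have "1 * ((\<delta> / 2)\<^sup>2) powr v \<le> C * (12 * pi * \<delta>) powr u"
    proof (rule C(2)[where B = "{t - \<delta>..t + \<delta>}" and U = "{\<delta> / 2..\<delta>}"])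
      have "emeasure lborel {x::real^2. norm x \<in> {t - \<delta>..t + \<delta>}} \<le> ennreal (2 * pi * (t + \<delta>) * (t + \<delta> - (t - \<delta>)))"
        using \<delta> t12 by (intro emeasure_norm_in_le) auto
      also have "\<dots> \<le> ennreal (2 * pi * 3 * (2 * \<delta>))"
        using \<delta> t12 by (intro ennreal_leI mult_mono) auto
      finally show "emeasure lborel {x::real^2. norm x \<in> {t - \<delta>..t + \<delta>}} \<le> ennreal (12 * pi * \<delta>)" by (simp add: mult_ac)
      have "ennreal (2 * pi * (\<delta> / 2) * (\<delta> / 2)) \<le> emeasure lborel {x::real^2. norm x \<in> {\<delta> / 2..\<delta>}}"
        using \<delta> by (intro emeasure_norm_in_ge) auto
      moreover have "1 * (\<delta> / 2)\<^sup>2 \<le> 2 * pi * (\<delta> / 2)\<^sup>2" using pi_ge_two by (intro mult_right_mono) auto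
      then have "ennreal ((\<delta> / 2)\<^sup>2) \<le> ennreal (2 * pi * (\<delta> / 2) * (\<delta> / 2))"
        by (intro ennreal_leI) (simp add: power2_eq_square mult.assoc)
      ultimately show "ennreal ((\<delta> / 2)\<^sup>2) \<le> emeasure lborel {x::real^2. norm x \<in> {\<delta> / 2..\<delta>}}"
        by (rule order_trans[rotated])
      fix x :: "real^2" assume "norm x \<in> {\<delta> / 2..\<delta>}"
      then have "sqrt (chord_sq (norm x) t \<theta>) \<in> {t - \<delta>..t + \<delta>}" for \<theta>
        using circle_dist_bounds[of "norm x" t \<theta>] t12 \<delta> by auto
      then have "ennreal ((pi - 0) / pi) \<le> abs_circle_avg t (radial_indicator {t - \<delta>..t + \<delta>}) x"
        by (intro abs_circle_avg_indicator_ge) auto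
      then show "\<exists>t'\<in>E. ennreal 1 \<le> abs_circle_avg t' (radial_indicator {t - \<delta>..t + \<delta>}) x" using t by auto
    qed (use \<delta> in auto)
    then show ?thesis by simp
  qed
  define D where "D = C * (12 * pi) powr u * 2 powr (2 * v)"
  have D0: "0 < D" using C(1) by (simp add: D_def)
  have le: "1 \<le> D * \<delta> powr (u - 2 * v)" if \<delta>: "0 < \<delta>" "\<delta> \<le> 1" for \<delta> :: real
  proof -
    have "((\<delta> / 2)\<^sup>2) powr v = \<delta> powr (2 * v) / 2 powr (2 * v)"
    proof -
      have "(\<delta> / 2)\<^sup>2 = (\<delta> / 2) powr 2" using \<delta> powr_numeral[of "\<delta> / 2" "num.Bit0 num.One"] by simp
      then show ?thesis using \<delta> by (simp only: powr_powr) (simp add: powr_divide)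
    qed
    then have "\<delta> powr (2 * v) / 2 powr (2 * v) \<le> C * (12 * pi) powr u * \<delta> powr u"
      using ineq[OF \<delta>] \<delta> by (simp add: powr_mult)
    then show ?thesis using \<delta> by (simp add: D_def powr_diff field_simps)
  qed
  have "1 \<le> D * ((1 / (D + 1)) powr (1 / (u - 2 * v))) powr (u - 2 * v)"
    using D0 \<open>\<not> u \<le> 2 * v\<close> by (intro le) (auto intro!: powr_le1)
  then show False using D0 \<open>\<not> u \<le> 2 * v\<close> by (simp add: powr_powr field_simps)
qed

text \<open>If |x| is within 2 \<open>\<delta>\<close> of some t in E, an arc of angle
  \<open>\<delta>\<close> passes through the disc of radius 4 \<open>\<delta>\<close>; such x fill
  an area of order \<open>\<delta>\<close> N(E, \<open>\<delta>\<close>). With N of order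
  \<open>\<delta>\<close>^(-\<open>\<beta>\<close>), comparing exponents gives the edge through P_2
  and P_3.\<close>

lemma necessary_small_balls:
  obtains C where "0 < C" "\<And>\<delta>. 0 < \<delta> \<Longrightarrow> \<delta> \<le> 1/4 \<Longrightarrow>
    \<delta> * (\<delta> * real (covering_number E \<delta>)) powr v \<le> C * \<delta> powr (2 * u)"
proof -
  obtain C where "test_bound E u v C"
    using max_bounded_rad_test_bound[OF bdd p q] unfolding u v by blast
  note C = test_boundD[OF this]
  have v0: "0 \<le> v" unfolding v by simp
  have "\<delta> * (\<delta> * real (covering_number E \<delta>)) powr v \<le> pi * C * (32 * pi) powr u * \<delta> powr (2 * u)"
    if \<delta>: "0 < \<delta>" "\<delta> \<le> 1/4" for \<delta>
  proof -
    let ?U = "{r. \<exists>t\<in>E. \<bar>r - (0 + 1 * t)\<bar> < 2 * \<delta>}"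
    let ?N = "real (covering_number E \<delta>)"
    have N1: "1 \<le> ?N" using covering_number_pos[OF E(1) \<delta>(1) E(2)] by simp
    have "\<delta> / pi * (pi * (\<delta> * ?N)) powr v \<le> C * (32 * pi * \<delta>\<^sup>2) powr u"
    proof (rule C(2)[where B = "{0..4 * \<delta>}" and U = ?U])
      show "emeasure lborel {x::real^2. norm x \<in> {0..4 * \<delta>}} \<le> ennreal (32 * pi * \<delta>\<^sup>2)"
        using emeasure_norm_in_le[of "4 * \<delta>" 0] \<delta> by (simp add: power2_eq_square mult_ac)
      have "ennreal (2 * pi * (1/2) * (\<delta> * ?N)) \<le> emeasure lborel {x::real^2. norm x \<in> ?U}"
      proof (rule emeasure_norm_in_ge)
        show "?U \<in> sets borel" using open_translates[of E 0 1 "2 * \<delta>"] by simp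
        show "1/2 \<le> r" if "r \<in> ?U" for r using that E(1) \<delta> by (force simp: abs_less_iff)
        show "ennreal (\<delta> * ?N) \<le> emeasure lborel ?U" by (rule emeasure_translates_ge[OF E(1) \<delta>(1)]) simp
      qed (use \<delta> in auto)
      then show "ennreal (pi * (\<delta> * ?N)) \<le> emeasure lborel {x::real^2. norm x \<in> ?U}" by simp
      fix x :: "real^2" assume "norm x \<in> ?U"
      then obtain t where t: "t \<in> E" "\<bar>norm x - t\<bar> < 2 * \<delta>" by auto
      have t12: "1 \<le> t" "t \<le> 2" using t(1) E by auto
      have "sqrt (chord_sq (norm x) t \<theta>) \<in> {0..4 * \<delta>}" if \<theta>: "0 \<le> \<theta>" "\<theta> \<le> \<delta>" for \<theta>
      proof -
        have nx: "norm x \<le> 4" using t(2) t12 \<delta> by auto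
        have "2 * norm x * t * (1 - cos \<theta>) \<le> 2 * norm x * t * (\<theta>\<^sup>2 / 2)"
          using t12 by (intro mult_left_mono one_minus_cos_le) auto
        also have "\<dots> \<le> 2 * 4 * 2 * (\<delta>\<^sup>2 / 2)"
          using t12 nx \<theta> by (intro mult_mono divide_right_mono power_mono) auto
        finally have 1: "2 * norm x * t * (1 - cos \<theta>) \<le> 8 * \<delta>\<^sup>2" by simp
        have "\<bar>norm x - t\<bar>\<^sup>2 \<le> (2 * \<delta>)\<^sup>2" using t(2) by (intro power_mono) auto
        then have 2: "(norm x - t)\<^sup>2 \<le> 4 * \<delta>\<^sup>2" by (simp add: power_mult_distrib)
        have "chord_sq (norm x) t \<theta> = (norm x - t)\<^sup>2 + 2 * norm x * t * (1 - cos \<theta>)"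
          by (simp add: power2_eq_square algebra_simps)
        also have "\<dots> \<le> 4 * \<delta>\<^sup>2 + 8 * \<delta>\<^sup>2" by (intro add_mono 1 2)
        also have "\<dots> \<le> (4 * \<delta>)\<^sup>2" by (simp add: power_mult_distrib)
        finally have "sqrt (chord_sq (norm x) t \<theta>) \<le> 4 * \<delta>"
          using \<delta> by (intro real_le_lsqrt) auto
        moreover have "\<bar>norm x - t\<bar> \<le> sqrt (chord_sq (norm x) t \<theta>)"
          using circle_dist_bounds(1)[of "norm x" t \<theta>] t12 by auto
        ultimately show ?thesis unfolding atLeastAtMost_iff by (intro conjI; linarith)
      qed
      then have "ennreal ((\<delta> - 0) / pi) \<le> abs_circle_avg t (radial_indicator {0..4 * \<delta>}) x"
        using \<delta> pi_ge_two by (intro abs_circle_avg_indicator_ge) auto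
      then show "\<exists>t\<in>E. ennreal (\<delta> / pi) \<le> abs_circle_avg t (radial_indicator {0..4 * \<delta>}) x" using t(1) by auto
    qed (use \<delta> N1 open_translates[of E 0 1 "2 * \<delta>"] in auto)
    moreover have "\<delta> * (\<delta> * ?N) powr v \<le> \<delta> * (pi * (\<delta> * ?N)) powr v"
    proof (intro mult_left_mono powr_mono2 v0)
      have "1 * (\<delta> * ?N) \<le> pi * (\<delta> * ?N)" using pi_ge_two \<delta> by (intro mult_right_mono) auto
      then show "\<delta> * ?N \<le> pi * (\<delta> * ?N)" by simp
    qed (use \<delta> in auto)
    moreover have "(32 * pi * \<delta>\<^sup>2) powr u = (32 * pi) powr u * \<delta> powr (2 * u)"
      using \<delta> powr_powr[of \<delta> 2 u] by (simp add: powr_mult powr_numeral)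
    ultimately show ?thesis by (simp add: field_simps)
  qed
  moreover have "0 < pi * C * (32 * pi) powr u" using C(1) by simp
  ultimately show ?thesis using that by blast
qed

text \<open>A thin annulus of radius c is touched from inside, at the far point, by the circles with
  |x| + t close to c. For |x| of order R the contact lasts for an angle of order sqrt
  (\<open>\<delta>\<close> / R), and t in an interval of length R gives an area of order R
  \<open>\<delta>\<close> N of such x.\<close>

lemma necessary_local:
  obtains C where "0 < C" "\<And>a R \<delta>. 0 < \<delta> \<Longrightarrow> \<delta> \<le> R \<Longrightarrow> R \<le> 1 \<Longrightarrow> 1 \<le> a \<Longrightarrow> a \<le> 2 \<Longrightarrow>
    R powr (v - 1/2) * real (covering_number (E \<inter> {a..a+R}) \<delta>) powr v * \<delta> powr (1/2 + v - u) \<le> C"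
proof -
  obtain C where "test_bound E u v C"
    using max_bounded_rad_test_bound[OF bdd p q] unfolding u v by blast
  note C = test_boundD[OF this]
  have v0: "0 \<le> v" unfolding v by simp
  have "R powr (v - 1/2) * real (covering_number (E \<inter> {a..a+R}) \<delta>) powr v * \<delta> powr (1/2 + v - u)
      \<le> 7 powr (1/2) * pi * C * (120 * pi) powr u"
    if \<delta>: "0 < \<delta>" "\<delta> \<le> R" and R: "R \<le> 1" and a: "1 \<le> a" "a \<le> 2" for a R \<delta>
  proof (cases "covering_number (E \<inter> {a..a+R}) \<delta> = 0")
    case True
    then show ?thesis using C(1) by simp
  next
    case False
    \<comment> \<open>Then c - t lies between 4 R and 5 R, and after an error of 2
      \<open>\<delta>\<close>, at most 2 R, still |x| lies between R and 7 R.\<close>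
    define c where "c = a + 5 * R"
    let ?F = "E \<inter> {a..a+R}"
    let ?N = "real (covering_number ?F \<delta>)"
    let ?U = "{r. \<exists>t\<in>?F. \<bar>r - (c + (-1) * t)\<bar> < 2 * \<delta>}"
    \<comment> \<open>The squared radius drops by at most r t \<open>\<psi>\<close>^2 over this
      angle; with r at most 7 R this is at most t \<open>\<delta>\<close>, which lowers the radius
      by at most \<open>\<delta>\<close>.\<close>
    define \<psi> where "\<psi> = sqrt (\<delta> / (7 * R))"
    have R0: "0 < R" using \<delta> by simp
    have \<psi>2: "\<psi>\<^sup>2 = \<delta> / (7 * R)" using \<delta> R0 by (simp add: \<psi>_def)
    have "\<psi> \<le> sqrt 1" unfolding \<psi>_def using \<delta> R0 by (intro real_sqrt_le_mono) (simp add: divide_simps)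
    then have \<psi>: "0 < \<psi>" "\<psi> \<le> 1" using \<delta> R0 by (auto simp: \<psi>_def)
    have N1: "1 \<le> ?N" using False by simp
    have "\<psi> / pi * (R * \<delta> * ?N) powr v \<le> C * (120 * pi * \<delta>) powr u"
    proof (rule C(2)[where B = "{c - 3 * \<delta>..c + 3 * \<delta>}" and U = ?U])
      have "emeasure lborel {x::real^2. norm x \<in> {c - 3 * \<delta>..c + 3 * \<delta>}}
         \<le> ennreal (2 * pi * (c + 3 * \<delta>) * (c + 3 * \<delta> - (c - 3 * \<delta>)))"
        using \<delta> a R0 by (intro emeasure_norm_in_le) (auto simp: c_def)
      also have "\<dots> \<le> ennreal (2 * pi * 10 * (6 * \<delta>))"
        using \<delta> a R by (intro ennreal_leI mult_mono) (auto simp: c_def)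
      finally show "emeasure lborel {x::real^2. norm x \<in> {c - 3 * \<delta>..c + 3 * \<delta>}} \<le> ennreal (120 * pi * \<delta>)" by (simp add: mult_ac)
      have "ennreal (2 * pi * R * (\<delta> * ?N)) \<le> emeasure lborel {x::real^2. norm x \<in> ?U}"
      proof (rule emeasure_norm_in_ge)
        show "?U \<in> sets borel" using open_translates[of ?F c "-1" "2 * \<delta>"] by simp
        show "R \<le> r" if "r \<in> ?U" for r using that \<delta> R0 by (auto simp: abs_less_iff c_def)
        show "ennreal (\<delta> * ?N) \<le> emeasure lborel ?U"
          by (rule emeasure_translates_ge[where a = 1 and b = 2]) (use E(1) \<delta>(1) in auto)
      qed (use \<delta> R0 in auto)
      moreover have "1 * (R * \<delta> * ?N) \<le> 2 * pi * (R * \<delta> * ?N)" using pi_ge_two \<delta> R0 by (intro mult_right_mono) auto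
      then have "ennreal (R * \<delta> * ?N) \<le> ennreal (2 * pi * R * (\<delta> * ?N))"
        by (intro ennreal_leI) (simp add: mult.assoc)
      ultimately show "ennreal (R * \<delta> * ?N) \<le> emeasure lborel {x::real^2. norm x \<in> ?U}"
        by (rule order_trans[rotated])
      fix x :: "real^2" assume x: "norm x \<in> ?U"
      then obtain t where t: "t \<in> E" "a \<le> t" "t \<le> a + R" "\<bar>norm x + t - c\<bar> < 2 * \<delta>" by (auto simp: algebra_simps)
      have t12: "1 \<le> t" "t \<le> 2" using t(1) E by auto
      define r where "r = norm x"
      have r: "0 < r" "r \<le> 7 * R" using t \<delta> R0 unfolding r_def c_def by (auto simp: abs_less_iff)
      have "sqrt (chord_sq r t \<theta>) \<in> {c - 3 * \<delta>..c + 3 * \<delta>}" if \<theta>: "pi - \<psi> \<le> \<theta>" "\<theta> \<le> pi" for \<theta>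
      proof -
        have "2 * r * t * (1 + cos \<theta>) = 2 * r * t * (1 - cos (pi - \<theta>))" by simp
        also have "\<dots> \<le> 2 * r * t * ((pi - \<theta>)\<^sup>2 / 2)"
          using t12 r by (intro mult_left_mono one_minus_cos_le) auto
        also have "\<dots> \<le> 2 * r * t * (\<psi>\<^sup>2 / 2)"
          using t12 r \<theta> by (intro mult_left_mono divide_right_mono power_mono) auto
        also have "\<dots> = t * (r * \<delta> / (7 * R))" unfolding \<psi>2 by simp
        also have "\<dots> \<le> t * \<delta>" using r R0 \<delta> t12 by (intro mult_left_mono) (auto simp: divide_simps mult_right_mono)
        finally have 1: "2 * r * t * (1 + cos \<theta>) \<le> t * \<delta>" .
        have "(r + t - \<delta>)\<^sup>2 = (r + t)\<^sup>2 - \<delta> * (r + (r + t - \<delta>)) - \<delta> * t"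
          by (simp add: power2_eq_square algebra_simps)
        also have "\<dots> \<le> (r + t)\<^sup>2 - \<delta> * t"
          using \<delta> R r t12 by simp
        also have "\<dots> \<le> (r + t)\<^sup>2 - 2 * r * t * (1 + cos \<theta>)" using 1 by (simp add: mult.commute)
        also have "\<dots> = chord_sq r t \<theta>" by (simp add: power2_eq_square algebra_simps)
        finally have "r + t - \<delta> \<le> sqrt (chord_sq r t \<theta>)" by (rule real_le_rsqrt)
        moreover have "sqrt (chord_sq r t \<theta>) \<le> r + t"
          using circle_dist_bounds(2)[of r t \<theta>] r t12 by simp
        ultimately show ?thesis using t(4) unfolding r_def by (auto simp: abs_less_iff)
      qed
      then have "ennreal ((pi - (pi - \<psi>)) / pi) \<le> abs_circle_avg t (radial_indicator {c - 3 * \<delta>..c + 3 * \<delta>}) x"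
        using \<psi> pi_ge_two unfolding r_def by (intro abs_circle_avg_indicator_ge) auto
      then show "\<exists>t\<in>E. ennreal (\<psi> / pi) \<le> abs_circle_avg t (radial_indicator {c - 3 * \<delta>..c + 3 * \<delta>}) x" using t(1) by auto
    qed (use \<delta> N1 R0 \<psi> open_translates[of ?F c "-1" "2 * \<delta>"] in auto)
    also have "\<psi> = (\<delta> / (7 * R)) powr (1/2)" using \<delta> R0 by (simp add: \<psi>_def powr_half_sqrt)
    finally have "(\<delta> / (7 * R)) powr (1/2) * (R * \<delta> * ?N) powr v \<le> pi * C * (120 * pi * \<delta>) powr u"
      by (simp add: field_simps)
    then have "\<delta> powr (1/2) / (7 powr (1/2) * R powr (1/2)) * (R powr v * \<delta> powr v * ?N powr v) \<le> pi * C * ((120 * pi) powr u * \<delta> powr u)"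
      using \<delta> R0 N1 by (simp add: powr_mult powr_divide del: powr_half_sqrt)
    moreover have "R powr (v - 1/2) = R powr v / R powr (1/2)" by (rule powr_diff)
    moreover have "\<delta> powr (1/2 + v - u) = \<delta> powr (1/2) * \<delta> powr v / \<delta> powr u" by (simp only: powr_diff powr_add)
    moreover have "0 < R powr (1/2)" "0 < \<delta> powr u" "0 < (7::real) powr (1/2)" using \<delta> R0 by auto
    ultimately show ?thesis
      by (simp only: times_divide_eq_left times_divide_eq_right divide_divide_eq_left pos_divide_le_eq mult_pos_pos)
         (simp only: mult_ac)
  qed
  moreover have "0 < 7 powr (1/2) * pi * C * (120 * pi) powr u" using C(1) by simp
  ultimately show ?thesis using that by blast
qed

end

section \<open>The closure of the type set\<close>

lemma covering_number_unit_le: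
  assumes "E \<subseteq> {1..2}" "0 < \<delta>" "\<delta> \<le> 1" "F \<subseteq> E"
  shows "real (covering_number F \<delta>) \<le> 2 / \<delta>"
  using covering_number_interval_le[of F 1 1 \<delta>] assms by auto

lemma eventually_at_right_0:
  "eventually P (at_right (0::real)) \<longleftrightarrow> (\<exists>\<delta>0>0. \<forall>\<delta>. 0 < \<delta> \<longrightarrow> \<delta> < \<delta>0 \<longrightarrow> P \<delta>)"
  by (auto simp: eventually_at_right_field)

lemma upper_minkowski_dim_eventually:
  assumes E: "E \<subseteq> {1..2}" "E \<noteq> {}" and dim: "upper_minkowski_dim E = ereal \<beta>" and "0 < \<epsilon>"
  shows "\<exists>\<delta>0>0. \<forall>\<delta>. 0 < \<delta> \<longrightarrow> \<delta> < \<delta>0 \<longrightarrow> ln (real (covering_number E \<delta>)) \<le> (\<beta> + \<epsilon>) * ln (1 / \<delta>)"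
proof -
  have "Limsup (at_right 0) (\<lambda>\<delta>. ereal (ln (real (covering_number E \<delta>)) / ln (1 / \<delta>))) < ereal (\<beta> + \<epsilon>)"
    using dim \<open>0 < \<epsilon>\<close> by (simp add: upper_minkowski_dim_def)
  from Limsup_lessD[OF this] obtain \<delta>0 where \<delta>0: "0 < \<delta>0"
    "\<And>\<delta>. 0 < \<delta> \<Longrightarrow> \<delta> < \<delta>0 \<Longrightarrow> ln (real (covering_number E \<delta>)) / ln (1 / \<delta>) < \<beta> + \<epsilon>"
    unfolding eventually_at_right_0 by auto
  show ?thesis
  proof (intro exI[of _ "min \<delta>0 1"] conjI allI impI)
    fix \<delta> :: real assume "0 < \<delta>" "\<delta> < min \<delta>0 1"
    moreover from this have "0 < ln (1 / \<delta>)" by simp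
    ultimately show "ln (real (covering_number E \<delta>)) \<le> (\<beta> + \<epsilon>) * ln (1 / \<delta>)"
      using \<delta>0(2)[of \<delta>] by (simp add: pos_divide_less_eq)
  qed (use \<delta>0 in auto)
qed

lemma upper_minkowski_dim_frequently:
  assumes dim: "upper_minkowski_dim E = ereal \<beta>" and "0 < \<epsilon>" "0 < \<delta>0"
  shows "\<exists>\<delta>. 0 < \<delta> \<and> \<delta> < \<delta>0 \<and> (\<beta> - \<epsilon>) * ln (1 / \<delta>) \<le> ln (real (covering_number E \<delta>))"
proof (rule ccontr)
  assume contr: "\<not> ?thesis"
  have "eventually (\<lambda>\<delta>. ereal (ln (real (covering_number E \<delta>)) / ln (1 / \<delta>)) \<le> ereal (\<beta> - \<epsilon>)) (at_right 0)"
    unfolding eventually_at_right_0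
  proof (intro exI[of _ "min \<delta>0 1"] conjI allI impI)
    fix \<delta> :: real assume \<delta>: "0 < \<delta>" "\<delta> < min \<delta>0 1"
    then have "0 < ln (1 / \<delta>)" by simp
    moreover have "ln (real (covering_number E \<delta>)) < (\<beta> - \<epsilon>) * ln (1 / \<delta>)"
      using contr \<delta> by (auto simp: not_le)
    ultimately show "ereal (ln (real (covering_number E \<delta>)) / ln (1 / \<delta>)) \<le> ereal (\<beta> - \<epsilon>)"
      by (simp add: pos_divide_le_eq)
  qed (use \<open>0 < \<delta>0\<close> in auto)
  then have "upper_minkowski_dim E \<le> ereal (\<beta> - \<epsilon>)"
    unfolding upper_minkowski_dim_def by (rule Limsup_bounded)
  then show False using dim \<open>0 < \<epsilon>\<close> by simp
qed

text \<open>The crude upper bound 2 comes from 2 / \<open>\<delta>\<close> being at most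
  \<open>\<delta>\<close>^(-2) at small scales; it suffices, because the base point (3/10, 1/5) used
  later satisfies 2 u < 1 + (1 - \<open>\<beta>\<close>) v strictly up to \<open>\<beta>\<close> =
  2.\<close>

lemma upper_minkowski_dim_bounds:
  assumes E: "E \<subseteq> {1..2}" "E \<noteq> {}" and dim: "upper_minkowski_dim E = ereal \<beta>"
  shows "0 \<le> \<beta>" "\<beta> \<le> 2"
proof -
  have "eventually (\<lambda>\<delta>. ereal 0 \<le> ereal (ln (real (covering_number E \<delta>)) / ln (1 / \<delta>))) (at_right 0)"
    unfolding eventually_at_right_0
  proof (intro exI[of _ 1] conjI allI impI)
    fix \<delta> :: real assume \<delta>: "0 < \<delta>" "\<delta> < 1"
    then have "1 \<le> covering_number E \<delta>" using covering_number_pos[OF E(1) _ E(2)] by simp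
    then show "ereal 0 \<le> ereal (ln (real (covering_number E \<delta>)) / ln (1 / \<delta>))"
      using \<delta> by (simp add: divide_nonneg_pos ln_ge_zero)
  qed simp
  then have "ereal 0 \<le> upper_minkowski_dim E"
    unfolding upper_minkowski_dim_def by (intro le_Limsup) auto
  then show "0 \<le> \<beta>" using dim by simp
  have "eventually (\<lambda>\<delta>. ereal (ln (real (covering_number E \<delta>)) / ln (1 / \<delta>)) \<le> ereal 2) (at_right 0)"
    unfolding eventually_at_right_0
  proof (intro exI[of _ "1/2"] conjI allI impI)
    fix \<delta> :: real assume \<delta>: "0 < \<delta>" "\<delta> < 1/2"
    have N: "1 \<le> covering_number E \<delta>" using covering_number_pos[OF E(1) _ E(2)] \<delta> by simp
    have "real (covering_number E \<delta>) \<le> 2 / \<delta>" using covering_number_unit_le[OF E(1)] \<delta> by simp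
    also have "\<dots> \<le> (1 / \<delta>) * (1 / \<delta>)" using \<delta> by (simp add: field_simps)
    finally have "ln (real (covering_number E \<delta>)) \<le> ln ((1 / \<delta>) * (1 / \<delta>))" using N \<delta> by (subst ln_le_cancel_iff) auto
    also have "\<dots> = 2 * ln (1 / \<delta>)" using \<delta> by (subst ln_mult) auto
    finally show "ereal (ln (real (covering_number E \<delta>)) / ln (1 / \<delta>)) \<le> ereal 2"
      using \<delta> by (simp add: pos_divide_le_eq)
  qed simp
  then have "upper_minkowski_dim E \<le> ereal 2"
    unfolding upper_minkowski_dim_def by (rule Limsup_bounded)
  then show "\<beta> \<le> 2" using dim by simp
qed

text \<open>The arguments are ln |J|, ln N(E cap J, \<open>\<delta>\<close>) and ln (1 /
  \<open>\<delta>\<close>), in which power laws become linear. Intervals missing E are excluded,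
  since their covering number 0 would enter through the default value
  \<open>ln 0 = 0\<close>.\<close>

abbreviation at_small_scales :: "real set \<Rightarrow> (real \<Rightarrow> real \<Rightarrow> real \<Rightarrow> bool) \<Rightarrow> bool" where
  "at_small_scales E Q \<equiv> \<exists>\<delta>0>0. \<forall>\<delta> a b. 0 < \<delta> \<longrightarrow> \<delta> < \<delta>0 \<longrightarrow> 1 \<le> a \<longrightarrow> b \<le> 2 \<longrightarrow> \<delta> \<le> b - a \<longrightarrow> b - a \<le> 1 \<longrightarrow>
     E \<inter> {a..b} \<noteq> {} \<longrightarrow> Q (ln (b - a)) (ln (real (covering_number (E \<inter> {a..b}) \<delta>))) (ln (1 / \<delta>))"

text \<open>For \<open>v > 0\<close> this is the inequality between \<open>u\<close>, \<open>v\<close> and \<open>\<nu>\<^sup>\<sharp>\<close> of the main theorem, rewritten so that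
  it is affine in \<open>(u, v)\<close> at each scale.\<close>

definition local_growth :: "real set \<Rightarrow> real \<Rightarrow> real \<Rightarrow> bool" where
  "local_growth E u v \<longleftrightarrow> (\<forall>\<epsilon>>0. at_small_scales E (\<lambda>x y z. (v - 1/2) * x + v * y \<le> (1/2 - u + v + \<epsilon>) * z))"

text \<open>At the origin the condition says no more than |J| being at least
  \<open>\<delta>\<close>. This matches the convention that (0,0) belongs to the right-hand
  side.\<close>

lemma local_growth_zero: "local_growth E 0 0"
  unfolding local_growth_def
proof (intro allI impI exI[of _ "1::real"] conjI)
  fix \<epsilon> \<delta> a b :: real
  assume "0 < \<epsilon>" "0 < \<delta>" "\<delta> < 1" "\<delta> \<le> b - a"
  then have "ln \<delta> \<le> ln (b - a)" "0 \<le> \<epsilon> * ln (1 / \<delta>)" by (auto intro!: mult_nonneg_nonneg)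
  then show "(0 - 1/2) * ln (b - a) + 0 * ln (real (covering_number (E \<inter> {a..b}) \<delta>)) \<le> (1/2 - 0 + 0 + \<epsilon>) * ln (1 / \<delta>)"
    using \<open>0 < \<delta>\<close> by (simp add: ln_div distrib_right)
qed simp

context
  fixes E :: "real set" and \<alpha> :: real
  assumes E: "E \<subseteq> {1..2}" "E \<noteq> {}"
begin

abbreviation nu_index :: "real \<Rightarrow> (real \<times> real) set" where
  "nu_index \<delta> \<equiv> {(a, b). 1 \<le> a \<and> b \<le> 2 \<and> \<delta> \<le> b - a \<and> b - a \<le> 1}"

abbreviation nu_term :: "real \<Rightarrow> real \<times> real \<Rightarrow> real" where
  "nu_term \<delta> \<equiv> \<lambda>(a, b). (b - a) powr (- \<alpha>) * real (covering_number (E \<inter> {a..b}) \<delta>)"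

text \<open>Makes the real supremum in \<open>nu_sharp\<close> a genuine one, so that it dominates
  its terms.\<close>

lemma nu_term_bdd_above:
  assumes "0 < \<delta>" "\<delta> < 1"
  shows "bdd_above (nu_term \<delta> ` nu_index \<delta>)"
proof (rule bdd_aboveI2)
  fix p assume "p \<in> nu_index \<delta>"
  then obtain a b where p: "p = (a, b)" "1 \<le> a" "b \<le> 2" "\<delta> \<le> b - a" "b - a \<le> 1" by auto
  have "(b - a) powr (- \<alpha>) \<le> 1 + \<delta> powr (- \<alpha>)"
  proof (cases "0 \<le> \<alpha>")
    case True
    then have "(b - a) powr (- \<alpha>) \<le> \<delta> powr (- \<alpha>)" using p assms by (intro powr_mono2') auto
    then show ?thesis by simp
  next
    case False
    then have "(b - a) powr (- \<alpha>) \<le> 1" using p assms by (intro powr_le1) auto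
    then show ?thesis by (simp add: add_increasing2)
  qed
  moreover have "real (covering_number (E \<inter> {a..b}) \<delta>) \<le> 2 / \<delta>"
    using covering_number_unit_le[OF E(1)] assms by auto
  ultimately show "nu_term \<delta> p \<le> (1 + \<delta> powr (- \<alpha>)) * (2 / \<delta>)"
    unfolding p(1) prod.case by (intro mult_mono) auto
qed

lemma nu_sup_ge_1:
  assumes "0 < \<delta>" "\<delta> < 1"
  shows "1 \<le> (SUP p\<in>nu_index \<delta>. nu_term \<delta> p)"
proof (rule cSUP_upper2[OF nu_term_bdd_above[OF assms]])
  show "(1, 2) \<in> nu_index \<delta>" using assms by simp
  have "E \<inter> {1..2} = E" using E by auto
  then show "1 \<le> nu_term \<delta> (1, 2)" using covering_number_pos[OF E(1) assms(1) E(2)] by simp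
qed

lemma nu_sharp_eq:
  "nu_sharp E \<alpha> = Limsup (at_right 0) (\<lambda>\<delta>. ereal (ln (SUP p\<in>nu_index \<delta>. nu_term \<delta> p) / ln (1 / \<delta>)))"
  unfolding nu_sharp_def by (simp add: case_prod_unfold)

text \<open>The logarithm of the supremum is compared termwise; uniformity over J is what the
  supremum inside the limit provides. Intervals missing E contribute 0 to the supremum, which is at
  least 1.\<close>

lemma nu_sharp_le_iff:
  "nu_sharp E \<alpha> \<le> ereal K \<longleftrightarrow> (\<forall>\<epsilon>>0. at_small_scales E (\<lambda>x y z. - \<alpha> * x + y \<le> (K + \<epsilon>) * z))" (is "_ \<longleftrightarrow> (\<forall>\<epsilon>>0. ?Q \<epsilon>)")
proof
  assume le: "nu_sharp E \<alpha> \<le> ereal K"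
  show "\<forall>\<epsilon>>0. ?Q \<epsilon>"
  proof (intro allI impI)
    fix \<epsilon> :: real assume "0 < \<epsilon>"
    then have "nu_sharp E \<alpha> < ereal (K + \<epsilon>)" using le by (auto intro: le_less_trans)
    from Limsup_lessD[OF this[unfolded nu_sharp_eq]] obtain \<delta>0 where \<delta>0: "0 < \<delta>0"
      "\<And>\<delta>. 0 < \<delta> \<Longrightarrow> \<delta> < \<delta>0 \<Longrightarrow> ln (SUP p\<in>nu_index \<delta>. nu_term \<delta> p) / ln (1 / \<delta>) < K + \<epsilon>"
      unfolding eventually_at_right_0 by auto
    show "?Q \<epsilon>"
    proof (intro exI[of _ "min \<delta>0 1"] conjI allI impI)
      fix \<delta> a b :: real
      assume \<delta>: "0 < \<delta>" "\<delta> < min \<delta>0 1" and ab: "1 \<le> a" "b \<le> 2" "\<delta> \<le> b - a" "b - a \<le> 1" and ne: "E \<inter> {a..b} \<noteq> {}"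
      have pos: "0 < ln (1 / \<delta>)" using \<delta> by simp
      have "E \<inter> {a..b} \<subseteq> {1..2}" using E by auto
      then have N: "1 \<le> covering_number (E \<inter> {a..b}) \<delta>" using ne \<delta> by (intro covering_number_pos) auto
      have "nu_term \<delta> (a, b) \<le> (SUP p\<in>nu_index \<delta>. nu_term \<delta> p)"
        using ab \<delta> by (intro cSUP_upper nu_term_bdd_above) auto
      moreover have t: "0 < nu_term \<delta> (a, b)" using N ab \<delta> by simp
      ultimately have "ln (nu_term \<delta> (a, b)) \<le> ln (SUP p\<in>nu_index \<delta>. nu_term \<delta> p)"
        by (subst ln_le_cancel_iff) auto
      also have "\<dots> \<le> (K + \<epsilon>) * ln (1 / \<delta>)" using \<delta>0(2)[of \<delta>] \<delta> pos by (simp add: pos_divide_less_eq)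
      also have "ln (nu_term \<delta> (a, b)) = - \<alpha> * ln (b - a) + ln (real (covering_number (E \<inter> {a..b}) \<delta>))"
        using N ab \<delta> by (simp add: ln_mult ln_powr)
      finally show "- \<alpha> * ln (b - a) + ln (real (covering_number (E \<inter> {a..b}) \<delta>)) \<le> (K + \<epsilon>) * ln (1 / \<delta>)" .
    qed (use \<delta>0 in auto)
  qed
next
  assume Q: "\<forall>\<epsilon>>0. ?Q \<epsilon>"
  show "nu_sharp E \<alpha> \<le> ereal K"
  proof (rule ereal_le_epsilon2)
    fix \<epsilon> :: real assume "0 < \<epsilon>"
    with Q obtain \<delta>0 where \<delta>0: "0 < \<delta>0" "\<And>\<delta> a b. 0 < \<delta> \<Longrightarrow> \<delta> < \<delta>0 \<Longrightarrow> 1 \<le> a \<Longrightarrow> b \<le> 2 \<Longrightarrow> \<delta> \<le> b - a \<Longrightarrow> b - a \<le> 1 \<Longrightarrow>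
     E \<inter> {a..b} \<noteq> {} \<Longrightarrow>
     - \<alpha> * ln (b - a) + ln (real (covering_number (E \<inter> {a..b}) \<delta>)) \<le> (K + \<epsilon>) * ln (1 / \<delta>)" by blast
    have "nu_sharp E \<alpha> \<le> ereal (K + \<epsilon>)"
      unfolding nu_sharp_eq
    proof (rule Limsup_bounded)
      show "\<forall>\<^sub>F \<delta> in at_right 0. ereal (ln (SUP p\<in>nu_index \<delta>. nu_term \<delta> p) / ln (1 / \<delta>)) \<le> ereal (K + \<epsilon>)"
        unfolding eventually_at_right_0
      proof (intro exI[of _ "min \<delta>0 1"] conjI allI impI)
        fix \<delta> :: real
        assume \<delta>: "0 < \<delta>" "\<delta> < min \<delta>0 1"
        have pos: "0 < ln (1 / \<delta>)" using \<delta> by simp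
        have "(SUP p\<in>nu_index \<delta>. nu_term \<delta> p) \<le> exp ((K + \<epsilon>) * ln (1 / \<delta>))"
        proof (rule cSUP_least)
          have "(1, 2) \<in> nu_index \<delta>" using \<delta> by simp
          then show "nu_index \<delta> \<noteq> {}" by blast
          fix p assume "p \<in> nu_index \<delta>"
          then obtain a b where p: "p = (a, b)" "1 \<le> a" "b \<le> 2" "\<delta> \<le> b - a" "b - a \<le> 1" by auto
          show "nu_term \<delta> p \<le> exp ((K + \<epsilon>) * ln (1 / \<delta>))"
          proof (cases "E \<inter> {a..b} = {}")
            case True
            have "covering_number (E \<inter> {a..b}) \<delta> \<le> card ({} :: real set)"
              unfolding True by (rule covering_number_le) auto
            then show ?thesis unfolding p(1) by simp
          next
            case False
            have "E \<inter> {a..b} \<subseteq> {1..2}" using E by auto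
            then have N: "1 \<le> covering_number (E \<inter> {a..b}) \<delta>" using False \<delta> by (intro covering_number_pos) auto
            have t: "0 < nu_term \<delta> (a, b)" using N p \<delta> by simp
            have "ln (nu_term \<delta> (a, b)) = - \<alpha> * ln (b - a) + ln (real (covering_number (E \<inter> {a..b}) \<delta>))"
              using N p \<delta> by (simp add: ln_mult ln_powr)
            also have "\<dots> \<le> (K + \<epsilon>) * ln (1 / \<delta>)" using p \<delta> False by (intro \<delta>0(2)) auto
            finally have "exp (ln (nu_term \<delta> (a, b))) \<le> exp ((K + \<epsilon>) * ln (1 / \<delta>))" by (subst exp_le_cancel_iff)
            then show ?thesis using t unfolding p(1) by (subst (asm) exp_ln) auto
          qed
        qed
        then have "ln (SUP p\<in>nu_index \<delta>. nu_term \<delta> p) \<le> ln (exp ((K + \<epsilon>) * ln (1 / \<delta>)))"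
          using nu_sup_ge_1[of \<delta>] \<delta> by (subst ln_le_cancel_iff) (auto intro: less_le_trans[OF zero_less_one])
        then show "ereal (ln (SUP p\<in>nu_index \<delta>. nu_term \<delta> p) / ln (1 / \<delta>)) \<le> ereal (K + \<epsilon>)"
          using pos by (simp add: pos_divide_le_eq)
      qed (use \<delta>0 in auto)
    qed
    then show "nu_sharp E \<alpha> \<le> ereal K + ereal \<epsilon>" by simp
  qed
qed

end

text \<open>Multiplying the inequality at each scale by v turns - (1 / (2 v) - 1) into v - 1/2 and
  makes it affine in (u, v). The tolerance is rescaled by v or 1 / v.\<close>

lemma local_growth_iff_nu_sharp:
  assumes E: "E \<subseteq> {1..2}" "E \<noteq> {}" and v: "0 < v"
  shows "local_growth E u v \<longleftrightarrow> ereal v * nu_sharp E ((1 / v) / 2 - 1) + ereal (u - v) \<le> ereal (1 / 2)"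
proof -
  let ?nu = "nu_sharp E ((1 / v) / 2 - 1)"
  let ?K = "(1/2 - u + v) / v"
  have "ereal v * ?nu + ereal (u - v) \<le> ereal (1 / 2) \<longleftrightarrow> ?nu \<le> ereal ?K"
    using v by (cases ?nu) (auto simp: field_simps)
  also have "\<dots> \<longleftrightarrow> local_growth E u v"
    unfolding nu_sharp_le_iff[OF E] local_growth_def
  proof (intro iffI allI impI)
    fix \<epsilon> :: real assume \<epsilon>: "0 < \<epsilon>"
    have id: "v * (- (1 / v / 2 - 1) * x + y) = (v - 1/2) * x + v * y" "v * ((?K + \<epsilon> / v) * z) = (1/2 - u + v + \<epsilon>) * z"
      "v * ((?K + \<epsilon>) * z) = (1/2 - u + v + \<epsilon> * v) * z" for x y z
      using v by (auto simp: field_simps)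
    {
      assume *: "\<forall>\<epsilon>>0. at_small_scales E (\<lambda>x y z. - (1 / v / 2 - 1) * x + y \<le> (?K + \<epsilon>) * z)"
      have "0 < \<epsilon> / v" using \<epsilon> v by simp
      with * obtain \<delta>0 where \<delta>0: "0 < \<delta>0" "\<And>\<delta> a b. 0 < \<delta> \<Longrightarrow> \<delta> < \<delta>0 \<Longrightarrow> 1 \<le> a \<Longrightarrow> b \<le> 2 \<Longrightarrow> \<delta> \<le> b - a \<Longrightarrow> b - a \<le> 1 \<Longrightarrow>
        E \<inter> {a..b} \<noteq> {} \<Longrightarrow> - (1 / v / 2 - 1) * ln (b - a) + ln (real (covering_number (E \<inter> {a..b}) \<delta>)) \<le> (?K + \<epsilon> / v) * ln (1 / \<delta>)" by blast
      show "at_small_scales E (\<lambda>x y z. (v - 1/2) * x + v * y \<le> (1/2 - u + v + \<epsilon>) * z)"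
        using \<delta>0(1) mult_left_mono[OF \<delta>0(2), of _ _ _ v] v unfolding id by (intro exI[of _ \<delta>0]) auto
    next
      assume *: "\<forall>\<epsilon>>0. at_small_scales E (\<lambda>x y z. (v - 1/2) * x + v * y \<le> (1/2 - u + v + \<epsilon>) * z)"
      have "0 < \<epsilon> * v" using \<epsilon> v by simp
      with * obtain \<delta>0 where \<delta>0: "0 < \<delta>0" "\<And>\<delta> a b. 0 < \<delta> \<Longrightarrow> \<delta> < \<delta>0 \<Longrightarrow> 1 \<le> a \<Longrightarrow> b \<le> 2 \<Longrightarrow> \<delta> \<le> b - a \<Longrightarrow> b - a \<le> 1 \<Longrightarrow>
        E \<inter> {a..b} \<noteq> {} \<Longrightarrow> (v - 1/2) * ln (b - a) + v * ln (real (covering_number (E \<inter> {a..b}) \<delta>)) \<le> (1/2 - u + v + \<epsilon> * v) * ln (1 / \<delta>)" by blast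
      show "at_small_scales E (\<lambda>x y z. - (1 / v / 2 - 1) * x + y \<le> (?K + \<epsilon>) * z)"
      proof (intro exI[of _ \<delta>0] conjI allI impI)
        fix \<delta> a b assume "0 < \<delta>" "\<delta> < \<delta>0" "1 \<le> a" "b \<le> 2" "\<delta> \<le> b - a" "b - a \<le> 1" "E \<inter> {a..b} \<noteq> {}"
        from \<delta>0(2)[OF this] show "- (1 / v / 2 - 1) * ln (b - a) + ln (real (covering_number (E \<inter> {a..b}) \<delta>)) \<le> (?K + \<epsilon>) * ln (1 / \<delta>)"
          unfolding id(1,3)[symmetric] using v by (simp only: mult_le_cancel_left_pos)
      qed (rule \<delta>0)
    }
  qed
  finally show ?thesis ..
qed

lemma radial_triangle_iff:
  assumes "0 \<le> \<beta>"
  shows "(u, v) \<in> radial_triangle \<beta> \<longleftrightarrow> v \<le> u \<and> u \<le> 2 * v \<and> 2 * u \<le> 1 + (1 - \<beta>) * v"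
proof
  assume "(u, v) \<in> radial_triangle \<beta>"
  then obtain a b c where abc: "0 \<le> a" "0 \<le> b" "0 \<le> c" "a + b + c = 1"
    "u = b * (1 / (1 + \<beta>)) + c * (2 / (3 + \<beta>))" "v = b * (1 / (1 + \<beta>)) + c * (1 / (3 + \<beta>))"
    unfolding radial_triangle_def convex_hull_3 by auto
  define s t where "s = b / (1 + \<beta>)" and "t = c / (3 + \<beta>)"
  have st: "0 \<le> s" "0 \<le> t" "b = s * (1 + \<beta>)" "c = t * (3 + \<beta>)" "u = s + 2 * t" "v = s + t"
    using abc assms by (auto simp: s_def t_def)
  have "2 * u - (1 - \<beta>) * v = b + c" unfolding st(3-6) by (simp add: algebra_simps)
  then show "v \<le> u \<and> u \<le> 2 * v \<and> 2 * u \<le> 1 + (1 - \<beta>) * v" using st abc(1,4) by simp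
next
  assume *: "v \<le> u \<and> u \<le> 2 * v \<and> 2 * u \<le> 1 + (1 - \<beta>) * v"
  \<comment> \<open>The barycentric weights of the second and third vertex, obtained by solving for
    them; the weight of (0,0) is the rest, so its sign is the third inequality.\<close>
  define b c where "b = (1 + \<beta>) * (2 * v - u)" and "c = (3 + \<beta>) * (u - v)"
  have "b + c = 2 * u - (1 - \<beta>) * v" by (simp add: b_def c_def algebra_simps)
  then have "0 \<le> b" "0 \<le> c" "0 \<le> 1 - b - c" using * assms by (auto simp: b_def c_def)
  moreover have "b * (1 / (1 + \<beta>)) = 2 * v - u" "c * (1 / (3 + \<beta>)) = u - v" "c * (2 / (3 + \<beta>)) = 2 * (u - v)"
    using assms by (auto simp: b_def c_def)
  ultimately show "(u, v) \<in> radial_triangle \<beta>"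
    unfolding radial_triangle_def convex_hull_3
    by (intro CollectI exI[of _ "1 - b - c"] exI[of _ b] exI[of _ c]) auto
qed

lemma log_scale_large:
  fixes \<delta> M :: real
  assumes "0 < \<delta>" "\<delta> < exp (- M)" shows "M < ln (1 / \<delta>)"
proof -
  have "ln \<delta> < ln (exp (- M))" using assms by (subst ln_less_cancel_iff) auto
  then show ?thesis using assms by (simp add: ln_div)
qed

text \<open>A lower bound valid for exponents of either sign; it serves to absorb scales bounded
  away from 0 into constants.\<close>

lemma powr_abs_exponent_le:
  fixes x y :: real
  assumes "0 < c" "c \<le> x" "x \<le> 1" shows "c powr \<bar>y\<bar> \<le> x powr y"
proof -
  have "c powr \<bar>y\<bar> \<le> x powr \<bar>y\<bar>" using assms by (intro powr_mono2) auto
  also have "\<dots> \<le> x powr y" using assms by (intro powr_mono') auto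
  finally show ?thesis .
qed

section \<open>The two inclusions\<close>

context
  fixes E :: "real set" and \<beta> :: real
  assumes E: "E \<subseteq> {1..2}" "E \<noteq> {}" and dim: "upper_minkowski_dim E = ereal \<beta>"
begin

lemma type_set_in_triangle:
  assumes "(u, v) \<in> radial_type_set E"
  shows "(u, v) \<in> radial_triangle \<beta>"
proof -
  obtain p q where pq: "u = enn2real (1 / p)" "v = enn2real (1 / q)" "1 \<le> p" "1 \<le> q" "max_bounded_rad E p q"
    using assms by (auto simp: radial_type_set_def)
  note ctx = E pq(3,4,5,1,2)
  have v0: "0 \<le> v" using pq by simp
  have "2 * u \<le> 1 + (1 - \<beta>) * v"
  proof (rule ccontr)
    assume "\<not> ?thesis"
    then have g: "0 < 2 * u - 1 - v + \<beta> * v" (is "0 < ?g") by (simp add: algebra_simps)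
    obtain C where C: "0 < C" "\<And>\<delta>. 0 < \<delta> \<Longrightarrow> \<delta> \<le> 1/4 \<Longrightarrow>
      \<delta> * (\<delta> * real (covering_number E \<delta>)) powr v \<le> C * \<delta> powr (2 * u)"
      using necessary_small_balls[OF ctx] by metis
    \<comment> \<open>Chosen so that replacing \<open>\<beta>\<close> by \<open>\<beta>\<close> -
      \<open>\<epsilon>\<close> uses at most half of the violation \<open>?g\<close>; the other half
      beats ln C. Only the scales realising the upper limit are available, hence the single small
      \<open>\<delta>\<close> below.\<close>
    define \<epsilon> where "\<epsilon> = ?g / (2 * (v + 1))"
    have \<epsilon>: "0 < \<epsilon>" "\<epsilon> * v \<le> ?g / 2"
    proof -
      show "0 < \<epsilon>" using g v0 by (simp add: \<epsilon>_def)
      then have "\<epsilon> * v \<le> \<epsilon> * (v + 1)" by simp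
      also have "\<dots> = ?g / 2" using v0 by (simp add: \<epsilon>_def divide_simps)
      finally show "\<epsilon> * v \<le> ?g / 2" .
    qed
    define \<delta>0 where "\<delta>0 = min (1/4) (exp (- (2 * \<bar>ln C\<bar> / ?g)))"
    have "0 < \<delta>0" by (simp add: \<delta>0_def)
    then obtain \<delta> where \<delta>: "0 < \<delta>" "\<delta> < \<delta>0" "(\<beta> - \<epsilon>) * ln (1 / \<delta>) \<le> ln (real (covering_number E \<delta>))"
      using upper_minkowski_dim_frequently[OF dim \<epsilon>(1)] by blast
    define l where "l = ln (1 / \<delta>)"
    have lnd: "ln \<delta> = - l" using \<delta> by (simp add: l_def ln_div)
    have l: "2 * \<bar>ln C\<bar> / ?g < l" unfolding l_def using \<delta> by (intro log_scale_large) (auto simp: \<delta>0_def)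
    let ?N = "real (covering_number E \<delta>)"
    have N: "1 \<le> ?N" using covering_number_pos[OF E(1) \<delta>(1) E(2)] by simp
    have "ln (\<delta> * (\<delta> * ?N) powr v) \<le> ln (C * \<delta> powr (2 * u))"
      using C(2)[of \<delta>] \<delta> N C(1) by (subst ln_le_cancel_iff) (auto simp: \<delta>0_def)
    then have "ln \<delta> + v * (ln \<delta> + ln ?N) \<le> ln C + 2 * u * ln \<delta>"
      using \<delta> N C(1) by (simp add: ln_mult ln_powr)
    moreover have "v * ((\<beta> - \<epsilon>) * l) \<le> v * ln ?N" using \<delta>(3) v0 unfolding l_def by (intro mult_left_mono)
    ultimately have "(?g - \<epsilon> * v) * l \<le> ln C" unfolding lnd by (simp add: algebra_simps)
    moreover have lpos: "0 < l" using l g by (intro le_less_trans[OF _ l]) auto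
    have "?g / 2 * l \<le> (?g - \<epsilon> * v) * l" using \<epsilon> lpos by (intro mult_right_mono) auto
    moreover have "\<bar>ln C\<bar> < ?g / 2 * l" using l g by (simp add: pos_divide_less_eq mult.commute)
    ultimately show False by linarith
  qed
  then show ?thesis
    using radial_triangle_iff[OF upper_minkowski_dim_bounds(1)[OF E dim]]
      necessary_large_balls[OF ctx] necessary_annulus[OF ctx] by simp
qed

text \<open>ln |J| and ln N are both of order at most ln (1 / \<open>\<delta>\<close>), so moving
  (u, v) by d changes the affine inequality by a multiple of d ln (1 / \<open>\<delta>\<close>). The
  condition therefore passes to limits, tolerance included.\<close>

lemma closure_type_set_local_growth:
  assumes cl: "(u, v) \<in> closure (radial_type_set E)"
  shows "local_growth E u v"
  unfolding local_growth_def
proof (intro allI impI)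
  fix \<epsilon> :: real assume \<epsilon>: "0 < \<epsilon>"
  \<comment> \<open>Eight units: two for v in the left-hand side, two for v - u in the right-hand
    side, and four for ln C at small scales.\<close>
  define d where "d = \<epsilon> / 8"
  have d: "0 < d" using \<epsilon> by (simp add: d_def)
  obtain u' v' where uv': "(u', v') \<in> radial_type_set E" "dist (u', v') (u, v) < d"
    using cl d unfolding closure_approachable by (metis surj_pair)
  have du: "\<bar>u' - u\<bar> \<le> d" "\<bar>v' - v\<bar> \<le> d"
    using dist_fst_le[of "(u', v')" "(u, v)"] dist_snd_le[of "(u', v')" "(u, v)"] uv'(2) by (auto simp: dist_real_def)
  obtain p q where pq: "u' = enn2real (1 / p)" "v' = enn2real (1 / q)" "1 \<le> p" "1 \<le> q" "max_bounded_rad E p q"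
    using uv'(1) by (auto simp: radial_type_set_def)
  obtain C where C: "0 < C" "\<And>a R \<delta>. 0 < \<delta> \<Longrightarrow> \<delta> \<le> R \<Longrightarrow> R \<le> 1 \<Longrightarrow> 1 \<le> a \<Longrightarrow> a \<le> 2 \<Longrightarrow>
    R powr (v' - 1/2) * real (covering_number (E \<inter> {a..a+R}) \<delta>) powr v' * \<delta> powr (1/2 + v' - u') \<le> C"
    using necessary_local[OF E pq(3,4,5,1,2)] by metis
  define \<delta>0 where "\<delta>0 = min (1/2) (exp (- (\<bar>ln C\<bar> / (4 * d))))"
  show "at_small_scales E (\<lambda>x y z. (v - 1/2) * x + v * y \<le> (1/2 - u + v + \<epsilon>) * z)"
  proof (intro exI[of _ \<delta>0] conjI allI impI)
    fix \<delta> a b :: real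
    assume \<delta>: "0 < \<delta>" "\<delta> < \<delta>0" and ab: "1 \<le> a" "b \<le> 2" "\<delta> \<le> b - a" "b - a \<le> 1" and ne: "E \<inter> {a..b} \<noteq> {}"
    define l where "l = ln (1 / \<delta>)"
    have lnd: "ln \<delta> = - l" using \<delta> by (simp add: l_def ln_div)
    have l: "\<bar>ln C\<bar> / (4 * d) < l" unfolding l_def using \<delta> by (intro log_scale_large) (auto simp: \<delta>0_def)
    then have lC: "ln C \<le> 4 * d * l" using d by (simp add: pos_divide_less_eq mult.commute)
    have l2: "ln 2 \<le> l" unfolding l_def using \<delta> by (subst ln_le_cancel_iff) (auto simp: \<delta>0_def field_simps)
    define N where "N = real (covering_number (E \<inter> {a..b}) \<delta>)"
    define R where "R = b - a"
    have R: "0 < R" "\<delta> \<le> R" "R \<le> 1" "a + R = b" using ab \<delta> by (auto simp: R_def)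
    have "E \<inter> {a..b} \<subseteq> {1..2}" using E by auto
    then have "1 \<le> covering_number (E \<inter> {a..b}) \<delta>" using ne \<delta> by (intro covering_number_pos) auto
    then have N: "1 \<le> N" by (simp add: N_def)
    have "N \<le> 2 / \<delta>" unfolding N_def using E \<delta> by (intro covering_number_unit_le[of E]) (auto simp: \<delta>0_def)
    then have "ln N \<le> ln (2 / \<delta>)" using N \<delta> by (subst ln_le_cancel_iff) auto
    then have lnN: "0 \<le> ln N" "ln N \<le> ln 2 + l" using N \<delta> by (auto simp: ln_div lnd)
    have "ln \<delta> \<le> ln R" using R \<delta> by (subst ln_le_cancel_iff) auto
    then have lnR: "- l \<le> ln R" "ln R \<le> 0" using R lnd by auto
    have "R powr (v' - 1/2) * N powr v' * \<delta> powr (1/2 + v' - u') \<le> C"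
      using C(2)[of \<delta> R a] R \<delta> ab unfolding N_def by auto
    then have "ln (R powr (v' - 1/2) * N powr v' * \<delta> powr (1/2 + v' - u')) \<le> ln C"
      using R N \<delta> C(1) by (subst ln_le_cancel_iff) auto
    then have main: "(v' - 1/2) * ln R + v' * ln N \<le> ln C + (1/2 + v' - u') * l"
      using R N \<delta> by (simp add: ln_mult ln_powr lnd)
    have "(v - v') * (ln R + ln N) \<le> \<bar>v - v'\<bar> * \<bar>ln R + ln N\<bar>" by (metis abs_ge_self abs_mult)
    also have "\<dots> \<le> d * (2 * l)" using du lnN lnR l2 by (intro mult_mono) auto
    finally have 1: "(v - v') * (ln R + ln N) \<le> 2 * d * l" by simp
    have l0: "0 \<le> l" using l2 ln_ge_zero[of 2] by linarith
    have "(v' - u') * l \<le> (v - u + 2 * d) * l" using du l0 by (intro mult_right_mono) auto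
    then have "(1/2 + v' - u') * l \<le> (1/2 + v - u + 2 * d) * l" by (simp add: algebra_simps)
    then have "(v - 1/2) * ln R + v * ln N \<le> (1/2 + v - u + 8 * d) * l"
      using main 1 lC by (simp add: algebra_simps)
    then show "(v - 1/2) * ln (b - a) + v * ln (real (covering_number (E \<inter> {a..b}) \<delta>)) \<le> (1/2 - u + v + \<epsilon>) * ln (1 / \<delta>)"
      unfolding N_def R_def l_def d_def by (simp add: algebra_simps)
  qed (simp add: \<delta>0_def)
qed

text \<open>The base point \<open>(3/10, 1/5)\<close> satisfies all defining inequalities of the right-hand side strictly
  for every \<open>E\<close>, by the trivial bound \<open>N(E \<inter> J, \<delta>) \<le> 2 |J| / \<delta>\<close>.\<close>

lemma interior_in_type_set:
  assumes tri: "(u, v) \<in> radial_triangle \<beta>" and growth: "local_growth E u v" and \<kappa>: "0 < \<kappa>" "\<kappa> < 1"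
  shows "((1 - \<kappa>) * u + \<kappa> * (3/10), (1 - \<kappa>) * v + \<kappa> * (1/5)) \<in> radial_type_set E"
proof -
  note \<beta> = upper_minkowski_dim_bounds[OF E dim]
  have t: "v \<le> u" "u \<le> 2 * v" "2 * u \<le> 1 + (1 - \<beta>) * v" using tri radial_triangle_iff[OF \<beta>(1)] by auto
  have v0: "0 \<le> v" using t by linarith
  define u' v' where "u' = (1 - \<kappa>) * u + \<kappa> * (3/10)" and "v' = (1 - \<kappa>) * v + \<kappa> * (1/5)"
  have "2 * u \<le> 1 + v" using t(3) mult_nonneg_nonneg[OF \<beta>(1) v0] by (simp add: algebra_simps)
  then have "u \<le> 1" using t(1) by linarith
  then have "(1 - \<kappa>) * u \<le> (1 - \<kappa>) * 1" using \<kappa> by (intro mult_left_mono) auto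
  moreover have "(1 - \<kappa>) * v \<le> (1 - \<kappa>) * u" "0 \<le> (1 - \<kappa>) * v" using \<kappa> t v0 by (auto intro: mult_left_mono)
  ultimately have uv': "0 < v'" "v' < u'" "u' < 1"
    using \<kappa> unfolding u'_def v'_def by (linarith, linarith, simp add: algebra_simps)
  \<comment> \<open>At the base point the trivial bound leaves a slack of 1/10 in the coefficient of
    ln (1 / \<open>\<delta>\<close>), hence \<open>\<kappa>\<close> / 10 at the mixed point. Half of
    it covers the tolerance \<open>\<kappa>\<close> / 20 taken from \<open>growth\<close>, the other
    half is v' \<open>\<eta>\<close>.\<close>
  define P A \<eta> where "P = u' / v'" and "A = P - 1 / (2 * v')" and "\<eta> = \<kappa> / 20 / v'"
  have \<eta>: "0 < \<eta>" using \<kappa> uv' by (simp add: \<eta>_def)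
  have id1: "v' * (\<eta> + A) = \<kappa> / 20 + u' - 1/2" "v' * (P - A - 1) = 1/2 - v'"
    "v' * (\<eta> + 2 * A) = \<kappa> / 20 + 2 * u' - 1"
    using uv' by (auto simp: \<eta>_def A_def P_def field_simps)
  have crude: "\<delta> * real (covering_number F \<delta>) \<le> 2" if "F \<subseteq> E" "0 < \<delta>" "\<delta> \<le> 1" for F \<delta>
    using covering_number_unit_le[OF E(1) that(2,3,1)] that by (simp add: pos_le_divide_eq mult.commute)
  obtain \<delta>1 where \<delta>1: "0 < \<delta>1" "\<And>\<delta> a b. 0 < \<delta> \<Longrightarrow> \<delta> < \<delta>1 \<Longrightarrow> 1 \<le> a \<Longrightarrow> b \<le> 2 \<Longrightarrow> \<delta> \<le> b - a \<Longrightarrow> b - a \<le> 1 \<Longrightarrow>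
     E \<inter> {a..b} \<noteq> {} \<Longrightarrow>
     (v - 1/2) * ln (b - a) + v * ln (real (covering_number (E \<inter> {a..b}) \<delta>)) \<le> (1/2 - u + v + \<kappa> / 20) * ln (1 / \<delta>)"
    using growth \<kappa> unfolding local_growth_def by (metis divide_pos_pos zero_less_numeral)
  obtain \<delta>2 where \<delta>2: "0 < \<delta>2" "\<And>\<delta>. 0 < \<delta> \<Longrightarrow> \<delta> < \<delta>2 \<Longrightarrow> ln (real (covering_number E \<delta>)) \<le> (\<beta> + \<eta>) * ln (1 / \<delta>)"
    using upper_minkowski_dim_eventually[OF E dim \<eta>] by blast
  define c where "c = min (min \<delta>1 \<delta>2) 1"
  have c: "0 < c" "c \<le> 1" "c \<le> \<delta>1" "c \<le> \<delta>2" using \<delta>1 \<delta>2 by (auto simp: c_def)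
  \<comment> \<open>Below the threshold \<open>c\<close> the asymptotic bounds hold with C1; above
    it, \<open>\<delta>\<close> N is at most 2, and C2, C3 compensate for the smallest possible
    values of the powers.\<close>
  define C1 C2 C3 where "C1 = exp (1 / v')" and "C2 = 2 / (c powr \<bar>\<eta> + A\<bar> * c powr \<bar>P - A - 1\<bar>)"
    and "C3 = 2 / c powr \<bar>\<eta> + 2 * A\<bar>"
  have C: "0 < C1" "0 < C2" "0 < C3" "1 \<le> C1" using c uv' by (auto simp: C1_def C2_def C3_def)
  have fine: "\<delta> * real (covering_number (E \<inter> {a..a+L}) \<delta>) \<le> C1 * \<delta> powr (\<eta> + A) * L powr (P - A - 1)"
    if \<delta>: "0 < \<delta>" "\<delta> < c" "\<delta> \<le> L" "L \<le> 1" and a: "1 \<le> a" "a + L \<le> 2" for a L \<delta>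
  proof (cases "E \<inter> {a..a+L} = {}")
    case True
    have "covering_number (E \<inter> {a..a+L}) \<delta> \<le> card ({} :: real set)"
      unfolding True by (rule covering_number_le) auto
    then show ?thesis using C by simp
  next
    case False
    define N where "N = real (covering_number (E \<inter> {a..a+L}) \<delta>)"
    define l where "l = ln (1 / \<delta>)"
    have lnd: "ln \<delta> = - l" using \<delta> by (simp add: l_def ln_div)
    have "E \<inter> {a..a+L} \<subseteq> {1..2}" using E by auto
    then have "1 \<le> covering_number (E \<inter> {a..a+L}) \<delta>" using False \<delta> by (intro covering_number_pos) auto
    then have N: "1 \<le> N" by (simp add: N_def)
    have l0: "0 \<le> l" unfolding l_def using \<delta> c by simp
    have "ln \<delta> \<le> ln L" using \<delta> by (subst ln_le_cancel_iff) auto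
    then have lnL: "- l \<le> ln L" using lnd by simp
    have 1: "(v - 1/2) * ln L + v * ln N \<le> (1/2 - u + v + \<kappa> / 20) * l"
      using \<delta>1(2)[of \<delta> a "a + L"] \<delta> a c False unfolding N_def l_def by auto
    have "N \<le> 2 * L / \<delta>" unfolding N_def using \<delta> by (intro covering_number_interval_le) auto
    then have "ln N \<le> ln (2 * L / \<delta>)" using N \<delta> by (subst ln_le_cancel_iff) auto
    also have "\<dots> = ln 2 + ln L + l" using \<delta> by (simp add: ln_mult ln_div lnd)
    finally have 2: "ln N \<le> ln 2 + ln L + l" .
    \<comment> \<open>The condition at (3/10, 1/5) would allow (2/5) l; the trivial bound for N
      needs only (3/10) l, with 1 absorbing the constant ln 2 / 5.\<close>
    have 3: "(1/5 - 1/2) * ln L + 1/5 * ln N \<le> 3/10 * l + 1" using 2 lnL ln_2_less_1 by simp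
    have "(v' - 1/2) * ln L + v' * ln N
       = (1 - \<kappa>) * ((v - 1/2) * ln L + v * ln N) + \<kappa> * ((1/5 - 1/2) * ln L + 1/5 * ln N)"
      unfolding v'_def by (simp add: field_simps)
    also have "\<dots> \<le> (1 - \<kappa>) * ((1/2 - u + v + \<kappa> / 20) * l) + \<kappa> * (3/10 * l + 1)"
      by (rule add_mono[OF mult_left_mono[OF 1] mult_left_mono[OF 3]]) (use \<kappa> in auto)
    also have "\<dots> = (1/2 - u' + v' - \<kappa> / 20) * l - \<kappa> * \<kappa> / 20 * l + \<kappa>"
      unfolding u'_def v'_def by (simp add: field_simps)
    also have "\<dots> \<le> (1/2 - u' + v' - \<kappa> / 20) * l + 1"
    proof -
      have "0 \<le> \<kappa> * \<kappa> / 20 * l" using \<kappa> l0 by simp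
      then show ?thesis using \<kappa> by linarith
    qed
    finally have ineq: "(v' - 1/2) * ln L + v' * ln N \<le> (1/2 - u' + v' - \<kappa> / 20) * l + 1" .
    have "v' * (1 / v' + (\<eta> + A) * ln \<delta> + (P - A - 1) * ln L)
        = 1 + (v' * (\<eta> + A)) * ln \<delta> + (v' * (P - A - 1)) * ln L"
      using uv' by (simp add: distrib_left mult.assoc)
    then have "v' * (ln \<delta> + ln N) \<le> v' * (1 / v' + (\<eta> + A) * ln \<delta> + (P - A - 1) * ln L)"
      unfolding id1 using ineq by (simp add: lnd algebra_simps)
    then have "ln \<delta> + ln N \<le> 1 / v' + (\<eta> + A) * ln \<delta> + (P - A - 1) * ln L"
      using uv' by (simp only: mult_le_cancel_left_pos)
    also have "\<dots> = ln (C1 * \<delta> powr (\<eta> + A) * L powr (P - A - 1))"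
      using \<delta> by (simp add: C1_def ln_mult ln_powr)
    finally have "ln (\<delta> * N) \<le> ln (C1 * \<delta> powr (\<eta> + A) * L powr (P - A - 1))"
      using \<delta> N by (simp add: ln_mult)
    then show ?thesis unfolding N_def[symmetric] using \<delta> N C by (subst (asm) ln_le_cancel_iff) auto
  qed
  interpret dilation_bounds E P A \<eta> "C1 + C2 + C3"
  proof
    show "E \<subseteq> {1..2}" "0 < \<eta>" "0 \<le> C1 + C2 + C3" using E \<eta> C by auto
    show "1 \<le> P" using uv' by (simp add: P_def)
  next
    fix a L \<delta> :: real assume \<delta>: "0 < \<delta>" "\<delta> \<le> L" "L \<le> 1"
    let ?X = "\<delta> powr (\<eta> + A) * L powr (P - A - 1)"
    have "\<delta> * real (covering_number (E \<inter> {a..a+L}) \<delta>) \<le> (C1 + C2) * ?X"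
    proof (cases "\<delta> < c")
      case True
      \<comment> \<open>\<open>growth\<close> speaks of intervals inside [1,2] only; sliding the
        interval back into [1,2] loses no point of E.\<close>
      define a' where "a' = max 1 (min a (2 - L))"
      have a': "1 \<le> a'" "a' + L \<le> 2" using \<delta> by (auto simp: a'_def)
      have "1 \<le> x" "x \<le> 2" if "x \<in> E" for x using that E by auto
      then have sub: "E \<inter> {a..a+L} \<subseteq> E \<inter> {a'..a'+L}"
        unfolding a'_def by (force simp: max_def min_def)
      have "covering_number (E \<inter> {a..a+L}) \<delta> \<le> covering_number (E \<inter> {a'..a'+L}) \<delta>"
        using \<delta> by (intro covering_number_mono[OF sub, of a' "a' + L"]) auto
      then have "\<delta> * real (covering_number (E \<inter> {a..a+L}) \<delta>) \<le> \<delta> * real (covering_number (E \<inter> {a'..a'+L}) \<delta>)"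
        using \<delta> by (intro mult_left_mono) auto
      also have "\<dots> \<le> C1 * ?X" using fine[OF \<delta>(1) True \<delta>(2,3) a'(1,2)] by (simp add: mult.assoc)
      also have "\<dots> \<le> (C1 + C2) * ?X" using C by (intro mult_right_mono) auto
      finally show ?thesis .
    next
      case False
      have "\<delta> * real (covering_number (E \<inter> {a..a+L}) \<delta>) \<le> 2" using \<delta> by (intro crude) auto
      also have "2 = C2 * (c powr \<bar>\<eta> + A\<bar> * c powr \<bar>P - A - 1\<bar>)" using c by (simp add: C2_def)
      also have "\<dots> \<le> C2 * ?X"
        using False \<delta> c C by (intro mult_left_mono mult_mono powr_abs_exponent_le) auto
      also have "\<dots> \<le> (C1 + C2) * ?X" using C by (intro mult_right_mono) auto
      finally show ?thesis .
    qed
    also have "\<dots> \<le> (C1 + C2 + C3) * ?X" using C by (intro mult_right_mono) auto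
    finally show "\<delta> * real (covering_number (E \<inter> {a..a+L}) \<delta>) \<le> (C1 + C2 + C3) * \<delta> powr (\<eta> + A) * L powr (P - A - 1)"
      by (simp add: mult.assoc)
  next
    fix \<delta> :: real assume \<delta>: "0 < \<delta>" "\<delta> \<le> 1"
    have "\<delta> * real (covering_number E \<delta>) \<le> (C1 + C3) * \<delta> powr (\<eta> + 2 * A)"
    proof (cases "\<delta> < c")
      case True
      define N where "N = real (covering_number E \<delta>)"
      define l where "l = ln (1 / \<delta>)"
      have lnd: "ln \<delta> = - l" using \<delta> by (simp add: l_def ln_div)
      have N: "1 \<le> N" using covering_number_pos[OF E(1) \<delta>(1) E(2)] by (simp add: N_def)
      have l0: "0 \<le> l" unfolding l_def using \<delta> by simp
      have "ln N \<le> (\<beta> + \<eta>) * l" unfolding N_def l_def using \<delta> True c by (intro \<delta>2(2)) auto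
      then have "v' * (ln \<delta> + ln N) \<le> v' * ((\<beta> + \<eta> - 1) * l)"
        using uv' lnd by (intro mult_left_mono) (auto simp: algebra_simps)
      also have "\<dots> = (v' * \<beta> + \<kappa> / 20 - v') * l" using uv' by (simp add: \<eta>_def field_simps)
      also have "\<dots> \<le> (1 - 2 * u' - \<kappa> / 20) * l"
      proof (intro mult_right_mono l0)
        \<comment> \<open>The third edge inequality is mixed in the same way: with
          \<open>\<beta>\<close> at most 2 its slack at the base point is at least 1/5, and
          \<open>\<kappa>\<close> / 10 of it is used.\<close>
        have "(1 - \<kappa>) * (2 * u) \<le> (1 - \<kappa>) * (1 + (1 - \<beta>) * v)" using t \<kappa> by (intro mult_left_mono) auto
        moreover have "\<kappa> * \<beta> \<le> \<kappa> * 2" using \<beta> \<kappa> by (intro mult_left_mono) auto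
        moreover have "v' * \<beta> + \<kappa> / 20 - v' - (1 - 2 * u' - \<kappa> / 20)
            = (1 - \<kappa>) * (2 * u) - (1 - \<kappa>) * (1 + (1 - \<beta>) * v) + \<kappa> * \<beta> / 5 - \<kappa> / 2"
          unfolding u'_def v'_def by (simp add: field_simps)
        ultimately show "v' * \<beta> + \<kappa> / 20 - v' \<le> 1 - 2 * u' - \<kappa> / 20" using \<kappa> by linarith
      qed
      also have "\<dots> = v' * ((\<eta> + 2 * A) * ln \<delta>)"
        unfolding mult.assoc[symmetric] id1 lnd by (simp add: algebra_simps)
      finally have "ln \<delta> + ln N \<le> (\<eta> + 2 * A) * ln \<delta>" using uv' by (simp only: mult_le_cancel_left_pos)
      then have "ln (\<delta> * N) \<le> ln (\<delta> powr (\<eta> + 2 * A))" using \<delta> N by (simp add: ln_mult ln_powr)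
      then have "\<delta> * N \<le> 1 * \<delta> powr (\<eta> + 2 * A)" using \<delta> N by (subst (asm) ln_le_cancel_iff) auto
      also have "\<dots> \<le> (C1 + C3) * \<delta> powr (\<eta> + 2 * A)" using C by (intro mult_right_mono) auto
      finally show ?thesis unfolding N_def .
    next
      case False
      have "\<delta> * real (covering_number E \<delta>) \<le> 2" using \<delta> by (intro crude) auto
      also have "2 = C3 * c powr \<bar>\<eta> + 2 * A\<bar>" using c by (simp add: C3_def)
      also have "\<dots> \<le> C3 * \<delta> powr (\<eta> + 2 * A)"
        using False \<delta> c C by (intro mult_left_mono powr_abs_exponent_le) auto
      also have "\<dots> \<le> (C1 + C3) * \<delta> powr (\<eta> + 2 * A)" using C by (intro mult_right_mono) auto
      finally show ?thesis .
    qed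
    also have "\<dots> \<le> (C1 + C2 + C3) * \<delta> powr (\<eta> + 2 * A)" using C by (intro mult_right_mono) auto
    finally show "\<delta> * real (covering_number E \<delta>) \<le> (C1 + C2 + C3) * \<delta> powr (\<eta> + 2 * A)" .
  qed
  have "max_bounded_rad E (ennreal (1 / u')) (ennreal (1 / v'))"
    by (rule max_bounded_rad_of_exponents[OF uv' P_def A_def])
  moreover have "enn2real (1 / ennreal (1 / u')) = u'" "enn2real (1 / ennreal (1 / v')) = v'"
    using uv' by (simp_all add: divide_ennreal ennreal_1[symmetric] del: ennreal_1)
  moreover have "1 \<le> ennreal (1 / u')" "1 \<le> ennreal (1 / v')"
    using uv' by (simp_all add: ennreal_1[symmetric] ennreal_leI del: ennreal_1)
  ultimately have "(u', v') \<in> radial_type_set E"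
    unfolding radial_type_set_def by (intro CollectI exI[of _ "ennreal (1 / u')"] exI[of _ "ennreal (1 / v')"]) auto
  then show ?thesis unfolding u'_def v'_def .
qed

lemma local_growth_in_closure:
  assumes "(u, v) \<in> radial_triangle \<beta>" "local_growth E u v"
  shows "(u, v) \<in> closure (radial_type_set E)"
  unfolding closure_approachable
proof (intro allI impI)
  fix e :: real assume e: "0 < e"
  define m where "m = norm ((3/10, 1/5) - (u, v))"
  define \<kappa> where "\<kappa> = min (1/2) (e / (2 * (m + 1)))"
  have m: "0 \<le> m" by (simp add: m_def)
  have \<kappa>: "0 < \<kappa>" "\<kappa> < 1" using e m by (auto simp: \<kappa>_def)
  let ?y = "((1 - \<kappa>) * u + \<kappa> * (3/10), (1 - \<kappa>) * v + \<kappa> * (1/5))"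
  have "?y - (u, v) = \<kappa> *\<^sub>R ((3/10, 1/5) - (u, v))" by (simp add: algebra_simps)
  then have "dist ?y (u, v) = \<kappa> * m" using \<kappa> by (simp add: dist_norm m_def del: diff_Pair)
  also have "\<dots> \<le> e / (2 * (m + 1)) * m" using m by (intro mult_right_mono) (auto simp: \<kappa>_def)
  also have "\<dots> < e"
  proof -
    have "e * m < e * (2 * (m + 1))" using e m by (intro mult_strict_left_mono) auto
    then show ?thesis using m by (simp add: pos_divide_less_eq)
  qed
  finally show "\<exists>y\<in>radial_type_set E. dist y (u, v) < e"
    using interior_in_type_set[OF assms \<kappa>] by blast
qed

end

theorem theorem1p2:
  fixes E :: "real set" and \<beta> :: real
  assumes "E \<subseteq> {1..2}" and "E \<noteq> {}"
    and "upper_minkowski_dim E = ereal \<beta>"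
  shows "closure (radial_type_set E) =
    radial_triangle \<beta> \<inter>
      {(u, v). (u, v) = (0, 0) \<or>
         v > 0 \<and> ereal v * nu_sharp E ((1 / v) / 2 - 1) + ereal (u - v) \<le> ereal (1 / 2)}"
proof (intro subset_antisym subsetI)
  note \<beta> = upper_minkowski_dim_bounds(1)[OF assms]
  fix x assume x: "x \<in> closure (radial_type_set E)"
  obtain u v where uv: "x = (u, v)" by force
  have "radial_type_set E \<subseteq> radial_triangle \<beta>"
    using type_set_in_triangle[OF assms] by auto
  moreover have "closed (radial_triangle \<beta>)"
    unfolding radial_triangle_def by (intro compact_imp_closed finite_imp_compact_convex_hull) simp
  ultimately have tri: "(u, v) \<in> radial_triangle \<beta>" using x uv closure_minimal by blast
  \<comment> \<open>The inequalities v <= u <= 2 v make v nonnegative, and v = 0 forces u =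
    0.\<close>
  then have "(u, v) = (0, 0) \<or> 0 < v" using radial_triangle_iff[OF \<beta>] by auto
  moreover have "local_growth E u v"
    using closure_type_set_local_growth[OF assms] x uv by simp
  ultimately show "x \<in> radial_triangle \<beta> \<inter>
      {(u, v). (u, v) = (0, 0) \<or>
         v > 0 \<and> ereal v * nu_sharp E ((1 / v) / 2 - 1) + ereal (u - v) \<le> ereal (1 / 2)}"
    using tri local_growth_iff_nu_sharp[OF assms(1,2)] unfolding uv by auto
next
  fix x assume "x \<in> radial_triangle \<beta> \<inter>
      {(u, v). (u, v) = (0, 0) \<or>
         v > 0 \<and> ereal v * nu_sharp E ((1 / v) / 2 - 1) + ereal (u - v) \<le> ereal (1 / 2)}"
  then obtain u v where uv: "x = (u, v)" "(u, v) \<in> radial_triangle \<beta>" "(u, v) = (0, 0) \<or>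
         v > 0 \<and> ereal v * nu_sharp E ((1 / v) / 2 - 1) + ereal (u - v) \<le> ereal (1 / 2)" by auto
  then have "local_growth E u v"
    using local_growth_zero local_growth_iff_nu_sharp[OF assms(1,2)] by auto
  then show "x \<in> closure (radial_type_set E)"
    using local_growth_in_closure[OF assms uv(2)] uv(1) by simp
qed

end
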